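(* Let $c>30$ and let $n>0$ be an integer with $n>\frac{2c}{\pi}+5$. Let $t_1<\dots<t_n$ be the roots of $\psi_n$ in $(-1,1)$, and define $I:(-1,1)\to\mathbb R$ (at points $t\ne t_j$) by $$I(t)=\frac{1}{\psi_n(t)}-\sum_{j=1}^n\frac{1}{\psi_n'(t_j)(t-t_j)}.$$ Then for all $t$, $$|I(t)|\le|\lambda_n|\Big(24\log\frac{2}{|\lambda_n|}+13\chi_n^{1/4}+40c|\lambda_n|+2\sqrt2\Big).$$
   Context: For a real number $c>0$, let $F_c[\varphi](x)=\int_{-1}^1\varphi(t)e^{icxt}\,dt$ on $L^2[-1,1]$, with eigenvalues $\lambda_0,\lambda_1,\dots$ ordered so that $|\lambda_n|\ge|\lambda_{n+1}|$ (nonzero, simple) and corresponding real eigenfunctions $\psi_0,\psi_1,\dots$ (prolate spheroidal wave functions) with $\|\psi_n\|_{L^2[-1,1]}=1$; $\psi_n$ has the parity of $n$ and exactly $n$ simple roots in $(-1,1)$. $\chi_0<\chi_1<\dots$ are the positive numbers such that $\psi_n$ satisfies $(1-x^2)\psi''(x)-2x\psi'(x)+(\chi_n-c^2x^2)\psi(x)=0$. *)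

theory Defs
  imports "HOL-Analysis.Analysis"
begin

definition finite_fourier :: "real \<Rightarrow> (real \<Rightarrow> real) \<Rightarrow> real \<Rightarrow> complex" where
  "finite_fourier c \<phi> x =
     integral {-1..1} (\<lambda>t. complex_of_real (\<phi> t) * exp (\<i> * complex_of_real (c * x * t)))"

definition pswf_system ::
  "real \<Rightarrow> (nat \<Rightarrow> real \<Rightarrow> real) \<Rightarrow> (nat \<Rightarrow> complex) \<Rightarrow> (nat \<Rightarrow> real) \<Rightarrow> bool" where
  "pswf_system c psi lam chi \<longleftrightarrow>
     (\<forall>n. continuous_on {-1..1} (psi n)
       \<and> (\<forall>x\<in>{-1..1}. finite_fourier c (psi n) x = lam n * complex_of_real (psi n x))
       \<and> lam n \<noteq> 0
       \<and> norm (lam n) \<ge> norm (lam (Suc n))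
       \<and> integral {-1..1} (\<lambda>t. (psi n t)\<^sup>2) = 1
       \<and> (\<forall>x\<in>{-1..1}. psi n (-x) = (-1) ^ n * psi n x)
       \<and> finite {t\<in>{-1<..<1}. psi n t = 0}
       \<and> card {t\<in>{-1<..<1}. psi n t = 0} = n
       \<and> (\<forall>x\<in>{-1<..<1}. psi n differentiable (at x)
             \<and> deriv (psi n) differentiable (at x))
       \<and> (\<forall>t\<in>{-1<..<1}. psi n t = 0 \<longrightarrow> deriv (psi n) t \<noteq> 0)
       \<and> (\<forall>x\<in>{-1<..<1}. (1 - x\<^sup>2) * deriv (deriv (psi n)) x - 2 * x * deriv (psi n) x
             + (chi n - c\<^sup>2 * x\<^sup>2) * psi n x = 0)
       \<and> 0 < chi n \<and> chi n < chi (Suc n))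
     \<and> inj lam"

end

theory Submission
  imports Defs "HOL-Complex_Analysis.Complex_Analysis"
begin

text \<open>
  The eigenvalue equation extends \<open>\<psi>\<^sub>n\<close> to an entire function \<open>F\<close> that satisfies
  \<open>((z\<^sup>2 - 1) F')' = (k - c\<^sup>2 (z\<^sup>2 - 1)) F\<close> with \<open>k = \<chi>\<^sub>n - c\<^sup>2\<close>. Counting zeros by Sturm comparison gives \<open>k > 0\<close>,
  and then all zeros of \<open>F\<close> are real. Let \<open>a > 1\<close> be the first critical point of \<open>\<Phi> = sqrt (x\<^sup>2 - 1) F\<close> on the
  right of \<open>1\<close>. By the residue theorem \<open>2 \<pi> \<i> I(t)\<close> is the integral of \<open>1 / (F(z) (z - t))\<close> over the lines
  \<open>Re z = \<plusminus>a\<close>. On these lines \<open>\<bar>\<Phi>\<bar>\<close> grows quadratically by a convexity argument, and at the real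
  point \<open>a\<close> it is compared, through a decreasing energy, with its amplitude at infinity, which
  integration by parts in the eigenvalue equation identifies as
  \<open>2 \<bar>F(1)\<bar> / (c \<bar>\<lambda>\<^sub>n\<bar>)\<close>. Together with \<open>c a \<le> 2 sqrt \<chi>\<^sub>n\<close> this gives \<open>\<bar>I(t)\<bar> \<le> 13 \<bar>\<lambda>\<^sub>n\<bar> \<chi>\<^sub>n\<^sup>1\<^sup>/\<^sup>4\<close>; the other terms
  of the bound are nonnegative because \<open>\<bar>\<lambda>\<^sub>n\<bar> \<le> 2\<close>.
\<close>

section \<open>The spheroidal wave equation\<close>

text \<open>The lines are placed at a critical point for the following reason. Along z = a + i y the
  function \<Phi> satisfies w'' = V w in y, and Re V >= 0 makes |w| convex; the vanishing slope at y
  = 0 then makes the value at the real point a the minimum over the whole line. The obstacle is the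
  term 1 / (z^2 - 1)^2 of V. Its real part can be negative off the real axis, and on the axis it
  spoils the monotonicity of the natural energy. It can be absorbed once a lies beyond the turning
  point c^2 (x^2 - 1) = k by a definite amount; \<open>turning_gap\<close> and its consequence
  \<open>P_gap\<close> supply this and are used both for the growth on the lines and for the energy.
  The normalisation enters through F(1)^2 >= 1/2: for k > 0 the eigenfunction has its largest
  modulus on [-1,1] at the endpoints. The final estimate is I(t)^2 <= 62 c a |\<lambda>|^2, kept in
  squared form to avoid nested roots; with c a <= 2 sqrt \<chi> and 124 <= 13^2 it yields the
  exponent 1/4 and the constant 13.\<close>

text \<open>\<open>G\<close> is \<open>F'\<close> and \<open>k\<close> is \<open>\<chi> - c\<^sup>2\<close>; the self-adjoint form of the equation avoids second derivatives.\<close>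
locale spheroidal =
  fixes c k :: real and F G :: "complex \<Rightarrow> complex"
  assumes c_gt: "c > 1"
    and F_deriv: "\<And>z. (F has_field_derivative G z) (at z)"
    and pG_deriv: "\<And>z. ((\<lambda>z. (z\<^sup>2 - 1) * G z) has_field_derivative
      (of_real k - of_real (c\<^sup>2) * (z\<^sup>2 - 1)) * F z) (at z)"
    and F_cnj: "\<And>z. F (cnj z) = cnj (F z)"
begin

definition f :: "real \<Rightarrow> real" where "f x = Re (F (of_real x))"
definition g :: "real \<Rightarrow> real" where "g x = Re (G (of_real x))"

lemma G_cnj: "G (cnj z) = cnj (G z)"
proof -
  have "((cnj \<circ> F \<circ> cnj) has_field_derivative cnj (G (cnj z))) (at z)"
    using has_field_derivative_cnj_cnj[of F "G (cnj z)" z] F_deriv by simp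
  moreover have "cnj \<circ> F \<circ> cnj = F"
    by (auto simp: fun_eq_iff F_cnj)
  ultimately have "cnj (G (cnj z)) = G z"
    using F_deriv DERIV_unique by metis
  then show ?thesis by (metis complex_cnj_cnj)
qed

lemma F_of_real: "F (of_real x) = of_real (f x)"
proof -
  have "F (of_real x) \<in> \<real>"
    by (simp add: Reals_cnj_iff F_cnj[symmetric])
  then show ?thesis by (simp add: f_def of_real_Re)
qed

lemma G_of_real: "G (of_real x) = of_real (g x)"
proof -
  have "G (of_real x) \<in> \<real>"
    by (simp add: Reals_cnj_iff G_cnj[symmetric])
  then show ?thesis by (simp add: g_def of_real_Re)
qed

lemma f_deriv: "(f has_real_derivative g x) (at x)"
proof -
  have "((\<lambda>x. F (of_real x)) has_vector_derivative G (of_real x)) (at x)"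
    by (intro has_vector_derivative_real_field F_deriv)
  from has_field_derivative_Re[OF this] show ?thesis
    by (simp add: f_def[abs_def] g_def)
qed

lemma pg_deriv:
  "((\<lambda>x. (x\<^sup>2 - 1) * g x) has_real_derivative (k - c\<^sup>2 * (x\<^sup>2 - 1)) * f x) (at x)"
proof -
  have "((\<lambda>x. ((of_real x)\<^sup>2 - 1) * G (of_real x)) has_vector_derivative
     (of_real k - of_real (c\<^sup>2) * ((of_real x)\<^sup>2 - 1)) * F (of_real x)) (at x)"
    by (intro has_vector_derivative_real_field pG_deriv)
  from has_field_derivative_Re[OF this] show ?thesis
    by (simp add: F_of_real G_of_real)
qed

lemma f_cont [continuous_intros]: "continuous_on A u \<Longrightarrow> continuous_on A (\<lambda>x. f (u x))"
proof -
  have "continuous_on UNIV f"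
    by (meson DERIV_isCont f_deriv continuous_at_imp_continuous_on)
  then show "continuous_on A u \<Longrightarrow> continuous_on A (\<lambda>x. f (u x))"
    by (rule continuous_on_compose2) auto
qed

lemma g_deriv:
  assumes "x\<^sup>2 \<noteq> 1"
  shows "(g has_real_derivative ((k - c\<^sup>2 * (x\<^sup>2 - 1)) * f x - 2 * x * g x) / (x\<^sup>2 - 1)) (at x)"
proof -
  let ?S = "{y::real. y\<^sup>2 \<noteq> 1}"
  have *: "((\<lambda>x. ((x\<^sup>2 - 1) * g x) / (x\<^sup>2 - 1)) has_real_derivative
     ((k - c\<^sup>2 * (x\<^sup>2 - 1)) * f x * (x\<^sup>2 - 1) - ((x\<^sup>2 - 1) * g x) * (2 * x)) / ((x\<^sup>2 - 1) * (x\<^sup>2 - 1))) (at x)"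
    using assms by (intro DERIV_divide pg_deriv) (auto intro!: derivative_eq_intros)
  have "open ?S" 
    by (intro open_Collect_neq continuous_intros)
  then have "(g has_real_derivative
     ((k - c\<^sup>2 * (x\<^sup>2 - 1)) * f x * (x\<^sup>2 - 1) - ((x\<^sup>2 - 1) * g x) * (2 * x)) / ((x\<^sup>2 - 1) * (x\<^sup>2 - 1))) (at x)"
    using assms by (intro has_field_derivative_transform_within_open[OF *, of ?S]) auto
  then show ?thesis
  proof (rule DERIV_cong)
    define q where "q = x\<^sup>2 - 1"
    have "q \<noteq> 0" using assms by (simp add: q_def)
    then show "((k - c\<^sup>2 * (x\<^sup>2 - 1)) * f x * (x\<^sup>2 - 1) - ((x\<^sup>2 - 1) * g x) * (2 * x)) / ((x\<^sup>2 - 1) * (x\<^sup>2 - 1))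
      = ((k - c\<^sup>2 * (x\<^sup>2 - 1)) * f x - 2 * x * g x) / (x\<^sup>2 - 1)"
      unfolding q_def[symmetric] by (simp add: field_simps)
  qed
qed

text \<open>Identity theorem for the entire function \<open>F\<close>. The comparison arguments
  below end with \<open>f\<close> vanishing on an interval, and this turns that conclusion into a
  contradiction.\<close>

lemma f_not_identically_zero:
  assumes "f x0 \<noteq> 0" "a < b"
  shows "\<exists>x\<in>{a<..<b}. f x \<noteq> 0"
proof (rule ccontr)
  assume "\<not> ?thesis"
  then have z: "\<And>x. x \<in> {a<..<b} \<Longrightarrow> F (of_real x) = 0"
    by (auto simp: F_of_real)
  define m where "m = (a + b) / 2"
  have m: "m \<in> {a<..<b}" using assms by (auto simp: m_def field_simps)
  have "F holomorphic_on UNIV"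
    using F_deriv has_field_derivative_at_within unfolding holomorphic_on_def field_differentiable_def by blast
  moreover have "(of_real m :: complex) islimpt (of_real ` {a<..<b})"
  proof -
    have "m islimpt {a<..<b}" using m by (simp add: interior_limit_point interior_open)
    show ?thesis
      unfolding islimpt_approachable
    proof (intro allI impI)
      fix e :: real assume "e > 0"
      then obtain y where "y \<in> {a<..<b}" "y \<noteq> m" "dist y m < e"
        using \<open>m islimpt {a<..<b}\<close> unfolding islimpt_approachable by blast
      then show "\<exists>x'\<in>of_real ` {a<..<b}. x' \<noteq> (of_real m :: complex) \<and> dist x' (of_real m) < e"
        by (intro bexI[of _ "of_real y"]) (simp_all add: dist_of_real)
    qed
  qed
  ultimately have "F (of_real x0) = 0"
    using z analytic_continuation[of F UNIV "of_real ` {a<..<b}" "of_real m" "of_real x0"] by blast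
  then show False using assms by (simp add: F_of_real)
qed

text \<open>Picone's identity, with the logarithmic derivative of the comparison function encoded in the
  Riccati expression \<open>R\<close>.\<close>
lemma riccati_comparison:
  assumes ab: "a < b" "-1 \<le> a" "b \<le> 1"
    and R: "\<And>x. x \<in> {a..b} \<Longrightarrow> (R has_real_derivative R' x) (at x)"
    and ric: "\<And>x. x \<in> {a<..<b} \<Longrightarrow> R' x + (R x)\<^sup>2 / (1 - x\<^sup>2) + k + c\<^sup>2 * (1 - x\<^sup>2) < 0"
    and fa: "f a = 0" and Kb: "(1 - b\<^sup>2) * g b * f b = (f b)\<^sup>2 * R b"
    and x: "x \<in> {a<..<b}"
  shows "f x = 0"
proof -
  \<comment> \<open>For \<open>R\<close> = (1 - x^2) v'/v this is (1 - x^2) f (f v' - f' v) / v. The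
    hypothesis on \<open>R'\<close> says that v is a strict supersolution of the equation of
    \<open>f\<close>, so \<open>K\<close> is decreasing.\<close>
  define K where "K = (\<lambda>x. ((x\<^sup>2 - 1) * g x) * f x + (f x)\<^sup>2 * R x)"
  define K' where "K' = (\<lambda>x. (k - c\<^sup>2 * (x\<^sup>2 - 1)) * (f x)\<^sup>2 + (x\<^sup>2 - 1) * (g x)\<^sup>2
     + 2 * f x * g x * R x + (f x)\<^sup>2 * R' x)"
  have Kd: "(K has_real_derivative K' x) (at x)" if "x \<in> {a..b}" for x
    unfolding K_def K'_def
    by (rule derivative_eq_intros refl pg_deriv R[OF that] f_deriv)+ (simp add: power2_eq_square algebra_simps)
  have K'eq: "K' x = - (1 - x\<^sup>2) * (g x - f x * R x / (1 - x\<^sup>2))\<^sup>2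
     + (f x)\<^sup>2 * (R' x + (R x)\<^sup>2 / (1 - x\<^sup>2) + k + c\<^sup>2 * (1 - x\<^sup>2))" and q: "1 - x\<^sup>2 > 0"
    if "x \<in> {a<..<b}" for x
  proof -
    have "\<bar>x\<bar> < 1" using that ab by (simp add: abs_less_iff)
    then have "x\<^sup>2 < 1" by (simp add: abs_square_less_1)
    then show "1 - x\<^sup>2 > 0" by simp
    then have e: "(1 - x\<^sup>2) * (R x / (1 - x\<^sup>2)) = R x" "(R x)\<^sup>2 / (1 - x\<^sup>2) = R x * (R x / (1 - x\<^sup>2))"
      by (auto simp: power2_eq_square)
    define S where "S = R x / (1 - x\<^sup>2)"
    have S: "R x = (1 - x\<^sup>2) * S" using e(1) by (simp add: S_def)
    have "f x * R x / (1 - x\<^sup>2) = f x * S" by (simp add: S_def)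
    then show "K' x = - (1 - x\<^sup>2) * (g x - f x * R x / (1 - x\<^sup>2))\<^sup>2
     + (f x)\<^sup>2 * (R' x + (R x)\<^sup>2 / (1 - x\<^sup>2) + k + c\<^sup>2 * (1 - x\<^sup>2))"
      unfolding K'_def e(2) S_def[symmetric] by (simp add: S power2_eq_square algebra_simps)
  qed
  have K'le: "K' x \<le> 0" if "x \<in> {a<..<b}" for x
  proof -
    have "- (1 - x\<^sup>2) * (g x - f x * R x / (1 - x\<^sup>2))\<^sup>2 \<le> 0"
      by (rule mult_nonpos_nonneg) (use q[OF that] in auto)
    moreover have "(f x)\<^sup>2 * (R' x + (R x)\<^sup>2 / (1 - x\<^sup>2) + k + c\<^sup>2 * (1 - x\<^sup>2)) \<le> 0"
      by (rule mult_nonneg_nonpos) (use ric[OF that] in auto)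
    ultimately show ?thesis
      unfolding K'eq[OF that] by (rule add_nonpos_nonpos)
  qed
  have anti: "K y \<le> K x" if "a \<le> x" "x \<le> y" "y \<le> b" for x y
  proof (cases "x = y")
    case False
    show ?thesis
    proof (rule DERIV_nonpos_imp_decreasing_open[of x y K])
      show "x \<le> y" using that by simp
      fix z assume "x < z" "z < y"
      then have "z \<in> {a..b}" "z \<in> {a<..<b}" using that by auto
      then show "\<exists>y. (K has_real_derivative y) (at z) \<and> y \<le> 0"
        using K'le Kd by blast
    next
      show "continuous_on {x..y} K"
        using that by (intro DERIV_continuous_on[OF has_field_derivative_at_within[OF Kd]]) auto
    qed
  qed simp
  \<comment> \<open>A decreasing function that vanishes at both ends is constant, so
    \<open>K'\<close> = 0. Both summands of \<open>K'\<close> are nonpositive, and the strictly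
    negative coefficient of f^2 forces \<open>f\<close> to vanish. The condition at \<open>b\<close>
    covers a zero of \<open>f\<close> as well as the singular endpoint b = 1 with R 1 = 0.\<close>
  have "K a = 0" using fa by (simp add: K_def)
  moreover have "K b = 0" using Kb by (simp add: K_def algebra_simps)
  ultimately have K0: "K y = 0" if "y \<in> {a..b}" for y
    using anti[of a y] anti[of y b] that by auto
  have "(K has_real_derivative 0) (at x)"
  proof (rule has_field_derivative_transform_within_open[where f = "\<lambda>_. 0" and S = "{a<..<b}"])
    show "\<And>y. y \<in> {a<..<b} \<Longrightarrow> 0 = K y" using K0 by auto
  qed (use x in auto)
  then have "K' x = 0" using Kd[of x] x DERIV_unique by fastforce
  moreover have "- (1 - x\<^sup>2) * (g x - f x * R x / (1 - x\<^sup>2))\<^sup>2 \<le> 0"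
    by (rule mult_nonpos_nonneg) (use q[OF x] in auto)
  ultimately have "\<not> (f x)\<^sup>2 * (R' x + (R x)\<^sup>2 / (1 - x\<^sup>2) + k + c\<^sup>2 * (1 - x\<^sup>2)) < 0"
    unfolding K'eq[OF x] by (metis add_nonpos_neg less_irrefl)
  then have "\<not> (f x)\<^sup>2 > 0"
    using mult_pos_neg[OF _ ric[OF x]] by blast
  then show ?thesis by simp
qed

end

section \<open>Counting zeros when \<open>\<chi> \<le> c\<^sup>2\<close>\<close>

text \<open>Pigeonhole: values at mutual distance at least \<open>d\<close> have distinct floors
  after shifting by \<open>lo\<close> and dividing by \<open>d\<close>.\<close>

lemma card_le_of_separated:
  fixes \<theta> :: "'a \<Rightarrow> real"
  assumes "finite Z" "d > 0" "lo \<le> hi"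
    and range: "\<And>x. x \<in> Z \<Longrightarrow> lo \<le> \<theta> x \<and> \<theta> x \<le> hi"
    and sep: "\<And>x y. x \<in> Z \<Longrightarrow> y \<in> Z \<Longrightarrow> x \<noteq> y \<Longrightarrow> \<bar>\<theta> x - \<theta> y\<bar> \<ge> d"
  shows "real (card Z) \<le> (hi - lo) / d + 1"
proof -
  define h where "h x = \<lfloor>(\<theta> x - lo) / d\<rfloor>" for x
  have "inj_on h Z"
  proof (rule inj_onI, rule ccontr)
    fix x y assume xy: "x \<in> Z" "y \<in> Z" "h x = h y" "x \<noteq> y"
    have "\<bar>(\<theta> x - lo) / d - (\<theta> y - lo) / d\<bar> < 1"
      using xy(3) unfolding h_def by linarith
    then have "\<bar>\<theta> x - \<theta> y\<bar> < d"
      using \<open>d > 0\<close> by (simp add: diff_divide_distrib[symmetric] divide_less_eq)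
    with sep xy show False by fastforce
  qed
  moreover have "h ` Z \<subseteq> {0..\<lfloor>(hi - lo) / d\<rfloor>}"
    using range \<open>d > 0\<close> by (auto simp: h_def intro!: floor_mono divide_right_mono)
  ultimately have "card Z \<le> card {0..\<lfloor>(hi - lo) / d\<rfloor>}"
    using card_inj_on_le by blast
  then have "card Z \<le> nat (\<lfloor>(hi - lo) / d\<rfloor> + 1)"
    by simp
  moreover have "0 \<le> \<lfloor>(hi - lo) / d\<rfloor>"
    using \<open>d > 0\<close> \<open>lo \<le> hi\<close> by simp
  then have "0 \<le> \<lfloor>(hi - lo) / d\<rfloor> + 1" by linarith
  ultimately have "int (card Z) \<le> \<lfloor>(hi - lo) / d\<rfloor> + 1"
    using le_nat_iff by blast
  then show ?thesis by linarith
qed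

context spheroidal
begin

text \<open>Comparison with v(y) = exp (c y), for which R = c (1 - y^2). The Riccati expression is
  then 2 c^2 (1 - y^2) - 2 c y + k, negative as soon as c (1 - y^2) <= 1/2 and y > 1/2. This keeps
  zeros away from the singularity at D = 0 of the phase used below.\<close>

lemma zero_far_from_one:
  assumes "k \<le> 0" "f x0 \<noteq> 0" "f x = 0" "0 < x" "x < 1"
  shows "c * (1 - x) > 1/4"
proof (rule ccontr)
  assume "\<not> ?thesis"
  then have D: "c * (1 - x) \<le> 1/4" by simp
  have "c * (1 - x) \<ge> 1 - x" using c_gt assms by simp
  then have x34: "x \<ge> 3/4" using D by linarith
  have "f y = 0" if y: "y \<in> {x<..<1}" for y
  proof (rule riccati_comparison[of x 1 "\<lambda>y. c * (1 - y\<^sup>2)" "\<lambda>y. - 2 * c * y"])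
    fix y assume y: "y \<in> {x<..<1}"
    have "y\<^sup>2 < 1" using y assms by (simp add: abs_square_less_1)
    then have e: "(c * (1 - y\<^sup>2))\<^sup>2 / (1 - y\<^sup>2) = c\<^sup>2 * (1 - y\<^sup>2)"
      by (simp add: power2_eq_square)
    have "1 - y\<^sup>2 = (1 - y) * (1 + y)" by (simp add: power2_eq_square algebra_simps)
    also have "\<dots> \<le> (1 - x) * 2" using y \<open>0 < x\<close> by (intro mult_mono) auto
    finally have "c * (1 - y\<^sup>2) \<le> c * ((1 - x) * 2)" using c_gt by simp
    also have "\<dots> = 2 * (c * (1 - x))" by simp
    finally have "c * (1 - y\<^sup>2) \<le> 1/2" using D by linarith
    then have "c * (c * (1 - y\<^sup>2)) \<le> c * (1/2)" using c_gt by (intro mult_left_mono) auto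
    moreover have "c * y > c * (1/2)" using x34 y c_gt by simp
    ultimately show "- 2 * c * y + (c * (1 - y\<^sup>2))\<^sup>2 / (1 - y\<^sup>2) + k + c\<^sup>2 * (1 - y\<^sup>2) < 0"
      unfolding e using \<open>k \<le> 0\<close> unfolding power2_eq_square[of c] mult.assoc by linarith
  qed (use assms y in \<open>auto intro!: derivative_eq_intros\<close>)
  with f_not_identically_zero[OF assms(2) \<open>x < 1\<close>] show False by blast
qed

text \<open>The comparison function is \<open>cos (\<theta> - \<theta>\<^sub>m) / sqrt (\<theta>' (1 - x\<^sup>2))\<close> with the phase
  \<open>\<theta> = D - 1 / (2 D)\<close>, \<open>D = c (1 - x)\<close>.\<close>
lemma zeros_phase_separated:
  assumes k: "k \<le> 0" and "f x0 \<noteq> 0" "f x = 0" "f x' = 0" "0 < x" "x < x'" "x' < 1"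
  defines "\<theta> \<equiv> \<lambda>D::real. D - 1 / (2 * D)"
  shows "\<theta> (c * (1 - x)) - \<theta> (c * (1 - x')) \<ge> pi"
proof (rule ccontr)
  assume "\<not> ?thesis"
  then have lt: "\<theta> (c * (1 - x)) - \<theta> (c * (1 - x')) < pi" by simp
  \<comment> \<open>Centring the phase at the midpoint puts the whole interval within pi/2 of
    \<open>m\<close>, so the cosine in the comparison function stays positive.\<close>
  define m where "m = (\<theta> (c * (1 - x)) + \<theta> (c * (1 - x'))) / 2"
  \<comment> \<open>Logarithmic derivative in D of h(D) = cos (\<theta> D - m) / sqrt (\<theta>' D).
    With the remaining factor (1 - y^2)^(-1/2) and D = c (1 - y), the comparison function has R = y
    - c (1 - y^2) S.\<close>
  define S where "S = (\<lambda>D. 1 / (D * (2 * D\<^sup>2 + 1)) - (1 + 1 / (2 * D\<^sup>2)) * tan (\<theta> D - m))"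
  define S' where "S' = (\<lambda>D. - (6 * D\<^sup>2 + 1) / (D\<^sup>2 * (2 * D\<^sup>2 + 1)\<^sup>2) + 1 / D ^ 3 * tan (\<theta> D - m)
      - (1 + 1 / (2 * D\<^sup>2))\<^sup>2 * (1 + (tan (\<theta> D - m))\<^sup>2))"
  have mono: "\<theta> D \<le> \<theta> E" if "0 < D" "D \<le> E" for D E
    unfolding \<theta>_def using that by (intro diff_mono frac_le) auto
  have cosp: "cos (\<theta> (c * (1 - y)) - m) > 0" if "y \<in> {x..x'}" for y
  proof -
    have "\<theta> (c * (1 - y)) \<le> \<theta> (c * (1 - x))" "\<theta> (c * (1 - x')) \<le> \<theta> (c * (1 - y))"
      using that \<open>0 < x\<close> \<open>x < x'\<close> \<open>x' < 1\<close> c_gt by (intro mono; simp)+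
    then show ?thesis using lt unfolding m_def
      by (intro cos_gt_zero_pi) (simp_all add: field_simps)
  qed
  have S_deriv: "(S has_real_derivative S' D) (at D)"
    if "D > 0" and c: "cos (\<theta> D - m) > 0" for D
  proof -
    have \<theta>d: "(\<theta> has_real_derivative 1 + 1 / (2 * D\<^sup>2)) (at D)"
      unfolding \<theta>_def using that
      by (auto intro!: derivative_eq_intros simp: power2_eq_square field_simps)
    have t: "((\<lambda>D. tan (\<theta> D - m)) has_real_derivative
        (1 + (tan (\<theta> D - m))\<^sup>2) * (1 + 1 / (2 * D\<^sup>2))) (at D)"
      by (rule DERIV_cong, rule DERIV_chain2[of tan], rule DERIV_tan)
        (use c in \<open>auto intro!: derivative_eq_intros \<theta>d simp: tan_sec power_inverse\<close>)
    have 1: "((\<lambda>D. 1 / (D * (2 * D\<^sup>2 + 1))) has_real_derivative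
        - (6 * D\<^sup>2 + 1) / (D\<^sup>2 * (2 * D\<^sup>2 + 1)\<^sup>2)) (at D)"
    proof -
      have "D * (2 * D\<^sup>2 + 1) \<noteq> 0" using \<open>D > 0\<close>
        by (metis add_pos_pos less_irrefl mult_eq_0_iff mult_pos_pos zero_less_numeral zero_less_one zero_less_power)
      then have "((\<lambda>D. 1 / (D * (2 * D\<^sup>2 + 1))) has_real_derivative
        (0 * (D * (2 * D\<^sup>2 + 1)) - 1 * (6 * D\<^sup>2 + 1)) / ((D * (2 * D\<^sup>2 + 1)) * (D * (2 * D\<^sup>2 + 1)))) (at D)"
        by (intro DERIV_divide) (auto intro!: derivative_eq_intros simp: power2_eq_square algebra_simps)
      then show ?thesis
        by (rule DERIV_cong) (simp add: power2_eq_square ac_simps)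
    qed
    have 2: "((\<lambda>D. 1 + 1 / (2 * D\<^sup>2)) has_real_derivative - 1 / D ^ 3) (at D)"
      using that by (auto intro!: derivative_eq_intros simp: field_simps eval_nat_numeral)
    define A T B where "A = 1 + 1 / (2 * D\<^sup>2)" and "T = tan (\<theta> D - m)" and "B = 1 / D ^ 3"
    have "- 1 / D ^ 3 = - B" by (simp add: B_def)
    then show ?thesis
      unfolding S_def S'_def
      by (intro DERIV_cong[OF DERIV_diff[OF 1 DERIV_mult[OF 2 t]]])
        (simp only: A_def[symmetric] T_def[symmetric] B_def[symmetric],
          simp add: power2_eq_square algebra_simps)
  qed
  \<comment> \<open>The left side is h''/h. The terms linear in the tangent cancel, which is the
    purpose of dividing by sqrt \<theta>', and -(\<theta>')^2 - 6/w^2 remains. The phase D - 1/(2 D)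
    is chosen so that (\<theta>')^2 contains 1 + 1/D^2.\<close>
  have S_ric: "S' D + (S D)\<^sup>2 < - (1 + 1 / D\<^sup>2)" if "D > 0" for D
  proof -
    define T where "T = tan (\<theta> D - m)"
    define w where "w = 2 * D\<^sup>2 + 1"
    have w: "w > 0" unfolding w_def by (simp add: add_nonneg_pos)
    have \<tau>: "1 + 1 / (2 * D\<^sup>2) = w / (2 * D\<^sup>2)"
      using that by (simp add: w_def field_simps)
    have "S' D + (S D)\<^sup>2 = - (6 * D\<^sup>2 + 1) / (D\<^sup>2 * w\<^sup>2) + (1 / (D * w))\<^sup>2 + (1 / D ^ 3) * T
       - 2 * (1 / (D * w)) * (w / (2 * D\<^sup>2)) * T - (w / (2 * D\<^sup>2))\<^sup>2"
    proof -
      define A B where "A = w / (2 * D\<^sup>2)" and "B = 1 / (D * w)"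
      show ?thesis
        unfolding S_def S'_def T_def[symmetric] w_def[symmetric] \<tau> A_def[symmetric] B_def[symmetric]
        by (simp add: power2_eq_square algebra_simps)
    qed
    also have "2 * (1 / (D * w)) * (w / (2 * D\<^sup>2)) = 1 / D ^ 3"
      using w that by (simp add: field_simps eval_nat_numeral)
    also have "- (6 * D\<^sup>2 + 1) / (D\<^sup>2 * w\<^sup>2) + (1 / (D * w))\<^sup>2 = - 6 / w\<^sup>2"
      using w that by (simp add: field_simps eval_nat_numeral)
    also have "(w / (2 * D\<^sup>2))\<^sup>2 = 1 + 1 / D\<^sup>2 + 1 / (4 * D ^ 4)"
      using that by (simp add: w_def field_simps eval_nat_numeral)
    finally have "S' D + (S D)\<^sup>2 = - 6 / w\<^sup>2 - (1 + 1 / D\<^sup>2 + 1 / (4 * D ^ 4))" by simp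
    moreover have "6 / w\<^sup>2 > 0" "1 / (4 * D ^ 4) > 0" using w that by auto
    ultimately show ?thesis by linarith
  qed
  have "f y = 0" if y: "y \<in> {x<..<x'}" for y
  proof (rule riccati_comparison[of x x' "\<lambda>y. y - c * (1 - y\<^sup>2) * S (c * (1 - y))"
        "\<lambda>y. 1 + 2 * c * y * S (c * (1 - y)) + c\<^sup>2 * (1 - y\<^sup>2) * S' (c * (1 - y))"])
    fix y assume y: "y \<in> {x..x'}"
    have "(S has_real_derivative S' (c * (1 - y))) (at (c * (1 - y)))"
      using y assms c_gt cosp by (intro S_deriv) auto
    then have "((\<lambda>y. S (c * (1 - y))) has_real_derivative S' (c * (1 - y)) * (- c)) (at y)"
      by (rule DERIV_chain2) (auto intro!: derivative_eq_intros)
    then show "((\<lambda>y. y - c * (1 - y\<^sup>2) * S (c * (1 - y))) has_real_derivative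
       1 + 2 * c * y * S (c * (1 - y)) + c\<^sup>2 * (1 - y\<^sup>2) * S' (c * (1 - y))) (at y)"
      by (auto intro!: derivative_eq_intros simp: power2_eq_square algebra_simps)
  next
    fix y assume y: "y \<in> {x<..<x'}"
    define D q s s' where "D = c * (1 - y)" and "q = 1 - y\<^sup>2" and "s = S (c * (1 - y))" and "s' = S' (c * (1 - y))"
    have D: "D > 0" using y assms c_gt by (simp add: D_def)
    have qf: "q = (1 - y) * (1 + y)" by (simp add: q_def power2_eq_square algebra_simps)
    have q: "q > 0" using y assms by (simp add: qf)
    have "q \<ge> 1 - y" using y assms by (simp add: qf mult_le_cancel_left1)
    then have "c * q \<ge> D" using c_gt by (simp add: D_def)
    then have "(c * q)\<^sup>2 \<ge> D\<^sup>2" using D by simp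
    \<comment> \<open>The factor (1 - y^2)^(-1/2) contributes 1/q to the Riccati expression. The
      term 1/D^2 from \<open>S_ric\<close> pays for it, because c q >= D.\<close>
    then have iq: "1 / q \<le> c\<^sup>2 * q * (1 / D\<^sup>2)"
      using D q by (simp add: field_simps power2_eq_square)
    have "c\<^sup>2 * q > 0" using q c_gt by simp
    then have "c\<^sup>2 * q * (s' + s\<^sup>2) < c\<^sup>2 * q * (- (1 + 1 / D\<^sup>2))"
      using S_ric[OF D] unfolding s_def s'_def D_def by (intro mult_strict_left_mono)
    moreover have "(y - c * q * s)\<^sup>2 / q = y\<^sup>2 / q - 2 * c * y * s + c\<^sup>2 * q * s\<^sup>2"
      using q by (simp add: field_simps power2_eq_square)
    moreover have "1 + y\<^sup>2 / q = 1 / q" using q by (simp add: q_def field_simps)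
    ultimately have "1 + 2 * c * y * s + c\<^sup>2 * q * s' + (y - c * q * s)\<^sup>2 / q + k + c\<^sup>2 * q < 0"
      using iq k by (simp add: algebra_simps)
    then show "1 + 2 * c * y * S (c * (1 - y)) + c\<^sup>2 * (1 - y\<^sup>2) * S' (c * (1 - y))
      + (y - c * (1 - y\<^sup>2) * S (c * (1 - y)))\<^sup>2 / (1 - y\<^sup>2) + k + c\<^sup>2 * (1 - y\<^sup>2) < 0"
      by (simp only: s_def s'_def q_def)
  qed (use assms y in auto)
  with f_not_identically_zero[OF assms(2) \<open>x < x'\<close>] show False by blast
qed

text \<open>The phases of the zeros are pi-separated and lie in [-7/4, c]: -7/4 is the phase at D =
  1/4, the bound of \<open>zero_far_from_one\<close>, and D <= c on (0,1).\<close>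

lemma card_zeros_le:
  assumes k: "k \<le> 0" and f0: "f x0 \<noteq> 0" and "finite Z" "Z \<subseteq> {0<..<1}" and Z: "\<And>x. x \<in> Z \<Longrightarrow> f x = 0"
  shows "real (card Z) \<le> (c + 7/4) / pi + 1"
proof -
  define \<theta> where "\<theta> = (\<lambda>D::real. D - 1 / (2 * D))"
  have "real (card Z) \<le> (c - (-7/4)) / pi + 1"
  proof (rule card_le_of_separated[where \<theta> = "\<lambda>x. \<theta> (c * (1 - x))"])
    fix x assume x: "x \<in> Z"
    then have "0 < x" "x < 1" using assms by auto
    define D where "D = c * (1 - x)"
    have D: "D > 1/4" using zero_far_from_one[OF k f0 Z[OF x]] \<open>0 < x\<close> \<open>x < 1\<close> by (simp add: D_def)
    then have "1 / (2 * D) \<le> 1 / (2 * (1/4))"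
      by (intro divide_left_mono) auto
    then have "-7/4 \<le> D - 1 / (2 * D)" using D by simp
    moreover have "1 / (2 * D) \<ge> 0" using D by simp
    moreover have "D \<le> c" using \<open>0 < x\<close> c_gt by (simp add: D_def)
    ultimately show "-7/4 \<le> \<theta> (c * (1 - x)) \<and> \<theta> (c * (1 - x)) \<le> c"
      unfolding \<theta>_def D_def[symmetric] by (smt (verit))
  next
    fix x y assume xy: "x \<in> Z" "y \<in> Z" "x \<noteq> y"
    then have *: "0 < x" "x < 1" "0 < y" "y < 1" using assms by auto
    have sep: "pi \<le> \<theta> (c * (1 - u)) - \<theta> (c * (1 - v))" if "u \<in> Z" "v \<in> Z" "u < v" for u v
      using zeros_phase_separated[OF k f0 Z[OF that(1)] Z[OF that(2)]] that assms(4)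
      unfolding \<theta>_def by (simp add: subset_iff)
    show "pi \<le> \<bar>\<theta> (c * (1 - x)) - \<theta> (c * (1 - y))\<bar>"
      using sep[of x y] sep[of y x] xy by (cases "x < y") linarith+
  qed (use assms c_gt in auto)
  then show ?thesis by simp
qed

end

section \<open>The real axis\<close>

context spheroidal
begin

lemma F_holomorphic: "F holomorphic_on A"
  using F_deriv has_field_derivative_at_within
  unfolding holomorphic_on_def field_differentiable_def by blast

lemma G_holomorphic: "G holomorphic_on A"
proof -
  have "deriv F = G" using F_deriv DERIV_imp_deriv by blast
  then have "G holomorphic_on UNIV"
    using holomorphic_deriv[OF F_holomorphic, of UNIV] by simp
  then show ?thesis by (rule holomorphic_on_subset) simp
qed

lemma g_cont [continuous_intros]: "continuous_on A g"
proof -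
  have "continuous_on UNIV G"
    using G_holomorphic holomorphic_on_imp_continuous_on by blast
  then have "continuous_on A (\<lambda>x. G (of_real x))"
    by (rule continuous_on_compose2[where f = of_real]) (auto intro: continuous_on_of_real_id)
  then show ?thesis
    unfolding g_def[abs_def] by (rule continuous_on_Re)
qed

text \<open>Sonin's argument. With p = 1 - x^2 the derivative of \<open>Q\<close> is -(p m)' g^2 /
  m^2, and p m decreases on [0,1] since both factors do; hence \<open>Q\<close> increases up to Q 1
  = (f 1)^2. It yields both the lower bound for (f 1)^2 and |\<lambda>| <= 2.\<close>

lemma f_sq_le:
  assumes k: "k > 0" and x: "0 \<le> x" "x \<le> 1"
  shows "(f x)\<^sup>2 \<le> (f 1)\<^sup>2"
proof -
  define m where "m = (\<lambda>x::real. k + c\<^sup>2 * (1 - x\<^sup>2))"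
  define Q where "Q = (\<lambda>x. (f x)\<^sup>2 + (1 - x\<^sup>2) / m x * (g x)\<^sup>2)"
  have m: "m y > 0" if "0 \<le> y" "y \<le> 1" for y
  proof -
    have "y\<^sup>2 \<le> 1" using that by (simp add: power_le_one)
    then show ?thesis using k by (simp add: m_def add_pos_nonneg)
  qed
  have "Q x \<le> Q 1"
  proof (rule DERIV_nonneg_imp_increasing_open[OF x(2)])
    fix y assume y: "x < y" "y < 1"
    define D where "D = (k - c\<^sup>2 * (y\<^sup>2 - 1)) * f y - 2 * y * g y"
    have y2: "y\<^sup>2 < 1" using x y by (simp add: abs_square_less_1)
    have my: "m y > 0" using m x y by simp
    have g: "(g has_real_derivative D / (y\<^sup>2 - 1)) (at y)"
      unfolding D_def using y2 by (intro g_deriv) simp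
    have md: "(m has_real_derivative - 2 * c\<^sup>2 * y) (at y)"
      unfolding m_def by (auto intro!: derivative_eq_intros)
    have g2: "((\<lambda>x. (g x)\<^sup>2) has_real_derivative 2 * g y * (D / (y\<^sup>2 - 1))) (at y)"
      by (rule DERIV_cong[OF DERIV_power[OF g]]) simp
    have f2: "((\<lambda>x. (f x)\<^sup>2) has_real_derivative 2 * f y * g y) (at y)"
      by (rule DERIV_cong[OF DERIV_power[OF f_deriv]]) simp
    have Qd: "(Q has_real_derivative 2 * f y * g y + ((- 2 * y * m y - (1 - y\<^sup>2) * (- 2 * c\<^sup>2 * y)) / (m y * m y) * (g y)\<^sup>2
       + (1 - y\<^sup>2) / m y * (2 * g y * (D / (y\<^sup>2 - 1))))) (at y)"
      unfolding Q_def
      by (rule f2 g2 md derivative_eq_intros refl less_imp_neq[OF my, symmetric])+ (simp add: ac_simps)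
    have e1: "(1 - y\<^sup>2) / m y * (2 * g y * (D / (y\<^sup>2 - 1))) = - 2 * g y * D / m y"
    proof -
      have "D / (y\<^sup>2 - 1) = - D / (1 - y\<^sup>2)"
        by (metis minus_diff_eq minus_divide_left minus_divide_right minus_minus)
      then show ?thesis using y2 my by (simp add: field_simps)
    qed
    have Dm: "D = m y * f y - 2 * y * g y" by (simp add: D_def m_def algebra_simps)
    have e2: "- 2 * g y * D / m y = - 2 * f y * g y + 4 * y / m y * (g y)\<^sup>2"
      unfolding Dm using my by (simp add: field_simps power2_eq_square)
    have e3: "(- 2 * y * m y - (1 - y\<^sup>2) * (- 2 * c\<^sup>2 * y)) / (m y * m y) 
       = - 2 * y / m y + 2 * c\<^sup>2 * y * (1 - y\<^sup>2) / (m y)\<^sup>2"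
      using my by (simp add: field_simps power2_eq_square)
    have "(Q has_real_derivative (g y)\<^sup>2 * (2 * y / m y + 2 * c\<^sup>2 * y * (1 - y\<^sup>2) / (m y)\<^sup>2)) (at y)"
      by (rule DERIV_cong[OF Qd[unfolded e1 e2 e3]]) (simp add: algebra_simps)
    moreover have "(g y)\<^sup>2 * (2 * y / m y + 2 * c\<^sup>2 * y * (1 - y\<^sup>2) / (m y)\<^sup>2) \<ge> 0"
      using my y2 x y by (intro mult_nonneg_nonneg add_nonneg_nonneg divide_nonneg_nonneg) auto
    ultimately show "\<exists>d. (Q has_real_derivative d) (at y) \<and> 0 \<le> d" by blast
  next
    have "m y \<noteq> 0" if "y \<in> {x..1}" for y using m[of y] that x by simp
    moreover have "continuous_on {x..1} m" unfolding m_def by (intro continuous_intros)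
    ultimately show "continuous_on {x..1} Q"
      unfolding Q_def by (intro continuous_on_add continuous_on_mult continuous_on_divide
          continuous_on_power continuous_on_diff continuous_on_const continuous_on_id f_cont g_cont) auto
  qed
  moreover have "(f x)\<^sup>2 \<le> Q x"
  proof -
    have "x\<^sup>2 \<le> 1" using x by (simp add: power_le_one)
    then show ?thesis unfolding Q_def using m[OF x] by simp
  qed
  ultimately show ?thesis by (simp add: Q_def)
qed

text \<open>\<open>u / sqrt (x\<^sup>2 - 1)\<close> is the derivative of \<open>sqrt (x\<^sup>2 - 1) f\<close> on \<open>x > 1\<close>.\<close>
definition u :: "real \<Rightarrow> real" where "u x = x * f x + (x\<^sup>2 - 1) * g x"

lemma u_deriv: "(u has_real_derivative f x + x * g x + (k - c\<^sup>2 * (x\<^sup>2 - 1)) * f x) (at x)"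
  unfolding u_def by (rule derivative_eq_intros pg_deriv f_deriv refl)+ simp

lemma u_cont [continuous_intros]: "continuous_on A u"
  by (rule DERIV_continuous_on, rule has_field_derivative_at_within, rule u_deriv)

text \<open>sqrt (x^2 - 1) f starts from 0 at x = 1 and increases as long as \<open>u\<close> is
  positive.\<close>

lemma f_pos:
  assumes x: "x > 1" and u: "\<And>y. 1 < y \<Longrightarrow> y < x \<Longrightarrow> u y > 0"
  shows "f x > 0"
proof -
  define W where "W = (\<lambda>x. sqrt (x\<^sup>2 - 1) * f x)"
  have "W 1 < W x"
  proof (rule DERIV_pos_imp_increasing_open[OF x])
    fix y assume y: "1 < y" "y < x"
    have "y\<^sup>2 - 1 > 0" using y by (simp add: one_less_power)
    then have "(W has_real_derivative u y / sqrt (y\<^sup>2 - 1)) (at y)"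
      unfolding W_def u_def
      by (auto intro!: derivative_eq_intros f_deriv simp: field_simps)
    moreover have "u y / sqrt (y\<^sup>2 - 1) > 0"
      using u[OF y] \<open>y\<^sup>2 - 1 > 0\<close> by simp
    ultimately show "\<exists>d. (W has_real_derivative d) (at y) \<and> 0 < d" by blast
  qed (auto simp: W_def intro!: continuous_intros)
  then have "sqrt (x\<^sup>2 - 1) * f x > 0" by (simp add: W_def)
  moreover have "sqrt (x\<^sup>2 - 1) > 0" using x by (simp add: one_less_power)
  ultimately show ?thesis by (simp add: zero_less_mult_iff)
qed

text \<open>On x > 1 the function \<Phi> = sqrt (x^2 - 1) f satisfies \<Phi>'' = -V \<Phi>, and
  \<open>b\<close> is chosen so that k / (x^2 - 1) <= c^2/2, hence V >= c^2/2, from there on. So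
  \<Phi> oscillates at least as fast as with frequency c / sqrt 2 and cannot keep increasing for a
  full quarter period pi / (sqrt 2 c). Here \<open>r\<close> is \<Phi>'/\<Phi>.\<close>

lemma u_nonpos_before:
  assumes k: "k > 0"
  defines "b \<equiv> sqrt (1 + 2 * k / c\<^sup>2)"
  shows "\<exists>x. 1 < x \<and> x \<le> b + pi / (sqrt 2 * c) \<and> u x \<le> 0"
proof (rule ccontr)
  assume neg: "\<not> ?thesis"
  define e where "e = b + pi / (sqrt 2 * c)"
  have upos: "u x > 0" if "1 < x" "x \<le> e" for x
    using neg that unfolding e_def by force
  have cp: "c > 0" using c_gt by simp
  have b1: "b > 1" unfolding b_def using k cp by simp
  have be: "b < e" using cp by (simp add: e_def)
  have fp: "f x > 0" if "1 < x" "x \<le> e" for x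
    using f_pos[of x] upos that by simp
  define r where "r = (\<lambda>x. u x / ((x\<^sup>2 - 1) * f x))"
  \<comment> \<open>\<open>r\<close> is a logarithmic derivative and satisfies a Riccati inequality, so the Pruefer-type angle
    \<open>T\<close> decreases.\<close>
  define T where "T = (\<lambda>x. arctan (sqrt 2 / c * r x) + c / sqrt 2 * x)"
  have "T e \<le> T b"
  proof (rule DERIV_nonpos_imp_nonincreasing[of b e T])
    fix x assume x: "b \<le> x" "x \<le> e"
    define p where "p = x\<^sup>2 - 1"
    have "b\<^sup>2 \<le> x\<^sup>2" using x b1 by simp
    then have pk: "p \<ge> 2 * k / c\<^sup>2" using k cp by (simp add: b_def p_def)
    moreover have "2 * k / c\<^sup>2 > 0" using k cp by simp
    ultimately have p: "p > 0" by linarith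
    have f: "f x > 0" using fp x b1 by simp
    have g: "g x = (u x - x * f x) / p" using p by (simp add: u_def p_def)
    have u': "f x + x * g x + (k - c\<^sup>2 * p) * f x = (x * u x - f x) / p + (k - c\<^sup>2 * p) * f x"
      unfolding g using p by (simp add: field_simps power2_eq_square p_def)
    define V where "V = c\<^sup>2 - k / p + 1 / p\<^sup>2"
    have rd: "(r has_real_derivative - V - (r x)\<^sup>2) (at x)"
    proof -
      have "((\<lambda>x. (x\<^sup>2 - 1) * f x) has_real_derivative u x + x * f x) (at x)"
        unfolding u_def by (auto intro!: derivative_eq_intros f_deriv simp: algebra_simps)
      then have "(r has_real_derivative ((f x + x * g x + (k - c\<^sup>2 * p) * f x) * (p * f x) - u x * (u x + x * f x)) / ((p * f x) * (p * f x))) (at x)"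
        unfolding r_def p_def using f p by (intro DERIV_divide u_deriv) (auto simp: p_def)
      moreover have "((f x + x * g x + (k - c\<^sup>2 * p) * f x) * (p * f x) - u x * (u x + x * f x)) / ((p * f x) * (p * f x)) = - V - (r x)\<^sup>2"
        unfolding u' r_def V_def p_def[symmetric] using f p by (simp add: field_simps power2_eq_square)
      ultimately show ?thesis by simp
    qed
    have "k / p \<le> c\<^sup>2 / 2" using pk p cp by (simp add: field_simps)
    moreover have "1 / p\<^sup>2 > 0" using p by simp
    ultimately have V: "V \<ge> c\<^sup>2 / 2" unfolding V_def by linarith
    have "(T has_real_derivative sqrt 2 / c * (- V - (r x)\<^sup>2) / (1 + (sqrt 2 / c * r x)\<^sup>2) + c / sqrt 2) (at x)"
      unfolding T_def
      by (rule derivative_eq_intros rd refl)+ (auto simp: field_simps)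
    moreover have "sqrt 2 / c * (- V - (r x)\<^sup>2) / (1 + (sqrt 2 / c * r x)\<^sup>2) + c / sqrt 2 \<le> 0"
    proof -
      define z where "z = (sqrt 2 / c * r x)\<^sup>2"
      have z: "z \<ge> 0" by (simp add: z_def)
      have "z = 2 / c\<^sup>2 * (r x)\<^sup>2" by (simp add: z_def power_mult_distrib power_divide)
      then have rz: "(r x)\<^sup>2 = c\<^sup>2 / 2 * z" using cp by simp
      have "V + (r x)\<^sup>2 \<ge> c\<^sup>2 / 2 * (1 + z)" using V by (simp add: rz algebra_simps)
      then have "sqrt 2 / c * (V + (r x)\<^sup>2) \<ge> sqrt 2 / c * (c\<^sup>2 / 2 * (1 + z))"
        using cp by (intro mult_left_mono) auto
      also have "sqrt 2 / c * (c\<^sup>2 / 2 * (1 + z)) = c / sqrt 2 * (1 + z)"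
        using cp by (simp add: field_simps power2_eq_square)
      finally have "sqrt 2 / c * (V + (r x)\<^sup>2) / (1 + z) \<ge> c / sqrt 2"
        by (intro mult_imp_le_div_pos) (use z in auto)
      moreover have "sqrt 2 / c * (- V - (r x)\<^sup>2) / (1 + z) = - (sqrt 2 / c * (V + (r x)\<^sup>2) / (1 + z))"
        by (simp add: algebra_simps diff_divide_distrib add_divide_distrib)
      ultimately show ?thesis unfolding z_def[symmetric] by linarith
    qed
    ultimately show "\<exists>y. (T has_real_derivative y) (at x) \<and> y \<le> 0" by blast
  qed (use be in simp)
  moreover have "c / sqrt 2 * e = c / sqrt 2 * b + pi / 2"
    using cp by (simp add: e_def field_simps)
  moreover have "arctan (sqrt 2 / c * r b) < pi / 2" by (rule arctan_ubound)
  moreover have "r e > 0" 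
  proof -
    have "e\<^sup>2 > 1" using b1 be by (intro one_less_power) auto
    then show ?thesis unfolding r_def using upos[of e] fp[of e] b1 be by simp
  qed
  then have "arctan (sqrt 2 / c * r e) > 0" using cp by (simp add: zero_less_arctan_iff)
  ultimately show False unfolding T_def by linarith
qed

text \<open>Since u 1 = f 1 > 0, the intermediate value theorem gives a zero of \<open>u\<close>,
  and compactness gives a least one. The upper bound becomes the estimate of c a by sqrt \<chi> at
  the end.\<close>

lemma first_critical_point:
  assumes "k > 0" "f 1 > 0"
  obtains a where "1 < a" "a \<le> sqrt (1 + 2 * k / c\<^sup>2) + pi / (sqrt 2 * c)" "u a = 0"
    "\<And>x. 1 \<le> x \<Longrightarrow> x < a \<Longrightarrow> u x > 0"
proof -
  obtain e where e: "1 < e" "e \<le> sqrt (1 + 2 * k / c\<^sup>2) + pi / (sqrt 2 * c)" "u e \<le> 0"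
    using u_nonpos_before assms by blast
  have u1: "u 1 > 0" using assms by (simp add: u_def)
  define Z where "Z = {x \<in> {1..e}. u x = 0}"
  have IV: "\<exists>z\<in>Z. z \<le> y" if y: "1 \<le> y" "y \<le> e" "u y \<le> 0" for y
  proof -
    obtain z where "1 \<le> z" "z \<le> y" "u z = 0"
      using IVT2'[of u y 0 1] y u1 u_cont by auto
    then show ?thesis using y unfolding Z_def by auto
  qed
  have "Z \<noteq> {}" using IV[of e] e by auto
  moreover have "compact Z"
  proof -
    have "closed (u -` {0})" using continuous_closed_vimage[of "{0}" u] u_cont[of UNIV]
      by (simp add: continuous_on_eq_continuous_at)
    then have "compact ({1..e} \<inter> (u -` {0}))" by (intro compact_Int_closed) auto
    moreover have "Z = {1..e} \<inter> (u -` {0})" by (auto simp: Z_def)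
    ultimately show ?thesis by simp
  qed
  ultimately have "\<exists>a\<in>Z. \<forall>z\<in>Z. a \<le> z"
    by (intro compact_attains_inf)
  then obtain a where a: "a \<in> Z" "\<And>z. z \<in> Z \<Longrightarrow> a \<le> z"
    by blast
  show ?thesis
  proof
    show "u a = 0" using a by (simp add: Z_def)
    then show "1 < a" using a u1 by (cases "a = 1") (auto simp: Z_def)
    show "a \<le> sqrt (1 + 2 * k / c\<^sup>2) + pi / (sqrt 2 * c)" using a e by (simp add: Z_def)
    show "u x > 0" if "1 \<le> x" "x < a" for x
    proof (rule ccontr)
      assume "\<not> u x > 0"
      then have "u x \<le> 0" by simp
      moreover have "x \<le> e" using a(1) that by (simp add: Z_def)
      ultimately obtain z where "z \<in> Z" "z \<le> x" using IV[of x] \<open>1 \<le> x\<close> by blast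
      then show False using a that by force
    qed
  qed
qed

end

section \<open>The first critical point and the oscillatory region beyond it\<close>

locale spheroidal_critical = spheroidal +
  fixes a :: real
  assumes k_pos: "k > 0" and f1_pos: "f 1 > 0"
    and a_gt: "1 < a" and ua: "u a = 0"
    and u_pos: "\<And>x. 1 \<le> x \<Longrightarrow> x < a \<Longrightarrow> u x > 0"
begin

lemma f_pos_upto: "1 \<le> x \<Longrightarrow> x \<le> a \<Longrightarrow> f x > 0"
  using f1_pos f_pos[of x] u_pos by (cases "x = 1") auto

text \<open>With \<open>w = c\<^sup>2 (x\<^sup>2 - 1) - k\<close> this says that \<open>a\<close> lies beyond the turning point \<open>w = 0\<close>
  by a definite amount.\<close>
lemma turning_gap: "c\<^sup>2 * (a\<^sup>2 - 1) - k \<ge> c"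
proof -
  have cp: "c > 0" using c_gt by simp
  define w where "w = (\<lambda>x. c\<^sup>2 * (x\<^sup>2 - 1) - k)"
  define v where "v = (\<lambda>x. (x\<^sup>2 - 1) * g x)"
  have vd: "(v has_real_derivative - w x * f x) (at x)" for x
    unfolding v_def w_def by (rule DERIV_cong[OF pg_deriv]) simp
  have wd: "(w has_real_derivative 2 * c\<^sup>2 * x) (at x)" for x
    unfolding w_def by (auto intro!: derivative_eq_intros)
  have wq: "((\<lambda>x. m * (w x)\<^sup>2 / d) has_real_derivative m * (2 * w y * (2 * c\<^sup>2 * y)) / d) (at y)" for m d y
    by (rule DERIV_cdivide[OF DERIV_cmult[OF DERIV_cong[OF DERIV_power[OF wd]]]]) simp
  define x0 where "x0 = sqrt (1 + k / c\<^sup>2)"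
  have x02: "x0\<^sup>2 = 1 + k / c\<^sup>2" unfolding x0_def using k_pos by simp
  have x0: "x0 > 1" unfolding x0_def using k_pos cp by simp
  have w0: "w x0 = 0" unfolding w_def x02 using cp by simp
  have w_mono: "w x \<le> w y" if "0 \<le> x" "x \<le> y" for x y
    unfolding w_def using that by (simp add: mult_left_mono power_mono)
  have v_below: "v x \<ge> 0" if "1 \<le> x" "x \<le> x0" "x \<le> a" for x
  proof -
    have "v 1 \<le> v x"
    proof (rule DERIV_nonneg_imp_nondecreasing[OF that(1)])
      fix y assume y: "1 \<le> y" "y \<le> x"
      have "w y \<le> 0" using w_mono[of y x0] w0 y that by simp
      moreover have "f y > 0" using y that by (intro f_pos_upto) auto
      ultimately have "- w y * f y \<ge> 0" by (simp add: mult_nonpos_nonneg)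
      then show "\<exists>d. (v has_real_derivative d) (at y) \<and> 0 \<le> d" using vd by blast
    qed
    then show ?thesis by (simp add: v_def)
  qed
  \<comment> \<open>The critical point condition forces \<open>v\<close> to be negative at
    \<open>a\<close>, while \<open>v\<close> is still nonnegative at the turning point
    \<open>x0\<close>. Its decrease is driven by \<open>w\<close>, so \<open>w a\<close> cannot be
    small.\<close>
  have va: "v a = - a * f a" using ua by (simp add: u_def v_def)
  have fa: "f a > 0" using f_pos_upto[of a] a_gt by simp
  have x0a: "x0 < a"
  proof (rule ccontr)
    assume "\<not> x0 < a"
    then have "v a \<ge> 0" using v_below[of a] a_gt by simp
    moreover have "a * f a > 0" using fa a_gt by simp
    ultimately show False using va by simp
  qed
  obtain xm where xm: "xm \<in> {x0..a}" "\<And>x. x \<in> {x0..a} \<Longrightarrow> f x \<le> f xm"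
    using continuous_attains_sup[of "{x0..a}" f] x0a f_cont[OF continuous_on_id] by auto
  define M where "M = f xm"
  have M: "M > 0" unfolding M_def using xm x0 by (intro f_pos_upto) auto
  have wnn: "w x \<ge> 0" if "x0 \<le> x" for x using w_mono[of x0 x] w0 x0 that by simp
  \<comment> \<open>Here v' = -w f >= -M w, and the derivative of w^2 / (4 c^2) is w x >= w.\<close>
  have v_lower: "v x \<ge> - M * (w x)\<^sup>2 / (4 * c\<^sup>2)" if x: "x0 \<le> x" "x \<le> a" for x
  proof -
    let ?h = "\<lambda>x. v x + M * (w x)\<^sup>2 / (4 * c\<^sup>2)"
    have "?h x0 \<le> ?h x"
    proof (rule DERIV_nonneg_imp_nondecreasing[of x0 x ?h])
      fix y assume y: "x0 \<le> y" "y \<le> x"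
      have "(?h has_real_derivative w y * (M * y - f y)) (at y)"
        by (rule DERIV_cong[OF DERIV_add[OF vd wq]]) (use cp in \<open>simp add: field_simps power2_eq_square\<close>)
      moreover have "f y \<le> M * y"
      proof -
        have "f y \<le> M" using xm y x by (simp add: M_def)
        also have "M * 1 \<le> M * y" using y x0 M by (intro mult_left_mono) auto
        finally show ?thesis by simp
      qed
      then have "0 \<le> w y * (M * y - f y)" using wnn[of y] y by simp
      ultimately show "\<exists>d. (?h has_real_derivative d) (at y) \<and> 0 \<le> d" by blast
    qed (use x in auto)
    moreover have "v x0 \<ge> 0" using v_below[of x0] x0 x0a by simp
    ultimately show ?thesis using w0 by simp
  qed
  \<comment> \<open>The second integration: g = v / (x^2 - 1) >= -M w / 4 because w <= c^2 (x^2 -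
    1). Hence \<open>f\<close> falls from its maximum \<open>M\<close> by at most M (w a)^2 / (16
    c^2).\<close>
  have "f xm + M * (w xm)\<^sup>2 / (16 * c\<^sup>2) \<le> f a + M * (w a)\<^sup>2 / (16 * c\<^sup>2)"
  proof -
    let ?h = "\<lambda>x. f x + M * (w x)\<^sup>2 / (16 * c\<^sup>2)"
    show ?thesis
    proof (rule DERIV_nonneg_imp_nondecreasing[of xm a ?h])
      fix y assume y: "xm \<le> y" "y \<le> a"
      have y0: "x0 \<le> y" "1 < y" using y xm x0 by auto
      have "(?h has_real_derivative g y + M * w y * y / 4) (at y)"
        by (rule DERIV_cong[OF DERIV_add[OF f_deriv wq]]) (use cp in \<open>simp add: field_simps power2_eq_square\<close>)
      moreover have "0 \<le> g y + M * w y * y / 4"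
      proof -
        define p where "p = y\<^sup>2 - 1"
        have p: "p > 0" using y0 by (simp add: p_def one_less_power)
        have wp: "w y \<le> c\<^sup>2 * p" using k_pos by (simp add: w_def p_def)
        have "g y * p = v y" by (simp add: v_def p_def)
        also have "\<dots> \<ge> - M * (w y)\<^sup>2 / (4 * c\<^sup>2)" using v_lower y0 y by simp
        finally have "g y * p \<ge> - (M * (w y * w y) / (4 * c\<^sup>2))" by (simp add: power2_eq_square)
        moreover have "M * (w y * w y) / (4 * c\<^sup>2) \<le> M * (w y * (c\<^sup>2 * p)) / (4 * c\<^sup>2)"
          using wp wnn[of y] y0 M by (intro divide_right_mono mult_left_mono) auto
        moreover have "M * (w y * (c\<^sup>2 * p)) / (4 * c\<^sup>2) = M * w y / 4 * p" using cp by simp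
        ultimately have "(g y + M * w y / 4) * p \<ge> 0" by (simp only: distrib_right)
        then have "g y + M * w y / 4 \<ge> 0" using p by (simp add: zero_le_mult_iff)
        moreover have "M * w y * 1 \<le> M * w y * y" using M wnn[of y] y0 by (intro mult_left_mono) auto
        ultimately show ?thesis by simp
      qed
      ultimately show "\<exists>d. (?h has_real_derivative d) (at y) \<and> 0 \<le> d" by blast
    qed (use xm in auto)
  qed
  moreover have "M * (w xm)\<^sup>2 / (16 * c\<^sup>2) \<ge> 0" using M by simp
  ultimately have "M \<le> f a + M * (w a)\<^sup>2 / (16 * c\<^sup>2)" by (simp add: M_def)
  also have "f a \<le> a * f a" using fa a_gt by simp
  also have "a * f a \<le> M * (w a)\<^sup>2 / (4 * c\<^sup>2)" using v_lower[of a] x0a va by simp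
  finally have "M * 1 \<le> M * ((w a)\<^sup>2 / (4 * c\<^sup>2) + (w a)\<^sup>2 / (16 * c\<^sup>2))" by (simp add: algebra_simps)
  then have "1 \<le> (w a)\<^sup>2 / (4 * c\<^sup>2) + (w a)\<^sup>2 / (16 * c\<^sup>2)"
    using M by (rule mult_left_le_imp_le)
  also have "\<dots> = 5 / 16 * ((w a)\<^sup>2 / c\<^sup>2)" by (simp add: field_simps)
  finally have "1 \<le> (w a)\<^sup>2 / c\<^sup>2" by simp
  then have "c\<^sup>2 \<le> (w a)\<^sup>2" using cp by simp
  moreover have "w a \<ge> 0" using wnn x0a by simp
  ultimately have "c \<le> w a" by (rule power2_le_imp_le)
  then show ?thesis by (simp add: w_def)
qed

lemma P_pos: "a\<^sup>2 - 1 > 0"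
  using a_gt by (simp add: one_less_power)

text \<open>Divided by (a^2 - 1)^2 this reads c^2 - k/P - 1/P^2 >= 0 with P = a^2 - 1: the potential
  at \<open>a\<close> stays nonnegative even if its last term has the wrong sign.\<close>

lemma P_gap: "c\<^sup>2 * (a\<^sup>2 - 1)\<^sup>2 \<ge> k * (a\<^sup>2 - 1) + 1"
proof -
  define P where "P = a\<^sup>2 - 1"
  have cp: "c > 0" using c_gt by simp
  have gap: "c\<^sup>2 * P - k \<ge> c" using turning_gap by (simp add: P_def)
  then have "c * (c * P) \<ge> c * 1" using k_pos by (simp add: power2_eq_square mult.assoc)
  then have cP: "c * P \<ge> 1" using cp by simp
  have "1 \<le> P * c" using cP by (simp add: mult.commute)
  also have "\<dots> \<le> P * (c\<^sup>2 * P - k)" using gap P_pos by (intro mult_left_mono) (auto simp: P_def)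
  finally show ?thesis unfolding P_def[symmetric] by (simp add: power2_eq_square algebra_simps)
qed

text \<open>Sonin-type energy for \<open>sqrt (x\<^sup>2 - 1) f x\<close>; the exponential factor absorbs the
  term \<open>1 / (x\<^sup>2 - 1)\<^sup>2\<close> of the potential.\<close>
lemma energy_bound:
  assumes "x \<ge> a"
  shows "(x\<^sup>2 - 1) * (f x)\<^sup>2 \<le> (a\<^sup>2 - 1) * (f a)\<^sup>2 * exp (1/2)"
proof -
  define P where "P = a\<^sup>2 - 1"
  define w where "w = (\<lambda>x. c\<^sup>2 * (x\<^sup>2 - 1) - k)"
  \<comment> \<open>With \<Phi> = sqrt (x^2 - 1) f this is \<Phi>^2 + (\<Phi>')^2 / (c^2 - k / (x^2
    - 1)). The term 1 / (x^2 - 1)^2 is left out of the denominator, so the derivative of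
    \<open>E\<close> has the summand -2 u f / (p w) of unknown sign.\<close>
  define E where "E = (\<lambda>x. (x\<^sup>2 - 1) * (f x)\<^sup>2 + (u x)\<^sup>2 / w x)"
  define H where "H = (\<lambda>x. E x * exp (P / (2 * (x\<^sup>2 - 1))))"
  have cp: "c > 0" using c_gt by simp
  have P: "P > 0" using P_pos by (simp add: P_def)
  have w: "w y > 0" if "y \<ge> a" for y
  proof -
    have "c\<^sup>2 * (y\<^sup>2 - 1) \<ge> c\<^sup>2 * (a\<^sup>2 - 1)" using that a_gt by (simp add: mult_left_mono power_mono)
    then show ?thesis using turning_gap cp unfolding w_def by linarith
  qed
  have "H x \<le> H a"
  proof (rule DERIV_nonpos_imp_nonincreasing[of a x H])
    fix y assume y: "a \<le> y" "y \<le> x"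
    define p where "p = y\<^sup>2 - 1"
    have y1: "y > 1" using y a_gt by simp
    have pP: "p \<ge> P" using y a_gt by (simp add: p_def P_def)
    then have p: "p > 0" using P by simp
    have wy: "w y > 0" using w y by simp
    have weq: "w y = c\<^sup>2 * p - k" by (simp add: w_def p_def)
    \<comment> \<open>\<open>P_gap\<close> is this inequality at y = a, and w/p = c^2 - k/p grows
      with p.\<close>
    have pw: "p \<le> P\<^sup>2 * w y"
    proof -
      have "k * P \<le> c\<^sup>2 * P\<^sup>2 - 1" using P_gap by (simp add: P_def)
      then have "p * (k * P) \<le> p * (c\<^sup>2 * P\<^sup>2 - 1)" using p by (intro mult_left_mono) auto
      moreover have "P * (k * P) \<le> p * (k * P)" using pP k_pos P by (intro mult_right_mono) auto
      ultimately show ?thesis by (simp add: weq algebra_simps power2_eq_square)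
    qed
    define E' where "E' = - 2 * u y * f y / (p * w y) - 2 * y * k * (u y)\<^sup>2 / (p * (w y)\<^sup>2)"
    have g: "g y = (u y - y * f y) / p" using p by (simp add: u_def p_def)
    have u': "f y + y * g y + (k - c\<^sup>2 * p) * f y = (y * u y - f y) / p - w y * f y"
      unfolding g weq using p by (simp add: field_simps power2_eq_square p_def)
    have ud: "(u has_real_derivative (y * u y - f y) / p - w y * f y) (at y)"
      using u_deriv[of y] u' by (simp add: p_def)
    have wd: "(w has_real_derivative 2 * c\<^sup>2 * y) (at y)"
      unfolding w_def by (auto intro!: derivative_eq_intros)
    have u2: "((\<lambda>x. (u x)\<^sup>2) has_real_derivative 2 * u y * ((y * u y - f y) / p - w y * f y)) (at y)"
      by (rule DERIV_cong[OF DERIV_power[OF ud]]) simp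
    have pf: "((\<lambda>x. (x\<^sup>2 - 1) * (f x)\<^sup>2) has_real_derivative 2 * f y * u y) (at y)"
      unfolding u_def by (auto intro!: derivative_eq_intros f_deriv simp: algebra_simps power2_eq_square)
    have "(E has_real_derivative 2 * f y * u y + ((2 * u y * ((y * u y - f y) / p - w y * f y)) * w y
        - (u y)\<^sup>2 * (2 * c\<^sup>2 * y)) / (w y * w y)) (at y)"
      unfolding E_def using wy by (intro DERIV_add DERIV_divide pf u2 wd) auto
    moreover have "2 * f y * u y + ((2 * u y * ((y * u y - f y) / p - w y * f y)) * w y
        - (u y)\<^sup>2 * (2 * c\<^sup>2 * y)) / (w y * w y) = E'"
    proof -
      have c2: "c\<^sup>2 = (w y + k) / p" using weq p by simp
      show ?thesis unfolding E'_def c2 using p wy by (simp add: field_simps power2_eq_square)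
    qed
    ultimately have Ed: "(E has_real_derivative E') (at y)" by simp
    have "((\<lambda>x. P / (2 * (x\<^sup>2 - 1))) has_real_derivative (0 * (2 * (y\<^sup>2 - 1)) - P * (4 * y)) / ((2 * (y\<^sup>2 - 1)) * (2 * (y\<^sup>2 - 1)))) (at y)"
      using p by (intro DERIV_divide) (auto intro!: derivative_eq_intros simp: p_def)
    then have "((\<lambda>x. P / (2 * (x\<^sup>2 - 1))) has_real_derivative - P * y / p\<^sup>2) (at y)"
      by (rule DERIV_cong) (unfold p_def[symmetric], use p in \<open>simp add: field_simps power2_eq_square\<close>)
    then have "((\<lambda>x. exp (P / (2 * (x\<^sup>2 - 1)))) has_real_derivative exp (P / (2 * p)) * (- P * y / p\<^sup>2)) (at y)"
      unfolding p_def by (rule DERIV_fun_exp)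
    then have "(H has_real_derivative E' * exp (P / (2 * p)) + exp (P / (2 * p)) * (- P * y / p\<^sup>2) * E y) (at y)"
      unfolding H_def p_def by (rule DERIV_mult[OF Ed])
    moreover have "E' * exp (P / (2 * p)) + exp (P / (2 * p)) * (- P * y / p\<^sup>2) * E y \<le> 0"
    proof -
      have "E' \<le> - 2 * u y * f y / (p * w y)"
        unfolding E'_def using y1 k_pos p wy by (simp)
      \<comment> \<open>Young's inequality with weight P w. The f^2 part then matches what the
        exponential factor removes, since y >= 1, and the u^2 part does so by
        \<open>pw\<close>.\<close>
      also have "\<dots> \<le> (P * w y * (f y)\<^sup>2 + (u y)\<^sup>2 / (P * w y)) / (p * w y)"
      proof -
        have Pw: "P * w y > 0" using P wy by simp
        have "0 \<le> (P * w y * f y + u y)\<^sup>2 / (P * w y)" using Pw by simp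
        also have "\<dots> = P * w y * (f y)\<^sup>2 + (u y)\<^sup>2 / (P * w y) + 2 * u y * f y"
          using Pw P wy by (simp add: field_simps power2_eq_square)
        finally have "- 2 * u y * f y \<le> P * w y * (f y)\<^sup>2 + (u y)\<^sup>2 / (P * w y)" by simp
        then show ?thesis using p wy by (intro divide_right_mono) auto
      qed
      also have "\<dots> = P / p * (f y)\<^sup>2 + (u y)\<^sup>2 * (1 / (P * p * (w y)\<^sup>2))"
        using P p wy by (simp add: field_simps power2_eq_square)
      also have "\<dots> \<le> P / p * (f y)\<^sup>2 * y + (u y)\<^sup>2 * (P / (p\<^sup>2 * w y) * y)"
      proof (intro add_mono mult_left_mono)
        have "P / p * (f y)\<^sup>2 * 1 \<le> P / p * (f y)\<^sup>2 * y"
          using y1 P p by (intro mult_left_mono) auto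
        then show "P / p * (f y)\<^sup>2 \<le> P / p * (f y)\<^sup>2 * y" by simp
        have "1 / (P * p * (w y)\<^sup>2) \<le> P / (p\<^sup>2 * w y)"
        proof -
          have "p * (p * w y) \<le> P\<^sup>2 * w y * (p * w y)" using pw p wy by (intro mult_right_mono) auto
          then show ?thesis using P p wy by (simp add: divide_simps power2_eq_square)
        qed
        also have "P / (p\<^sup>2 * w y) * 1 \<le> P / (p\<^sup>2 * w y) * y"
          using y1 P p wy by (intro mult_left_mono) auto
        finally show "1 / (P * p * (w y)\<^sup>2) \<le> P / (p\<^sup>2 * w y) * y" by simp
      qed auto
      also have "\<dots> = P * y / p\<^sup>2 * E y"
        unfolding E_def p_def[symmetric] using p wy by (simp add: field_simps power2_eq_square)
      finally have "E' - P * y / p\<^sup>2 * E y \<le> 0" by simp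
      then have "exp (P / (2 * p)) * (E' - P * y / p\<^sup>2 * E y) \<le> 0"
        by (intro mult_nonneg_nonpos) auto
      then show ?thesis by (simp add: algebra_simps)
    qed
    ultimately show "\<exists>d. (H has_real_derivative d) (at y) \<and> d \<le> 0" by blast
  qed (use assms in auto)
  \<comment> \<open>The exponent P / (2 p) equals 1/2 at \<open>a\<close> and is positive beyond, so
    passing between \<open>H\<close> and \<open>E\<close> costs only exp (1/2).\<close>
  moreover have "H a = P * (f a)\<^sup>2 * exp (1/2)"
    unfolding H_def E_def P_def[symmetric] using P by (simp add: ua)
  moreover have "(x\<^sup>2 - 1) * (f x)\<^sup>2 \<le> H x"
  proof -
    have p: "x\<^sup>2 - 1 > 0" using assms a_gt by (simp add: one_less_power)
    then have nn: "0 \<le> (x\<^sup>2 - 1) * (f x)\<^sup>2" "0 \<le> (u x)\<^sup>2 / w x" using w[OF assms] by auto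
    have "1 \<le> exp (P / (2 * (x\<^sup>2 - 1)))" using P p by simp
    then have "E x * 1 \<le> E x * exp (P / (2 * (x\<^sup>2 - 1)))"
      using nn by (intro mult_left_mono) (auto simp: E_def)
    moreover have "(x\<^sup>2 - 1) * (f x)\<^sup>2 \<le> E x" using nn by (simp add: E_def)
    ultimately show ?thesis by (simp add: H_def)
  qed
  ultimately show ?thesis by (simp add: P_def)
qed

end

section \<open>Asymptotics from the integral equation\<close>

text \<open>Stated for general \<open>H\<close> because it is applied to \<open>F\<close> and then
  to its derivative; the factor i c z is not divided out, so z = 0 needs no exception.\<close>

lemma fourier_integral_by_parts:
  fixes H H' :: "complex \<Rightarrow> complex" and c :: real
  assumes d: "\<And>z. (H has_field_derivative H' z) (at z)" and cont: "continuous_on UNIV H'"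
  shows "\<i> * c * z * integral {-1..1} (\<lambda>t. H (of_real t) * exp (\<i> * c * z * of_real t))
    = H 1 * exp (\<i> * c * z) - H (-1) * exp (- (\<i> * c * z))
      - integral {-1..1} (\<lambda>t. H' (of_real t) * exp (\<i> * c * z * of_real t))"
proof -
  define e where "e = (\<lambda>t::real. exp (\<i> * c * z * of_real t))"
  have cH: "continuous_on UNIV H"
    using d by (meson DERIV_isCont continuous_at_imp_continuous_on)
  have ce: "continuous_on {-1..1} e" unfolding e_def by (intro continuous_intros)
  have cHr: "continuous_on {-1..1::real} (\<lambda>t. h (of_real t))" if "continuous_on UNIV h" for h :: "complex \<Rightarrow> complex"
    using that by (rule continuous_on_compose2[where f = of_real]) (auto intro: continuous_on_of_real_id)
  have i1: "(\<lambda>t. H (of_real t) * e t) integrable_on {-1..1}"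
    by (intro integrable_continuous_interval continuous_on_mult cHr cH ce)
  have i2: "(\<lambda>t. H' (of_real t) * e t) integrable_on {-1..1}"
    by (intro integrable_continuous_interval continuous_on_mult cHr cont ce)
  have ed: "(e has_vector_derivative (\<i> * c * z * e t)) (at t within A)" for t A
  proof -
    have "((\<lambda>w. exp (\<i> * c * z * w)) has_field_derivative (\<i> * c * z * e t)) (at (of_real t))"
      by (auto intro!: derivative_eq_intros simp: e_def)
    then show ?thesis unfolding e_def by (rule has_vector_derivative_real_field)
  qed
  have h1: "((\<lambda>t. H' (of_real t) * e t + \<i> * c * z * (H (of_real t) * e t)) has_integral
      H (of_real 1) * e 1 - H (of_real (-1)) * e (-1)) {-1..1}"
  proof (rule fundamental_theorem_of_calculus)
    fix t :: real assume "t \<in> {-1..1}"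
    have "((\<lambda>t. H (of_real t)) has_vector_derivative H' (of_real t)) (at t within {-1..1})"
      by (intro has_vector_derivative_real_field d)
    from has_vector_derivative_mult[OF this ed]
    show "((\<lambda>t. H (of_real t) * e t) has_vector_derivative
       H' (of_real t) * e t + \<i> * c * z * (H (of_real t) * e t)) (at t within {-1..1})"
      by (simp add: algebra_simps)
  qed simp
  have h2: "((\<lambda>t. H' (of_real t) * e t + \<i> * c * z * (H (of_real t) * e t)) has_integral
      integral {-1..1} (\<lambda>t. H' (of_real t) * e t) + \<i> * c * z * integral {-1..1} (\<lambda>t. H (of_real t) * e t)) {-1..1}"
    by (intro has_integral_add has_integral_mult_right integrable_integral i1 i2)
  have "integral {-1..1} (\<lambda>t. H' (of_real t) * e t) + \<i> * c * z * integral {-1..1} (\<lambda>t. H (of_real t) * e t)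
    = H 1 * e 1 - H (-1) * e (-1)"
    using has_integral_unique[OF h2 h1] by simp
  then show ?thesis by (simp add: e_def algebra_simps)
qed

lemma norm_fourier_integral_le:
  fixes H :: "complex \<Rightarrow> complex" and c :: real
  assumes cont: "continuous_on UNIV H" and B: "\<And>t. t \<in> {-1..1} \<Longrightarrow> norm (H (of_real t)) \<le> B" and "c \<ge> 0"
  shows "norm (integral {-1..1} (\<lambda>t. H (of_real t) * exp (\<i> * c * z * of_real t))) \<le> 2 * B * exp (c * \<bar>Im z\<bar>)"
proof -
  have "norm (integral {-1..1} (\<lambda>t. H (of_real t) * exp (\<i> * c * z * of_real t))) \<le> B * exp (c * \<bar>Im z\<bar>) * (1 - (-1))"
  proof (rule integral_bound)
    have "continuous_on {-1..1::real} (\<lambda>t. H (of_real t))"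
      using cont by (rule continuous_on_compose2[where f = of_real]) (auto intro: continuous_on_of_real_id)
    then show "continuous_on {-1..1} (\<lambda>t. H (of_real t) * exp (\<i> * c * z * of_real t))"
      by (rule continuous_on_mult) (intro continuous_intros)
    fix t :: real assume t: "t \<in> {-1..1}"
    have "Re (\<i> * c * z * of_real t) = c * (- (Im z * t))" by simp
    also have "- (Im z * t) \<le> \<bar>Im z * t\<bar>" by simp
    also have "\<bar>Im z * t\<bar> \<le> \<bar>Im z\<bar> * 1" unfolding abs_mult using t by (intro mult_left_mono) auto
    finally have "Re (\<i> * c * z * of_real t) \<le> c * \<bar>Im z\<bar>"
      using \<open>c \<ge> 0\<close> by (simp add: mult_left_mono)
    then show "norm (H (of_real t) * exp (\<i> * c * z * of_real t)) \<le> B * exp (c * \<bar>Im z\<bar>)"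
      unfolding norm_mult norm_exp_eq_Re using B[OF t] norm_ge_zero
      by (intro mult_mono) (auto intro: order_trans[OF norm_ge_zero])
  qed simp
  then show ?thesis by (simp add: mult_ac)
qed

locale spheroidal_band_limited = spheroidal_critical +
  fixes lam :: complex
  assumes F_int: "\<And>z. lam * F z = integral {-1..1} (\<lambda>t. F (of_real t) * exp (\<i> * of_real c * z * of_real t))"
    and parity: "(\<forall>z. F (- z) = F z) \<or> (\<forall>z. F (- z) = - F z)"
    and lam_nz: "lam \<noteq> 0"
begin

lemma norm_F_minus: "norm (F (- z)) = norm (F z)"
  using parity by (metis norm_minus_cancel)

text \<open>The first integration by parts gives the boundary terms, the second shows that the
  remainder is smaller by a factor 1/|z|. One estimate serves the real direction, for the amplitude,
  and the imaginary direction, for the horizontal sides of the contour.\<close>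

lemma F_asymptotic:
  obtains C where "C \<ge> 0"
    "\<And>z. norm z * norm (\<i> * c * z * (lam * F z) - (F 1 * exp (\<i> * c * z) - F (-1) * exp (- (\<i> * c * z))))
      \<le> C * exp (c * \<bar>Im z\<bar>)"
proof -
  have cp: "c > 0" using c_gt by simp
  define G' where "G' = deriv G"
  have G': "(G has_field_derivative G' z) (at z)" for z
    unfolding G'_def using G_holomorphic[of UNIV] holomorphic_derivI[of G UNIV z UNIV] by simp
  have contG: "continuous_on UNIV G" using G_holomorphic holomorphic_on_imp_continuous_on by blast
  have "G' holomorphic_on UNIV" unfolding G'_def using G_holomorphic by (intro holomorphic_deriv) auto
  then have contG': "continuous_on UNIV G'" by (rule holomorphic_on_imp_continuous_on)
  have "compact ((\<lambda>t. G' (of_real t)) ` {-1..1})"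
    by (intro compact_continuous_image continuous_on_compose2[OF contG'] continuous_on_of_real_id) auto
  then obtain B where B: "\<And>t. t \<in> {-1..1} \<Longrightarrow> norm (G' (of_real t)) \<le> B"
    using compact_imp_bounded bounded_iff by (metis imageI)
  define C where "C = (norm (G 1) + norm (G (-1)) + 2 * B) / c"
  have B0: "B \<ge> 0" using B[of 0] norm_ge_zero by (meson order_trans atLeastAtMost_iff zero_le_one neg_le_0_iff_le)
  show ?thesis
  proof
    show "C \<ge> 0" using B0 cp by (simp add: C_def)
    fix z
    define J where "J = integral {-1..1} (\<lambda>t. G (of_real t) * exp (\<i> * c * z * of_real t))"
    define J' where "J' = integral {-1..1} (\<lambda>t. G' (of_real t) * exp (\<i> * c * z * of_real t))"
    have e1: "norm (exp (\<i> * c * z)) \<le> exp (c * \<bar>Im z\<bar>)" "norm (exp (- (\<i> * c * z))) \<le> exp (c * \<bar>Im z\<bar>)"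
      unfolding norm_exp_eq_Re using cp by (auto simp: abs_if mult_le_0_iff)
    have 1: "\<i> * c * z * (lam * F z) - (F 1 * exp (\<i> * c * z) - F (-1) * exp (- (\<i> * c * z))) = - J"
      unfolding F_int fourier_integral_by_parts[OF F_deriv contG] J_def by simp
    have "norm (\<i> * c * z * J) = norm (G 1 * exp (\<i> * c * z) - G (-1) * exp (- (\<i> * c * z)) - J')"
      unfolding J_def J'_def fourier_integral_by_parts[OF G' contG'] ..
    also have "\<dots> \<le> norm (G 1 * exp (\<i> * c * z)) + norm (G (-1) * exp (- (\<i> * c * z))) + norm J'"
      by (meson add_right_mono norm_triangle_ineq4 order_trans)
    also have "\<dots> \<le> norm (G 1) * exp (c * \<bar>Im z\<bar>) + norm (G (-1)) * exp (c * \<bar>Im z\<bar>) + 2 * B * exp (c * \<bar>Im z\<bar>)"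
      unfolding norm_mult J'_def using cp
      by (intro add_mono mult_left_mono e1 norm_fourier_integral_le contG' B) auto
    finally have "c * (norm z * norm J) \<le> (norm (G 1) + norm (G (-1)) + 2 * B) * exp (c * \<bar>Im z\<bar>)"
      using cp by (simp add: norm_mult algebra_simps)
    then have "norm z * norm J \<le> C * exp (c * \<bar>Im z\<bar>)"
      using cp by (simp add: C_def field_simps)
    then show "norm z * norm (\<i> * c * z * (lam * F z) - (F 1 * exp (\<i> * c * z) - F (-1) * exp (- (\<i> * c * z))))
      \<le> C * exp (c * \<bar>Im z\<bar>)" unfolding 1 by simp
  qed
qed

text \<open>For large |Im z| one of the two exponentials dominates. A constant lower bound suffices
  for the horizontal sides, since the factor z - t already provides decay there.\<close>

lemma F_lower_far:
  obtains \<delta> Y0 where "\<delta> > 0" "Y0 \<ge> 1"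
    "\<And>z. \<bar>Re z\<bar> \<le> a \<Longrightarrow> \<bar>Im z\<bar> \<ge> Y0 \<Longrightarrow> norm (F z) \<ge> \<delta>"
proof -
  obtain C where C: "C \<ge> 0"
    "\<And>z. norm z * norm (\<i> * c * z * (lam * F z) - (F 1 * exp (\<i> * c * z) - F (-1) * exp (- (\<i> * c * z))))
      \<le> C * exp (c * \<bar>Im z\<bar>)" using F_asymptotic by blast
  have cp: "c > 0" using c_gt by simp
  have F1: "norm (F 1) = f 1" "norm (F (-1)) = f 1"
    using norm_F_minus[of 1] F_of_real[of 1] f1_pos by simp_all
  define \<delta> where "\<delta> = f 1 / (8 * norm lam)"
  \<comment> \<open>\<open>a\<close> gives |z| <= 2 Y, the bound 2 makes exp (-c Y) at most a
    quarter of exp (c Y), and 2 C / f 1 keeps the error below half of f 1 exp (c Y).\<close>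
  define Y0 where "Y0 = max (max a 2) (2 * C / f 1)"
  show ?thesis
  proof
    show "\<delta> > 0" using f1_pos lam_nz by (simp add: \<delta>_def)
    show "Y0 \<ge> 1" by (simp add: Y0_def)
    fix z :: complex assume z: "\<bar>Re z\<bar> \<le> a" "\<bar>Im z\<bar> \<ge> Y0"
    define Y where "Y = \<bar>Im z\<bar>"
    have Y: "Y \<ge> a" "Y \<ge> 2" "Y \<ge> 2 * C / f 1" using z by (auto simp: Y0_def Y_def)
    have nz: "norm z \<ge> Y" unfolding Y_def by (rule abs_Im_le_cmod)
    have nz2: "norm z \<le> 2 * Y" using cmod_le[of z] z Y by (simp add: Y_def)
    define D where "D = F 1 * exp (\<i> * c * z) - F (-1) * exp (- (\<i> * c * z))"
    define X where "X = \<i> * c * z * (lam * F z)"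
    have "norm D \<ge> f 1 * (exp (c * Y) - exp (- (c * Y)))"
    proof -
      have n: "norm (exp (\<i> * c * z)) = exp (- (c * Im z))" "norm (exp (- (\<i> * c * z))) = exp (c * Im z)"
        unfolding norm_exp_eq_Re by simp_all
      have "norm D \<ge> \<bar>norm (F 1 * exp (\<i> * c * z)) - norm (F (-1) * exp (- (\<i> * c * z)))\<bar>"
        unfolding D_def by (rule norm_triangle_ineq3)
      also have "norm (F 1 * exp (\<i> * c * z)) - norm (F (-1) * exp (- (\<i> * c * z))) = f 1 * (exp (- (c * Im z)) - exp (c * Im z))"
        unfolding norm_mult F1 n by (simp add: algebra_simps)
      also have "\<bar>f 1 * (exp (- (c * Im z)) - exp (c * Im z))\<bar> = f 1 * \<bar>exp (- (c * Im z)) - exp (c * Im z)\<bar>"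
        using f1_pos by (simp add: abs_mult)
      also have "\<dots> \<ge> f 1 * (exp (c * Y) - exp (- (c * Y)))"
        using f1_pos unfolding Y_def by (intro mult_left_mono) (auto simp: abs_if)
      finally show ?thesis .
    qed
    moreover have "exp (- (c * Y)) \<le> exp (c * Y) / 4"
    proof -
      have "c * Y \<ge> 1 * 2" using c_gt Y by (intro mult_mono) auto
      then have "4 \<le> exp (2 * (c * Y))" using exp_ge_add_one_self[of "2 * (c * Y)"] by linarith
      then have "4 * exp (- (c * Y)) \<le> exp (2 * (c * Y)) * exp (- (c * Y))" by simp
      then show ?thesis by (simp add: exp_add[symmetric] mult.commute)
    qed
    then have "f 1 * (exp (c * Y) - exp (- (c * Y))) \<ge> f 1 * (3 / 4 * exp (c * Y))"
      using f1_pos by (intro mult_left_mono) auto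
    moreover have "norm (X - D) \<le> f 1 / 2 * exp (c * Y)"
    proof -
      have "Y * norm (X - D) \<le> norm z * norm (X - D)" using nz by (intro mult_right_mono) auto
      also have "\<dots> \<le> C * exp (c * Y)" using C(2)[of z] by (simp add: X_def D_def Y_def)
      also have "\<dots> \<le> (Y * f 1 / 2) * exp (c * Y)" using Y(3) f1_pos by (intro mult_right_mono) (auto simp: field_simps)
      finally have "Y * norm (X - D) \<le> Y * (f 1 / 2 * exp (c * Y))" by simp
      then show ?thesis using Y by simp
    qed
    moreover have "norm D \<le> norm X + norm (X - D)"
      by (metis norm_minus_commute norm_triangle_sub)
    ultimately have "f 1 / 4 * exp (c * Y) \<le> norm X" by simp
    also have "norm X = c * norm z * norm lam * norm (F z)" using cp by (simp add: X_def norm_mult)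
    also have "\<dots> \<le> c * (2 * Y) * norm lam * norm (F z)"
      using nz2 cp by (intro mult_right_mono mult_left_mono) auto
    finally have "f 1 / 4 * exp (c * Y) \<le> c * (2 * Y) * norm lam * norm (F z)" .
    moreover have "c * Y \<le> exp (c * Y)" using exp_ge_add_one_self[of "c * Y"] by linarith
    then have "f 1 / 4 * (c * Y) \<le> f 1 / 4 * exp (c * Y)"
      using f1_pos by (intro mult_left_mono) auto
    ultimately have "(c * Y) * (f 1 / 4) \<le> (c * Y) * (2 * norm lam * norm (F z))" by (simp add: mult_ac)
    moreover have "c * Y > 0" using cp Y by simp
    ultimately have "f 1 / 4 \<le> 2 * norm lam * norm (F z)" by (simp only: mult_le_cancel_left_pos)
    then show "\<delta> \<le> norm (F z)" using lam_nz by (simp add: \<delta>_def field_simps)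
  qed
qed

text \<open>\<open>energy_bound\<close> holds at every x >= a. Evaluated along a sequence tending to
  infinity on which the leading term of \<open>F_asymptotic\<close> has its full modulus 2 f 1, it
  gives the claim in the limit.\<close>

lemma amplitude_bound:
  "(2 * f 1 / (c * norm lam))\<^sup>2 \<le> (a\<^sup>2 - 1) * (f a)\<^sup>2 * exp (1/2)"
proof -
  obtain C where C: "C \<ge> 0"
    "\<And>z. norm z * norm (\<i> * c * z * (lam * F z) - (F 1 * exp (\<i> * c * z) - F (-1) * exp (- (\<i> * c * z))))
      \<le> C * exp (c * \<bar>Im z\<bar>)" using F_asymptotic by blast
  have cp: "c > 0" using c_gt by simp
  have F1: "F 1 = of_real (f 1)" using F_of_real[of 1] by simp
  have sc: "sin (2 * pi * real n) = 0" "cos (2 * pi * real n) = 1" for n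
    using sin_2npi[of n] cos_2npi[of n] by (simp_all add: mult_ac)
  \<comment> \<open>The leading term is a multiple of the sine of c x for even \<open>F\<close> and
    of the cosine for odd \<open>F\<close>, so the peaks are at phase pi/2 and 0
    respectively.\<close>
  obtain \<phi> where \<phi>: "\<And>n::nat. norm (F 1 * exp (\<i> * of_real (2 * pi * n + \<phi>)) - F (-1) * exp (- (\<i> * of_real (2 * pi * n + \<phi>)))) = 2 * f 1"
  proof (cases "\<forall>z. F (- z) = F z")
    case True
    show ?thesis
    proof (rule that[of "pi / 2"])
      fix n :: nat
      have e: "exp (\<i> * of_real (2 * pi * n + pi / 2)) = \<i>"
        by (simp add: exp_eq_polar cis_conv_exp[symmetric] complex_eq_iff cos_add sin_add sc)
      show "norm (F 1 * exp (\<i> * of_real (2 * pi * n + pi / 2)) - F (-1) * exp (- (\<i> * of_real (2 * pi * n + pi / 2)))) = 2 * f 1"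
        unfolding exp_minus e using True[rule_format, of 1] f1_pos by (simp add: F1 norm_mult)
    qed
  next
    case False
    then have odd: "F (- 1) = - F 1" using parity by blast
    show ?thesis
    proof (rule that[of 0])
      fix n :: nat
      have e: "exp (\<i> * of_real (2 * pi * n + 0)) = 1"
        by (simp add: exp_eq_polar cis_conv_exp[symmetric] complex_eq_iff cos_add sin_add sc)
      show "norm (F 1 * exp (\<i> * of_real (2 * pi * n + 0)) - F (-1) * exp (- (\<i> * of_real (2 * pi * n + 0)))) = 2 * f 1"
        unfolding exp_minus e using odd f1_pos by (simp add: F1 norm_mult)
    qed
  qed
  define x where "x = (\<lambda>n::nat. (2 * pi * n + \<phi>) / c)"
  have x_lim: "filterlim x at_top sequentially"
  proof -
    have "filterlim (\<lambda>n::nat. 2 * pi * real n) at_top sequentially"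
      by (intro filterlim_tendsto_pos_mult_at_top[OF tendsto_const _ filterlim_real_sequentially]) simp
    then have "filterlim (\<lambda>n::nat. \<phi> + 2 * pi * real n) at_top sequentially"
      by (rule filterlim_tendsto_add_at_top[OF tendsto_const])
    then have "filterlim (\<lambda>n::nat. (1 / c) * (\<phi> + 2 * pi * real n)) at_top sequentially"
      using cp by (intro filterlim_tendsto_pos_mult_at_top[OF tendsto_const]) auto
    then show ?thesis by (simp add: x_def add.commute)
  qed
  \<comment> \<open>A lower bound for (x^2 - 1) (f x)^2, written in 1/x so that its limit is
    immediate.\<close>
  define L where "L = (\<lambda>x. (1 - inverse x ^ 2) * ((2 * f 1 - C * inverse x) / (c * norm lam))\<^sup>2)"
  have "(\<lambda>n. L (x n)) \<longlonglongrightarrow> (1 - 0 ^ 2) * ((2 * f 1 - C * 0) / (c * norm lam))\<^sup>2"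
    unfolding L_def using cp lam_nz
    by (intro tendsto_intros tendsto_inverse_0_at_top[OF x_lim]) auto
  moreover have "eventually (\<lambda>n. L (x n) \<le> (a\<^sup>2 - 1) * (f a)\<^sup>2 * exp (1/2)) sequentially"
  proof -
    have "eventually (\<lambda>n. x n \<ge> max a (C / f 1)) sequentially"
      using x_lim filterlim_at_top by blast
    then show ?thesis
    proof eventually_elim
      case (elim n)
      define y where "y = x n"
      have y: "y \<ge> a" "y \<ge> C / f 1" "y > 1" using elim a_gt by (auto simp: y_def)
      have cy: "c * y = 2 * pi * n + \<phi>" using cp by (simp add: y_def x_def)
      define D where "D = F 1 * exp (\<i> * of_real (c * y)) - F (-1) * exp (- (\<i> * of_real (c * y)))"
      have D: "norm D = 2 * f 1" unfolding D_def cy by (rule \<phi>)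
      define X where "X = \<i> * of_real (c * y) * (lam * F (of_real y))"
      have "y * norm (X - D) \<le> C"
        using C(2)[of "of_real y"] y by (simp add: X_def D_def mult.assoc)
      then have "norm (X - D) \<le> C * inverse y" using y by (simp add: field_simps)
      moreover have "norm D \<le> norm X + norm (X - D)"
        by (metis norm_minus_commute norm_triangle_sub)
      ultimately have "2 * f 1 - C * inverse y \<le> norm X" using D by simp
      also have "norm X = y * \<bar>f y\<bar> * (c * norm lam)" using cp y by (simp add: X_def norm_mult F_of_real)
      finally have "(2 * f 1 - C * inverse y) / (c * norm lam) \<le> y * \<bar>f y\<bar>"
        using cp lam_nz by (simp add: pos_divide_le_eq)
      moreover have "0 \<le> (2 * f 1 - C * inverse y) / (c * norm lam)"
      proof -
        have "C * inverse y \<le> f 1" using y f1_pos by (simp add: field_simps)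
        then show ?thesis using f1_pos cp by simp
      qed
      ultimately have "((2 * f 1 - C * inverse y) / (c * norm lam))\<^sup>2 \<le> (y * \<bar>f y\<bar>)\<^sup>2"
        by (rule power_mono)
      moreover have "1 - inverse y ^ 2 \<ge> 0" using y by (simp add: power_le_one inverse_le_1_iff)
      ultimately have "L y \<le> (1 - inverse y ^ 2) * (y * \<bar>f y\<bar>)\<^sup>2"
        unfolding L_def by (rule mult_left_mono)
      also have "\<dots> = (y\<^sup>2 - 1) * (f y)\<^sup>2" using y by (simp add: power_mult_distrib field_simps)
      also have "\<dots> \<le> (a\<^sup>2 - 1) * (f a)\<^sup>2 * exp (1/2)" using energy_bound y by simp
      finally show ?case by (simp add: y_def)
    qed
  qed
  ultimately have "(1 - 0 ^ 2) * ((2 * f 1 - C * 0) / (c * norm lam))\<^sup>2 \<le> (a\<^sup>2 - 1) * (f a)\<^sup>2 * exp (1/2)"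
    using tendsto_upperbound sequentially_bot by blast
  then show ?thesis by simp
qed

end

section \<open>Complex zeros and growth on vertical lines\<close>

text \<open>By Cauchy-Schwarz the modulus N = |w| satisfies N'' >= Re V N. Its slope at 0 vanishes
  since w' does, so N >= N 0, and two integrations of m N 0 y^2 / (B + y^2) give the claim.\<close>

lemma norm_growth_of_second_derivative:
  fixes w w1 V :: "real \<Rightarrow> complex"
  assumes wd: "\<And>y. (w has_vector_derivative w1 y) (at y)"
    and w1d: "\<And>y. (w1 has_vector_derivative V y * w y) (at y)"
    and w10: "w1 0 = 0" and w0: "w 0 \<noteq> 0" and B: "B > 0"
    and V: "\<And>y. y \<ge> 0 \<Longrightarrow> Re (V y) \<ge> m * (y\<^sup>2 / (B + y\<^sup>2))" and m: "m \<ge> 0" and y: "y \<ge> 0"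
  shows "norm (w y) \<ge> norm (w 0) * (1 + m * y ^ 4 / (12 * (B + y\<^sup>2)))"
proof -
  define A C A1 C1 where "A = (\<lambda>y. Re (w y))" and "C = (\<lambda>y. Im (w y))"
    and "A1 = (\<lambda>y. Re (w1 y))" and "C1 = (\<lambda>y. Im (w1 y))"
  define A2 C2 where "A2 = (\<lambda>y. Re (V y * w y))" and "C2 = (\<lambda>y. Im (V y * w y))"
  have [derivative_intros]: "(A has_real_derivative A1 y) (at y)" "(C has_real_derivative C1 y) (at y)"
     "(A1 has_real_derivative A2 y) (at y)" "(C1 has_real_derivative C2 y) (at y)" for y
    unfolding A_def C_def A1_def C1_def A2_def C2_def
    using has_field_derivative_Re[OF wd] has_field_derivative_Im[OF wd]
      has_field_derivative_Re[OF w1d] has_field_derivative_Im[OF w1d] by auto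
  define E where "E = (\<lambda>y. (A y)\<^sup>2 + (C y)\<^sup>2)"
  define e where "e = (\<lambda>y. A y * A1 y + C y * C1 y)"
  define e' where "e' = (\<lambda>y. (A1 y)\<^sup>2 + (C1 y)\<^sup>2 + Re (V y) * E y)"
  have EN: "E y = (norm (w y))\<^sup>2" for y by (simp add: E_def A_def C_def cmod_power2)
  have Enn: "E y \<ge> 0" for y by (simp add: E_def)
  have Ed: "(E has_real_derivative 2 * e y) (at y)" for y
    unfolding E_def e_def by (auto intro!: derivative_eq_intros simp: algebra_simps)
  have "A y * A2 y + C y * C2 y = Re (V y) * E y" for y
    by (simp add: A_def C_def A2_def C2_def E_def power2_eq_square algebra_simps)
  then have ed: "(e has_real_derivative e' y) (at y)" for y
    unfolding e_def e'_def by (auto intro!: derivative_eq_intros simp: algebra_simps power2_eq_square)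
  have ReV: "Re (V y) \<ge> 0" if "y \<ge> 0" for y
  proof -
    have "m * (y\<^sup>2 / (B + y\<^sup>2)) \<ge> 0" using m B by (intro mult_nonneg_nonneg divide_nonneg_nonneg) auto
    then show ?thesis using V[OF that] by linarith
  qed
  have e0: "e 0 = 0" by (simp add: e_def A1_def C1_def w10)
  have enn: "e y \<ge> 0" if "y \<ge> 0" for y
  proof -
    have "e 0 \<le> e y"
    proof (rule DERIV_nonneg_imp_nondecreasing[OF that])
      fix t assume "0 \<le> t" "t \<le> y"
      then have "e' t \<ge> 0" using ReV Enn unfolding e'_def by (intro add_nonneg_nonneg mult_nonneg_nonneg) auto
      then show "\<exists>d. (e has_real_derivative d) (at t) \<and> 0 \<le> d" using ed by blast
    qed
    then show ?thesis using e0 by simp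
  qed
  have Emono: "E 0 \<le> E y" if "y \<ge> 0" for y
    by (rule DERIV_nonneg_imp_nondecreasing[OF that]) (use Ed enn in fastforce)
  have E0: "E 0 > 0" using w0 by (simp add: EN)
  have Epos: "E y > 0" if "y \<ge> 0" for y using Emono[OF that] E0 by linarith
  define N where "N = (\<lambda>y. sqrt (E y))"
  have NN: "N y = norm (w y)" for y by (simp add: N_def EN)
  have Nmono: "N 0 \<le> N y" if "y \<ge> 0" for y using Emono[OF that] by (simp add: N_def)
  have Npos: "N y > 0" if "y \<ge> 0" for y using Epos[OF that] by (simp add: N_def)
  have NE: "N y * N y = E y" for y using Enn[of y] by (simp add: N_def)
  define N1 where "N1 = (\<lambda>y. e y / N y)"
  have Nd: "(N has_real_derivative N1 y) (at y)" if "y \<ge> 0" for y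
    unfolding N_def N1_def
    by (rule DERIV_cong[OF DERIV_chain2[OF DERIV_real_sqrt Ed]]) (use Epos[OF that] in \<open>auto simp: field_simps N_def\<close>)
  have N1d: "(N1 has_real_derivative (e' y * N y - e y * N1 y) / (N y * N y)) (at y)" if "y \<ge> 0" for y
    using Npos[OF that] unfolding N1_def[abs_def] by (intro DERIV_divide ed Nd[OF that, unfolded N1_def]) auto
  have N2: "(e' y * N y - e y * N1 y) / (N y * N y) \<ge> Re (V y) * N y" if "y \<ge> 0" for y
  proof -
    \<comment> \<open>Lagrange's identity in the plane, which yields the Cauchy-Schwarz inequality
      needed for N''.\<close>
    have "(e y)\<^sup>2 + (A y * C1 y - C y * A1 y)\<^sup>2 = E y * ((A1 y)\<^sup>2 + (C1 y)\<^sup>2)"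
      by (simp add: e_def E_def power2_eq_square algebra_simps)
    moreover have "(A y * C1 y - C y * A1 y)\<^sup>2 \<ge> 0" by simp
    ultimately have "(e y)\<^sup>2 \<le> E y * ((A1 y)\<^sup>2 + (C1 y)\<^sup>2)" by linarith
    then have "e y * e y \<le> E y * (e' y - Re (V y) * E y)" by (simp add: e'_def power2_eq_square)
    then have "Re (V y) * E y * E y \<le> e' y * E y - e y * e y" by (simp add: algebra_simps)
    also have "e' y * E y - e y * e y = (e' y * N y - e y * N1 y) * N y"
      using Npos[OF that] by (simp add: N1_def algebra_simps NE[symmetric])
    finally have "Re (V y) * N y * (N y * N y) * N y \<le> (e' y * N y - e y * N1 y) * N y"
      by (simp add: NE[symmetric] mult_ac)
    then have "Re (V y) * N y * (N y * N y) \<le> e' y * N y - e y * N1 y"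
      using Npos[OF that] by simp
    then show ?thesis using Npos[OF that] by (simp add: pos_le_divide_eq)
  qed
  have By: "B + y\<^sup>2 > 0" for y using B by (simp add: add_pos_nonneg)
  \<comment> \<open>Instead of exact antiderivatives, simple rational minorants are used: y^3 / (3
    (B + y^2)) has derivative at most y^2 / (B + y^2), and y^4 / (12 (B + y^2)) has derivative at
    most y^3 / (3 (B + y^2)).\<close>
  have N1_lower: "N1 y \<ge> N 0 * m * (y ^ 3 / (3 * (B + y\<^sup>2)))" if y: "y \<ge> 0" for y
  proof -
    let ?h = "\<lambda>y. N1 y - N 0 * m * (y ^ 3 / (3 * (B + y\<^sup>2)))"
    have "?h 0 \<le> ?h y"
    proof (rule DERIV_nonneg_imp_nondecreasing[of 0 y ?h, OF y])
      fix t assume t: "0 \<le> t" "t \<le> y"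
      have "((\<lambda>y. y ^ 3 / (3 * (B + y\<^sup>2))) has_real_derivative
        (3 * t ^ 2 * (3 * (B + t\<^sup>2)) - t ^ 3 * (6 * t)) / ((3 * (B + t\<^sup>2)) * (3 * (B + t\<^sup>2)))) (at t)"
        using By[of t] by (intro DERIV_divide) (auto intro!: derivative_eq_intros)
      moreover have "(3 * t ^ 2 * (3 * (B + t\<^sup>2)) - t ^ 3 * (6 * t)) / ((3 * (B + t\<^sup>2)) * (3 * (B + t\<^sup>2)))
        = t\<^sup>2 / (B + t\<^sup>2) - 2 * t ^ 4 / (3 * (B + t\<^sup>2)\<^sup>2)"
        using By[of t] by (simp add: divide_simps) (simp add: algebra_simps eval_nat_numeral)
      ultimately have "(?h has_real_derivative (e' t * N t - e t * N1 t) / (N t * N t)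
          - N 0 * m * (t\<^sup>2 / (B + t\<^sup>2) - 2 * t ^ 4 / (3 * (B + t\<^sup>2)\<^sup>2))) (at t)"
        using t by (intro DERIV_diff N1d DERIV_cmult) auto
      moreover have "N 0 * m * (t\<^sup>2 / (B + t\<^sup>2) - 2 * t ^ 4 / (3 * (B + t\<^sup>2)\<^sup>2)) \<le> Re (V t) * N t"
      proof -
        have "N 0 * m * (t\<^sup>2 / (B + t\<^sup>2) - 2 * t ^ 4 / (3 * (B + t\<^sup>2)\<^sup>2)) \<le> N 0 * m * (t\<^sup>2 / (B + t\<^sup>2))"
          using Npos[of 0] m by (intro mult_left_mono) auto
        also have "\<dots> = m * (t\<^sup>2 / (B + t\<^sup>2)) * N 0" by simp
        also have "\<dots> \<le> Re (V t) * N t"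
          using V[of t] t Nmono[of t] Npos[of 0] ReV[of t] by (intro mult_mono) auto
        finally show ?thesis .
      qed
      ultimately show "\<exists>d. (?h has_real_derivative d) (at t) \<and> 0 \<le> d"
        using N2[OF t(1)] by (intro exI conjI) (assumption, linarith)
    qed
    then show ?thesis using e0 by (simp add: N1_def)
  qed
  let ?h = "\<lambda>y. N y - N 0 * m * (y ^ 4 / (12 * (B + y\<^sup>2)))"
  have "?h 0 \<le> ?h y"
  proof (rule DERIV_nonneg_imp_nondecreasing[of 0 y ?h, OF y])
    fix t assume t: "0 \<le> t" "t \<le> y"
    have "((\<lambda>y. y ^ 4 / (12 * (B + y\<^sup>2))) has_real_derivative
      (4 * t ^ 3 * (12 * (B + t\<^sup>2)) - t ^ 4 * (24 * t)) / ((12 * (B + t\<^sup>2)) * (12 * (B + t\<^sup>2)))) (at t)"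
      using By[of t] by (intro DERIV_divide) (auto intro!: derivative_eq_intros)
    moreover have "(4 * t ^ 3 * (12 * (B + t\<^sup>2)) - t ^ 4 * (24 * t)) / ((12 * (B + t\<^sup>2)) * (12 * (B + t\<^sup>2)))
      = t ^ 3 / (3 * (B + t\<^sup>2)) - t ^ 5 / (6 * (B + t\<^sup>2)\<^sup>2)"
      using By[of t] by (simp add: divide_simps) (simp add: algebra_simps eval_nat_numeral)
    ultimately have "(?h has_real_derivative N1 t
        - N 0 * m * (t ^ 3 / (3 * (B + t\<^sup>2)) - t ^ 5 / (6 * (B + t\<^sup>2)\<^sup>2))) (at t)"
      using t by (intro DERIV_diff Nd DERIV_cmult) auto
    moreover have "N 0 * m * (t ^ 3 / (3 * (B + t\<^sup>2)) - t ^ 5 / (6 * (B + t\<^sup>2)\<^sup>2)) \<le> N 0 * m * (t ^ 3 / (3 * (B + t\<^sup>2)))"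
      using Npos[of 0] m t by (intro mult_left_mono) auto
    ultimately show "\<exists>d. (?h has_real_derivative d) (at t) \<and> 0 \<le> d"
      using N1_lower[OF t(1)] by (intro exI conjI) (assumption, linarith)
  qed
  then have "N y \<ge> N 0 + N 0 * m * (y ^ 4 / (12 * (B + y\<^sup>2)))" by simp
  then show ?thesis by (simp add: NN algebra_simps)
qed

context spheroidal_critical
begin

lemma segment_deriv:
  assumes "\<And>z. (h has_field_derivative h' z) (at z)"
  shows "((\<lambda>t::real. h (z0 + of_real t * \<omega>)) has_vector_derivative \<omega> * h' (z0 + of_real t * \<omega>)) (at t)"
proof -
  have "((\<lambda>w. h (z0 + w * \<omega>)) has_field_derivative h' (z0 + of_real t * \<omega>) * \<omega>) (at (of_real t))"
    by (rule DERIV_chain2[OF assms]) (auto intro!: derivative_eq_intros)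
  from has_vector_derivative_real_field[OF this] show ?thesis by (simp add: mult.commute)
qed

text \<open>Along a ray the quantity \<open>Re (\<eta> (cnj F) p G)\<close> has derivative
  \<open>Re (\<eta> \<omega> (k - c\<^sup>2 p)) \<bar>F\<bar>\<^sup>2 + Re (\<eta> (cnj \<omega>) p) \<bar>G\<bar>\<^sup>2\<close>, so it cannot return to \<open>0\<close> when both coefficients are
  positive.\<close>
lemma nonzero_on_ray:
  assumes T: "T > 0" and \<omega>: "\<omega> \<noteq> 0"
    and start: "Re (\<eta> * cnj (F z0) * ((z0\<^sup>2 - 1) * G z0)) = 0"
    and c1: "\<And>t. 0 < t \<Longrightarrow> t < T \<Longrightarrow> Re (\<eta> * \<omega> * (of_real k - of_real (c\<^sup>2) * ((z0 + of_real t * \<omega>)\<^sup>2 - 1))) > 0"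
    and c2: "\<And>t. 0 < t \<Longrightarrow> t < T \<Longrightarrow> Re (\<eta> * cnj \<omega> * ((z0 + of_real t * \<omega>)\<^sup>2 - 1)) \<ge> 0"
  shows "F (z0 + of_real T * \<omega>) \<noteq> 0"
proof
  assume FT: "F (z0 + of_real T * \<omega>) = 0"
  define z where "z = (\<lambda>t::real. z0 + of_real t * \<omega>)"
  define p where "p = (\<lambda>t. (z t)\<^sup>2 - 1)"
  define K where "K = (\<lambda>t. of_real k - of_real (c\<^sup>2) * p t)"
  define h where "h = (\<lambda>t. Re (\<eta> * (cnj (F (z t)) * (p t * G (z t)))))"
  define h' where "h' = (\<lambda>t. Re (\<eta> * \<omega> * K t) * (norm (F (z t)))\<^sup>2 + Re (\<eta> * cnj \<omega> * p t) * (norm (G (z t)))\<^sup>2)"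
  have rr: "Re (of_real r * w) = r * Re w" for r w by simp
  have hd: "(h has_real_derivative h' t) (at t)" for t
  proof -
    have d1: "((\<lambda>t. cnj (F (z t))) has_vector_derivative cnj (\<omega> * G (z t))) (at t)"
      unfolding z_def by (intro has_vector_derivative_cnj segment_deriv F_deriv)
    have d2: "((\<lambda>t. p t * G (z t)) has_vector_derivative \<omega> * (K t * F (z t))) (at t)"
      unfolding z_def p_def K_def by (rule segment_deriv[OF pG_deriv])
    have "((\<lambda>t. \<eta> * (cnj (F (z t)) * (p t * G (z t)))) has_vector_derivative
       \<eta> * (cnj (F (z t)) * (\<omega> * (K t * F (z t))) + cnj (\<omega> * G (z t)) * (p t * G (z t)))) (at t)"
      by (intro has_vector_derivative_mult_right has_vector_derivative_mult d1 d2)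
    from has_field_derivative_Re[OF this]
    have "(h has_real_derivative Re (\<eta> * (cnj (F (z t)) * (\<omega> * (K t * F (z t))) + cnj (\<omega> * G (z t)) * (p t * G (z t))))) (at t)"
      unfolding h_def .
    moreover have "\<eta> * (cnj (F (z t)) * (\<omega> * (K t * F (z t))) + cnj (\<omega> * G (z t)) * (p t * G (z t)))
      = of_real ((norm (F (z t)))\<^sup>2) * (\<eta> * \<omega> * K t) + of_real ((norm (G (z t)))\<^sup>2) * (\<eta> * cnj \<omega> * p t)"
      unfolding complex_norm_square by (simp add: algebra_simps)
    then have "Re (\<eta> * (cnj (F (z t)) * (\<omega> * (K t * F (z t))) + cnj (\<omega> * G (z t)) * (p t * G (z t)))) = h' t"
      by (simp only: h'_def plus_complex.sel rr) (simp only: mult.commute)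
    ultimately show ?thesis by simp
  qed
  have pos: "Re (\<eta> * \<omega> * K t) > 0" "Re (\<eta> * cnj \<omega> * p t) \<ge> 0" if "0 < t" "t < T" for t
    using c1[OF that] c2[OF that] by (simp_all add: K_def p_def z_def)
  have h'nn: "h' t \<ge> 0" if "0 < t" "t < T" for t
    unfolding h'_def using pos[OF that] by (intro add_nonneg_nonneg mult_nonneg_nonneg) auto
  have hmono: "h s \<le> h t" if "0 \<le> s" "s \<le> t" "t \<le> T" for s t
  proof (rule DERIV_nonneg_imp_increasing_open[OF that(2)])
    show "continuous_on {s..t} h" 
      by (rule DERIV_continuous_on[OF has_field_derivative_at_within[OF hd]])
    fix r assume "s < r" "r < t"
    then show "\<exists>y. (h has_real_derivative y) (at r) \<and> 0 \<le> y" using hd h'nn that by (meson order_le_less_trans order_less_le_trans)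
  qed
  have h0: "h 0 = 0" using start by (simp add: h_def p_def z_def mult.assoc)
  have hT: "h T = 0" using FT by (simp add: h_def z_def)
  \<comment> \<open>A zero of \<open>F\<close> at the end of the ray makes \<open>h\<close> vanish
    at both ends; being increasing, it vanishes throughout. The strictly positive coefficient of
    |F|^2 then forces F = 0 on the ray, against f 1 > 0.\<close>
  have hz: "h t = 0" if "t \<in> {0..T}" for t using hmono[of 0 t] hmono[of t T] that h0 hT by auto
  have Fz: "F (z t) = 0" if t: "t \<in> {0<..<T}" for t
  proof -
    have "(h has_real_derivative 0) (at t)"
      by (rule has_field_derivative_transform_within_open[where f = "\<lambda>_. 0" and S = "{0<..<T}"]) (use t hz in auto)
    then have "h' t = 0" using hd DERIV_unique by blast
    moreover have "Re (\<eta> * cnj \<omega> * p t) * (norm (G (z t)))\<^sup>2 \<ge> 0" using pos[of t] t by simp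
    moreover have "Re (\<eta> * \<omega> * K t) * (norm (F (z t)))\<^sup>2 \<ge> 0" using pos[of t] t by simp
    ultimately have "Re (\<eta> * \<omega> * K t) * (norm (F (z t)))\<^sup>2 = 0" unfolding h'_def by linarith
    then show ?thesis using pos[of t] t by simp
  qed
  have lim: "z (T / 2) islimpt z ` {0<..<T}"
    unfolding islimpt_approachable
  proof (intro allI impI)
    fix e :: real assume "e > 0"
    have "T / 2 islimpt {0<..<T}" using T by (simp add: interior_limit_point interior_open)
    moreover have "e / norm \<omega> > 0" using \<omega> \<open>e > 0\<close> by simp
    ultimately obtain s where s: "s \<in> {0<..<T}" "s \<noteq> T / 2" "dist s (T / 2) < e / norm \<omega>"
      unfolding islimpt_approachable by blast
    have zd: "z s - z (T / 2) = of_real (s - T / 2) * \<omega>" by (simp add: z_def algebra_simps)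
    have "dist (z s) (z (T / 2)) = dist s (T / 2) * norm \<omega>"
      unfolding dist_norm zd norm_mult norm_of_real real_norm_def ..
    also have "\<dots> < e" using s(3) \<omega> by (simp add: pos_less_divide_eq)
    finally have "dist (z s) (z (T / 2)) < e" .
    moreover have "z s - z (T / 2) \<noteq> 0" unfolding zd using s(2) \<omega>
      by (simp only: mult_eq_0_iff of_real_eq_0_iff) simp
    then have "z s \<noteq> z (T / 2)" by simp
    ultimately show "\<exists>x'\<in>z ` {0<..<T}. x' \<noteq> z (T / 2) \<and> dist x' (z (T / 2)) < e" using s(1) by blast
  qed
  have "F 1 = 0"
    using analytic_continuation[of F UNIV "z ` {0<..<T}" "z (T / 2)" 1] F_holomorphic lim Fz by blast
  then show False using F_of_real[of 1] f1_pos by simp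
qed

text \<open>Vertical ray from the real axis, where (cnj F) p G is real. For \<omega> = i and \<eta>
  = -i the coefficients are k - c^2 Re p and -Re p, and Re p = x^2 - t^2 - 1 <= 0.\<close>

lemma F_nonzero_upper_strip:
  assumes "\<bar>x\<bar> \<le> 1" "y > 0"
  shows "F (Complex x y) \<noteq> 0"
proof -
  have "F (of_real x + of_real y * \<i>) \<noteq> 0"
  proof (rule nonzero_on_ray[where \<eta> = "- \<i>"])
    have e: "cnj (F (of_real x)) * ((complex_of_real x ^ 2 - 1) * G (of_real x)) = of_real (f x * ((x\<^sup>2 - 1) * g x))"
      by (simp add: F_of_real G_of_real)
    show "Re (- \<i> * cnj (F (of_real x)) * ((complex_of_real x ^ 2 - 1) * G (of_real x))) = 0"
      by (simp only: mult.assoc e) simp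
    fix t assume t: "0 < t" "t < y"
    have "x\<^sup>2 \<le> 1" using assms by (simp add: abs_square_le_1)
    then have "x\<^sup>2 - t\<^sup>2 - 1 \<le> - t\<^sup>2" by simp
    then have *: "x\<^sup>2 - t\<^sup>2 - 1 \<le> 0" by (meson neg_le_0_iff_le order_trans zero_le_power2)
    have re: "Re ((of_real x + of_real t * \<i>)\<^sup>2 - 1) = x\<^sup>2 - t\<^sup>2 - 1" 
      by (simp add: power2_eq_square)
    have "Re (- \<i> * \<i> * (of_real k - of_real (c\<^sup>2) * ((of_real x + of_real t * \<i>)\<^sup>2 - 1)))
      = k - c\<^sup>2 * Re ((of_real x + of_real t * \<i>)\<^sup>2 - 1)"
      by (simp add: power2_eq_square)
    also have "\<dots> > 0" unfolding re using mult_nonneg_nonpos[OF zero_le_power2[of c] *] k_pos by linarith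
    finally show "Re (- \<i> * \<i> * (of_real k - of_real (c\<^sup>2) * ((of_real x + of_real t * \<i>)\<^sup>2 - 1))) > 0" .
    show "Re (- \<i> * cnj \<i> * ((of_real x + of_real t * \<i>)\<^sup>2 - 1)) \<ge> 0"
      using re * by (simp add: power2_eq_square)
  qed (use assms in auto)
  then show ?thesis by (simp add: complex_eq Complex_eq mult.commute)
qed

text \<open>Rays start at 1, where p = z^2 - 1 vanishes. On them p = 2 t \<omega> + t^2 \<omega>^2,
  and \<eta> = i (cnj \<omega>)^2 makes the contribution of 2 t \<omega> to the first coefficient
  purely imaginary; what remains is a positive multiple of Im \<omega>.\<close>

lemma F_nonzero_right:
  assumes "x \<ge> 1" "y > 0"
  shows "F (Complex x y) \<noteq> 0"
proof -
  define r where "r = norm (Complex (x - 1) y)"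
  define s d where "s = y / r" and "d = (x - 1) / r"
  have r: "r > 0" unfolding r_def using assms by (auto simp: complex_eq_iff)
  have s: "s > 0" and d: "d \<ge> 0" using assms r by (auto simp: s_def d_def)
  have "(x - 1)\<^sup>2 + y\<^sup>2 = r\<^sup>2" by (simp add: r_def cmod_power2)
  then have sd: "d\<^sup>2 + s\<^sup>2 = 1" unfolding s_def d_def using r
    by (simp only: power_divide add_divide_distrib[symmetric]) simp
  define \<omega> where "\<omega> = Complex d s"
  have w1: "\<omega> * cnj \<omega> = 1" using sd by (simp add: \<omega>_def complex_eq_iff power2_eq_square)
  have w0: "\<omega> \<noteq> 0" using w1 by auto
  have "F (1 + of_real r * \<omega>) \<noteq> 0"
  proof (rule nonzero_on_ray[where \<eta> = "\<i> * (cnj \<omega>)\<^sup>2"])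
    fix t assume t: "0 < t" "t < r"
    have p: "(1 + of_real t * \<omega>)\<^sup>2 - 1 = of_real (2 * t) * \<omega> + of_real (t\<^sup>2) * \<omega> * \<omega>"
      by (simp add: power2_eq_square algebra_simps)
    have e1: "\<i> * (cnj \<omega>)\<^sup>2 * \<omega> * (of_real k - of_real (c\<^sup>2) * ((1 + of_real t * \<omega>)\<^sup>2 - 1))
      = \<i> * cnj \<omega> * (\<omega> * cnj \<omega>) * of_real k - \<i> * of_real (c\<^sup>2) * (\<omega> * cnj \<omega>) * (\<omega> * cnj \<omega>) * of_real (2 * t)
        - \<i> * of_real (c\<^sup>2) * (\<omega> * cnj \<omega>) * (\<omega> * cnj \<omega>) * of_real (t\<^sup>2) * \<omega>"
      unfolding p by (simp add: power2_eq_square algebra_simps)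
    have "Re (\<i> * (cnj \<omega>)\<^sup>2 * \<omega> * (of_real k - of_real (c\<^sup>2) * ((1 + of_real t * \<omega>)\<^sup>2 - 1)))
      = k * s + c\<^sup>2 * t\<^sup>2 * s"
      by (simp only: e1 w1) (simp add: \<omega>_def algebra_simps)
    moreover have "k * s + c\<^sup>2 * t\<^sup>2 * s > 0" using k_pos s by (intro add_pos_nonneg) auto
    ultimately show "Re (\<i> * (cnj \<omega>)\<^sup>2 * \<omega> * (of_real k - of_real (c\<^sup>2) * ((1 + of_real t * \<omega>)\<^sup>2 - 1))) > 0" by simp
    have e2: "\<i> * (cnj \<omega>)\<^sup>2 * cnj \<omega> * ((1 + of_real t * \<omega>)\<^sup>2 - 1)
      = \<i> * (\<omega> * cnj \<omega>) * (cnj \<omega>)\<^sup>2 * of_real (2 * t) + \<i> * (\<omega> * cnj \<omega>) * (\<omega> * cnj \<omega>) * cnj \<omega> * of_real (t\<^sup>2)"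
      unfolding p by (simp add: power2_eq_square algebra_simps)
    have "Re (\<i> * (cnj \<omega>)\<^sup>2 * cnj \<omega> * ((1 + of_real t * \<omega>)\<^sup>2 - 1)) = 4 * t * d * s + t\<^sup>2 * s"
      by (simp only: e2 w1) (simp add: \<omega>_def power2_eq_square algebra_simps)
    then show "Re (\<i> * (cnj \<omega>)\<^sup>2 * cnj \<omega> * ((1 + of_real t * \<omega>)\<^sup>2 - 1)) \<ge> 0" using t d s by simp
  qed (use r w0 in auto)
  moreover have "1 + of_real r * \<omega> = Complex x y"
    using r by (simp add: \<omega>_def s_def d_def complex_eq_iff)
  ultimately show ?thesis by simp
qed

text \<open>With P = a^2 - 1 one has |z^2 - 1|^2 = P^2 + (2 P + 4) y^2 + y^4 on z = a + i y. This
  value makes 1 - P^2 / |z^2 - 1|^2 at least y^2 / (line_param + y^2).\<close>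

definition line_param :: real where "line_param = (a\<^sup>2 - 1)\<^sup>2 / (2 * (a\<^sup>2 - 1) + 4)"

lemma line_param_pos: "line_param > 0"
  unfolding line_param_def using P_pos by (intro divide_pos_pos) auto

text \<open>With \<open>z = a + \<i> y\<close> the function \<open>w y = sqrt (z\<^sup>2 - 1) F z\<close> satisfies \<open>w'' = V w\<close>, where
  \<open>V = c\<^sup>2 - k / (z\<^sup>2 - 1) + 1 / (z\<^sup>2 - 1)\<^sup>2\<close>.\<close>
lemma line_growth_upper:
  assumes "y \<ge> 0"
  shows "sqrt (norm ((Complex a y)\<^sup>2 - 1)) * norm (F (Complex a y))
    \<ge> sqrt (a\<^sup>2 - 1) * f a * (1 + c\<^sup>2 * y ^ 4 / (12 * (line_param + y\<^sup>2)))"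
proof -
  define S where "S = (\<lambda>z. csqrt (z - 1) * csqrt (z + 1))"
  define z where "z = (\<lambda>y. of_real a + of_real y * \<i>)"
  define p where "p = (\<lambda>y. (z y)\<^sup>2 - 1)"
  define U where "U = (\<lambda>z. z * F z + (z\<^sup>2 - 1) * G z)"
  define V where "V = (\<lambda>y. of_real (c\<^sup>2) - of_real k / p y + 1 / (p y)\<^sup>2)"
  have S2: "S z * S z = z\<^sup>2 - 1" for z
  proof -
    have "S z * S z = (csqrt (z - 1))\<^sup>2 * (csqrt (z + 1))\<^sup>2" by (simp add: S_def power2_eq_square mult_ac)
    also have "\<dots> = (z - 1) * (z + 1)" by simp
    finally show ?thesis by (simp add: power2_eq_square algebra_simps)
  qed
  have Snz: "S z \<noteq> 0" if "Re z > 1" for z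
  proof -
    have "z - 1 \<noteq> 0" "z + 1 \<noteq> 0" using that by (auto simp: complex_eq_iff)
    then show ?thesis by (simp add: S_def)
  qed
  have Sd: "(S has_field_derivative z / S z) (at z)" if "Re z > 1" for z
  proof -
    have n: "z - 1 \<notin> \<real>\<^sub>\<le>\<^sub>0" "z + 1 \<notin> \<real>\<^sub>\<le>\<^sub>0" using that by (auto simp: complex_nonpos_Reals_iff)
    have nz: "csqrt (z - 1) \<noteq> 0" "csqrt (z + 1) \<noteq> 0" using Snz[OF that] by (auto simp: S_def)
    have "((\<lambda>z. csqrt (z - 1)) has_field_derivative 1 / (2 * csqrt (z - 1)) * 1) (at z)"
      using DERIV_chain2[where f = csqrt and g = "\<lambda>z. z - 1", OF has_field_derivative_csqrt[OF n(1)]]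
      by (rule DERIV_cong) (auto intro!: derivative_eq_intros simp: inverse_eq_divide)
    moreover have "((\<lambda>z. csqrt (z + 1)) has_field_derivative 1 / (2 * csqrt (z + 1)) * 1) (at z)"
      using DERIV_chain2[where f = csqrt and g = "\<lambda>z. z + 1", OF has_field_derivative_csqrt[OF n(2)]]
      by (rule DERIV_cong) (auto intro!: derivative_eq_intros simp: inverse_eq_divide)
    ultimately have "(S has_field_derivative 1 / (2 * csqrt (z - 1)) * 1 * csqrt (z + 1) + 1 / (2 * csqrt (z + 1)) * 1 * csqrt (z - 1)) (at z)"
      unfolding S_def by (rule DERIV_mult)
    moreover have "1 / (2 * csqrt (z - 1)) * 1 * csqrt (z + 1) + 1 / (2 * csqrt (z + 1)) * 1 * csqrt (z - 1)
      = ((csqrt (z + 1))\<^sup>2 + (csqrt (z - 1))\<^sup>2) / (2 * S z)"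
      using nz by (simp add: S_def field_simps power2_eq_square)
    then have "1 / (2 * csqrt (z - 1)) * 1 * csqrt (z + 1) + 1 / (2 * csqrt (z + 1)) * 1 * csqrt (z - 1) = z / S z"
      by simp
    ultimately show ?thesis by simp
  qed
  have rz: "Re (z y) > 1" for y using a_gt by (simp add: z_def)
  have pnz: "p y \<noteq> 0" for y using S2[of "z y"] Snz[OF rz] by (auto simp: p_def)
  have chain: "((\<lambda>y. h (z y)) has_vector_derivative \<i> * h' (z y)) (at y)"
    if "\<And>z. Re z > 1 \<Longrightarrow> (h has_field_derivative h' z) (at z)" for h h' y
  proof -
    have "((\<lambda>w. h (of_real a + w * \<i>)) has_field_derivative h' (z y) * \<i>) (at (of_real y))"
      unfolding z_def by (rule DERIV_chain2[OF that]) (use a_gt in \<open>auto intro!: derivative_eq_intros\<close>)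
    from has_vector_derivative_real_field[OF this] show ?thesis
      unfolding z_def by (simp add: mult.commute)
  qed
  define w w1 where "w = (\<lambda>y. S (z y) * F (z y))" and "w1 = (\<lambda>y. \<i> * (U (z y) / S (z y)))"
  have wd: "(w has_vector_derivative w1 y) (at y)" for y
    unfolding w_def w1_def
  proof (rule chain[of "\<lambda>z. S z * F z" "\<lambda>z. U z / S z"])
    fix z assume z: "Re z > 1"
    have "((\<lambda>z. S z * F z) has_field_derivative z / S z * F z + G z * S z) (at z)"
      by (rule DERIV_mult[OF Sd[OF z] F_deriv])
    moreover have "z / S z * F z + G z * S z = U z / S z"
      using Snz[OF z] by (simp add: U_def S2[symmetric] field_simps)
    ultimately show "((\<lambda>z. S z * F z) has_field_derivative U z / S z) (at z)" by simp
  qed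
  have w1d: "(w1 has_vector_derivative V y * w y) (at y)" for y
  proof -
    define W where "W = (\<lambda>z. - (of_real (c\<^sup>2) - of_real k / (z\<^sup>2 - 1) + 1 / (z\<^sup>2 - 1)\<^sup>2) * (S z * F z))"
    have "((\<lambda>y. U (z y) / S (z y)) has_vector_derivative \<i> * W (z y)) (at y)"
    proof (rule chain[of "\<lambda>z. U z / S z" W])
      fix z assume z: "Re z > 1"
      define q where "q = z\<^sup>2 - 1"
      have q: "S z * S z = q" "q \<noteq> 0" using S2[of z] Snz[OF z] by (auto simp: q_def)
      have "(U has_field_derivative F z + z * G z + (of_real k - of_real (c\<^sup>2) * q) * F z) (at z)"
        unfolding U_def q_def by (rule derivative_eq_intros pG_deriv F_deriv refl)+ simp
      then have "((\<lambda>z. U z / S z) has_field_derivative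
        ((F z + z * G z + (of_real k - of_real (c\<^sup>2) * q) * F z) * S z - U z * (z / S z)) / (S z * S z)) (at z)"
        by (rule DERIV_divide[OF _ Sd[OF z] Snz[OF z]])
      moreover have "((F z + z * G z + (of_real k - of_real (c\<^sup>2) * q) * F z) * S z - U z * (z / S z)) / (S z * S z) = W z"
      proof -
        have "(F z + z * G z + (of_real k - of_real (c\<^sup>2) * q) * F z) * S z - U z * (z / S z)
          = ((F z + z * G z + (of_real k - of_real (c\<^sup>2) * q) * F z) * (S z * S z) - U z * z) / S z"
          using Snz[OF z] by (simp add: field_simps)
        also have "(F z + z * G z + (of_real k - of_real (c\<^sup>2) * q) * F z) * (S z * S z) - U z * z
          = - (of_real (c\<^sup>2) * q\<^sup>2 - of_real k * q + 1) * F z"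
          unfolding q(1) by (simp add: U_def q_def[symmetric], simp add: q_def power2_eq_square algebra_simps)
        also have "of_real (c\<^sup>2) * q\<^sup>2 - of_real k * q + 1 = (of_real (c\<^sup>2) - of_real k / q + 1 / q\<^sup>2) * (S z * S z * (S z * S z))"
          unfolding q(1) using q(2) by (simp add: field_simps power2_eq_square)
        finally show ?thesis
          using Snz[OF z] unfolding W_def q_def[symmetric] by simp (simp add: algebra_simps)
      qed
      ultimately show "((\<lambda>z. U z / S z) has_field_derivative W z) (at z)" by simp
    qed
    then have "(w1 has_vector_derivative \<i> * (\<i> * W (z y))) (at y)"
      unfolding w1_def by (rule has_vector_derivative_mult_right)
    moreover have "\<i> * (\<i> * W (z y)) = V y * w y"
      by (simp add: W_def V_def p_def w_def flip: mult.assoc)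
    ultimately show ?thesis by simp
  qed
  have zr: "z 0 = of_real a" by (simp add: z_def)
  have "U (of_real a) = of_real (u a)" by (simp add: U_def u_def F_of_real G_of_real)
  \<comment> \<open>The choice of \<open>a\<close> enters here: \<open>U\<close> is the complex form
    of \<open>u\<close>, so w' vanishes at y = 0.\<close>
  then have w10: "w1 0 = 0" using ua by (simp add: w1_def zr)
  have normw: "norm (w y) = sqrt (norm (p y)) * norm (F (z y))" for y
  proof -
    have "(norm (S (z y)))\<^sup>2 = norm (S (z y) * S (z y))" by (simp add: norm_mult power2_eq_square)
    then have "(norm (S (z y)))\<^sup>2 = norm (p y)" by (simp only: S2 p_def)
    then have "norm (S (z y)) = sqrt (norm (p y))" by (metis norm_ge_zero real_sqrt_unique)
    then show ?thesis by (simp add: w_def norm_mult)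
  qed
  define P where "P = a\<^sup>2 - 1"
  have P: "P > 0" using P_pos by (simp add: P_def)
  have fa: "f a > 0" using f_pos_upto[of a] a_gt by simp
  have p0: "p 0 = of_real P" by (simp add: p_def zr P_def)
  have w0n: "norm (w 0) = sqrt P * f a"
    unfolding normw p0 zr F_of_real using P fa by simp
  \<comment> \<open>The real part of k/p is at most k P / |p|^2, and 1/p^2 is bounded by its
    modulus. \<open>P_gap\<close> then absorbs both, leaving c^2 (1 - P^2 / |p|^2).\<close>
  have ReV: "Re (V y) \<ge> c\<^sup>2 * (y\<^sup>2 / (line_param + y\<^sup>2))" for y
  proof -
    define n where "n = P\<^sup>2 + (2 * P + 4) * y\<^sup>2 + y ^ 4"
    have rep: "Re (p y) = P - y\<^sup>2" "Im (p y) = 2 * a * y"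
      by (simp_all add: p_def z_def P_def power2_eq_square)
    have a2: "a\<^sup>2 = P + 1" by (simp add: P_def)
    have "(norm (p y))\<^sup>2 = (P - y\<^sup>2)\<^sup>2 + 4 * a\<^sup>2 * y\<^sup>2"
      unfolding cmod_power2 rep by (simp add: power_mult_distrib)
    then have n: "(norm (p y))\<^sup>2 = n"
      unfolding a2 n_def by (simp add: power2_eq_square algebra_simps eval_nat_numeral)
    have npos: "n > 0" using pnz[of y] by (simp add: n[symmetric])
    have "Re (of_real k / p y) = k * (P - y\<^sup>2) / n"
      unfolding n[symmetric] cmod_power2 Re_divide by (simp add: rep)
    also have "\<dots> \<le> k * P / n" using k_pos npos by (intro divide_right_mono mult_left_mono) auto
    finally have 1: "Re (of_real k / p y) \<le> k * P / n" .
    have "\<bar>Re (1 / (p y)\<^sup>2)\<bar> \<le> norm (1 / (p y)\<^sup>2)" by (rule abs_Re_le_cmod)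
    also have "\<dots> = 1 / n" by (simp add: norm_divide norm_power n)
    finally have 2: "Re (1 / (p y)\<^sup>2) \<ge> - (1 / n)" by linarith
    have "Re (V y) = c\<^sup>2 - Re (of_real k / p y) + Re (1 / (p y)\<^sup>2)" by (simp add: V_def)
    then have "Re (V y) \<ge> c\<^sup>2 - k * P / n - 1 / n" using 1 2 by linarith
    also have "c\<^sup>2 - k * P / n - 1 / n = c\<^sup>2 - (k * P + 1) / n" by (simp add: add_divide_distrib)
    finally have 3: "Re (V y) \<ge> c\<^sup>2 - (k * P + 1) / n" .
    have "(k * P + 1) / n \<le> c\<^sup>2 * P\<^sup>2 / n" using P_gap npos by (intro divide_right_mono) (auto simp: P_def)
    then have "Re (V y) \<ge> c\<^sup>2 - c\<^sup>2 * P\<^sup>2 / n" using 3 by linarith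
    also have "c\<^sup>2 - c\<^sup>2 * P\<^sup>2 / n = c\<^sup>2 * ((n - P\<^sup>2) / n)" using npos by (simp add: field_simps)
    finally have 4: "Re (V y) \<ge> c\<^sup>2 * ((n - P\<^sup>2) / n)" .
    have "y\<^sup>2 / (line_param + y\<^sup>2) \<le> (n - P\<^sup>2) / n"
    proof -
      have lp: "line_param * (2 * P + 4) = P\<^sup>2" using P by (simp add: line_param_def P_def[symmetric])
      have "line_param * (n - P\<^sup>2) = line_param * (2 * P + 4) * y\<^sup>2 + line_param * y ^ 4"
        by (simp add: n_def algebra_simps)
      also have "\<dots> \<ge> P\<^sup>2 * y\<^sup>2" unfolding lp using line_param_pos by simp
      finally have "y\<^sup>2 * n \<le> (n - P\<^sup>2) * (line_param + y\<^sup>2)" by (simp add: algebra_simps)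
      moreover have "line_param + y\<^sup>2 > 0" using line_param_pos by (simp add: add_pos_nonneg)
      ultimately show ?thesis using npos by (simp add: divide_le_eq pos_le_divide_eq field_simps)
    qed
    then have "c\<^sup>2 * (y\<^sup>2 / (line_param + y\<^sup>2)) \<le> c\<^sup>2 * ((n - P\<^sup>2) / n)" by (intro mult_left_mono) auto
    then show ?thesis using 4 by linarith
  qed
  have "norm (w y) \<ge> norm (w 0) * (1 + c\<^sup>2 * y ^ 4 / (12 * (line_param + y\<^sup>2)))"
  proof (rule norm_growth_of_second_derivative[OF wd w1d w10 _ line_param_pos ReV])
    show "w 0 \<noteq> 0" using w0n P fa by auto
  qed (use assms in auto)
  moreover have "z y = Complex a y" by (simp add: z_def complex_eq_iff)
  ultimately show ?thesis
    unfolding w0n unfolding normw p_def P_def by simp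
qed

end

section \<open>The contour integral\<close>

text \<open>The antiderivative is an arctangent, so the bound is uniform in \<open>Y\<close> and
  survives the limit to the full line.\<close>

lemma norm_vertical_integral_le:
  fixes h :: "complex \<Rightarrow> complex"
  assumes Y: "Y > 0" and r: "r > 0" and K: "K \<ge> 0"
    and cont: "continuous_on (closed_segment (Complex x (-Y)) (Complex x Y)) h"
    and bound: "\<And>y. \<bar>y\<bar> \<le> Y \<Longrightarrow> norm (h (Complex x y)) \<le> K / (1 + (r * y)\<^sup>2)"
  shows "norm (contour_integral (linepath (Complex x (-Y)) (Complex x Y)) h) \<le> K * pi / r"
proof -
  have "continuous_on {-Y..Y} (\<lambda>y. h (Complex x y))"
  proof (rule continuous_on_compose2[OF cont])
    show "continuous_on {-Y..Y} (Complex x)"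
      unfolding Complex_eq[abs_def] by (intro continuous_intros)
    show "Complex x ` {-Y..Y} \<subseteq> closed_segment (Complex x (-Y)) (Complex x Y)"
      using Y by (auto simp: closed_segment_same_Re closed_segment_eq_real_ivl)
  qed
  then have i1: "(\<lambda>y. h (Complex x y)) integrable_on {-Y..Y}" by (rule integrable_continuous_interval)
  have pos: "1 + (r * y)\<^sup>2 > 0" for y by (simp add: add_pos_nonneg)
  have i2: "((\<lambda>y. K / (1 + (r * y)\<^sup>2)) has_integral K / r * arctan (r * Y) - K / r * arctan (r * (-Y))) {-Y..Y}"
  proof (rule fundamental_theorem_of_calculus)
    fix y assume "y \<in> {-Y..Y}"
    have "((\<lambda>y. K / r * arctan (r * y)) has_real_derivative K / (1 + (r * y)\<^sup>2)) (at y within {-Y..Y})"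
      using r by (auto intro!: derivative_eq_intros simp: divide_inverse)
    then show "((\<lambda>y. K / r * arctan (r * y)) has_vector_derivative K / (1 + (r * y)\<^sup>2)) (at y within {-Y..Y})"
      by (simp add: has_real_derivative_iff_has_vector_derivative)
  qed (use Y in simp)
  have "norm (contour_integral (linepath (Complex x (-Y)) (Complex x Y)) h)
     = norm (integral {-Y..Y} (\<lambda>y. h (Complex x y)))"
    using Y by (subst contour_integral_linepath_same_Re[of _ x _ "-Y" Y]) (auto simp: norm_mult)
  also have "\<dots> \<le> integral {-Y..Y} (\<lambda>y. K / (1 + (r * y)\<^sup>2))"
    using i2 bound by (intro integral_norm_bound_integral i1) auto
  also have "\<dots> = K / r * (2 * arctan (r * Y))"
    using integral_unique[OF i2] by (simp add: arctan_minus)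
  also have "\<dots> \<le> K / r * (2 * (pi / 2))"
    using K r by (intro mult_left_mono less_imp_le[OF arctan_ubound]) auto
  finally show ?thesis by simp
qed

context spheroidal_band_limited
begin

text \<open>Reflection and parity make |F| symmetric about both axes, so estimates in the closed
  first quadrant suffice.\<close>

lemma norm_F_abs: "norm (F z) = norm (F (Complex \<bar>Re z\<bar> \<bar>Im z\<bar>))"
proof -
  have c: "norm (F (cnj z)) = norm (F z)" for z by (simp add: F_cnj)
  have "Complex \<bar>Re z\<bar> \<bar>Im z\<bar> \<in> {z, cnj z, - z, - cnj z}"
    by (auto simp: complex_eq_iff abs_if)
  then show ?thesis using c[of z] norm_F_minus[of z] norm_F_minus[of "cnj z"] by auto
qed

lemma F_zero_imp_real:
  assumes "F z = 0"
  shows "Im z = 0"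
proof (rule ccontr)
  assume "Im z \<noteq> 0"
  then have "\<bar>Im z\<bar> > 0" by simp
  then have "F (Complex \<bar>Re z\<bar> \<bar>Im z\<bar>) \<noteq> 0"
    using F_nonzero_upper_strip[of "\<bar>Re z\<bar>" "\<bar>Im z\<bar>"] F_nonzero_right[of "\<bar>Re z\<bar>" "\<bar>Im z\<bar>"]
    by (cases "\<bar>Re z\<bar> \<le> 1") auto
  then show False using assms norm_F_abs[of z] by simp
qed

lemma abs_f_abs: "\<bar>f \<bar>x\<bar>\<bar> = \<bar>f x\<bar>"
  using norm_F_minus[of "of_real x"] F_of_real[of x] F_of_real[of "- x"] by (auto simp: abs_if)

text \<open>The residue theorem needs an open region around the closed contour without further
  zeros, hence room to the right of \<open>a\<close>.\<close>

lemma f_positive_beyond: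
  obtains a' where "a' > a" "\<And>x. 1 \<le> x \<Longrightarrow> x < a' \<Longrightarrow> f x > 0"
proof -
  have "f a > 0" using f_pos_upto[of a] a_gt by simp
  moreover have "isCont f a" using f_deriv DERIV_isCont by blast
  ultimately have "eventually (\<lambda>x. f x > 0) (at a)"
    unfolding isCont_def using order_tendstoD(1) by blast
  then obtain d where d: "d > 0" "\<And>x. x \<noteq> a \<Longrightarrow> dist x a < d \<Longrightarrow> f x > 0"
    unfolding eventually_at by auto
  show ?thesis
  proof
    show "a + d > a" using d by simp
    fix x assume "1 \<le> x" "x < a + d"
    then show "f x > 0" using f_pos_upto[of x] d(2)[of x] by (cases "x \<le> a") (auto simp: dist_real_def)
  qed
qed

lemma zeros_in_strip:
  assumes "\<And>x. 1 \<le> x \<Longrightarrow> x < a' \<Longrightarrow> f x > 0" and z: "\<bar>Re z\<bar> < a'" "F z = 0"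
  shows "\<exists>s. z = of_real s \<and> -1 < s \<and> s < 1 \<and> f s = 0"
proof -
  have z': "z = of_real (Re z)" using F_zero_imp_real[OF z(2)] by (simp add: complex_eq_iff)
  then have f0: "f (Re z) = 0" using z(2) F_of_real[of "Re z"] by simp
  have "\<bar>Re z\<bar> < 1"
  proof (rule ccontr)
    assume "\<not> ?thesis"
    then have "f \<bar>Re z\<bar> > 0" using assms(1)[of "\<bar>Re z\<bar>"] z by simp
    then show False using abs_f_abs[of "Re z"] f0 by simp
  qed
  then show ?thesis using z' f0 by (intro exI[of _ "Re z"]) auto
qed

text \<open>All poles are simple, so each residue is the reciprocal of the derivative of F(z) (z -
  t): 1 / f t at t and 1 / (g s (s - t)) at a zero s, whence the minus sign.\<close>

lemma residue_sum:
  fixes t Y :: real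
  defines "Z \<equiv> {s\<in>{-1<..<1}. f s = 0}"
  assumes fin: "finite Z" and simple: "\<And>s. s \<in> Z \<Longrightarrow> g s \<noteq> 0"
    and t: "t \<in> {-1<..<1}" and ft: "f t \<noteq> 0" and Y: "Y > 0"
  shows "contour_integral (rectpath (Complex (-a) (-Y)) (Complex a Y)) (\<lambda>z. 1 / (F z * (z - of_real t)))
    = 2 * pi * \<i> * of_real (1 / f t - (\<Sum>s\<in>Z. 1 / (g s * (t - s))))"
proof -
  obtain a' where a': "a' > a" "\<And>x. 1 \<le> x \<Longrightarrow> x < a' \<Longrightarrow> f x > 0" using f_positive_beyond by blast
  define D where "D = (\<lambda>z. F z * (z - of_real t))"
  define pts where "pts = complex_of_real ` insert t Z"
  define S where "S = box (Complex (-a') (-(Y + 1))) (Complex a' (Y + 1))"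
  let ?R = "rectpath (Complex (-a) (-Y)) (Complex a Y)"
  have ptsb: "p \<in> box (Complex (-a) (-Y)) (Complex a Y)" if "p \<in> pts" for p
    using that t a_gt Y by (auto simp: pts_def Z_def in_box_complex_iff)
  have Dz: "z \<in> pts" if "z \<in> S" "D z = 0" for z
  proof (cases "z = of_real t")
    case False
    then have "F z = 0" using that by (simp add: D_def)
    moreover have "\<bar>Re z\<bar> < a'" using that by (auto simp: S_def in_box_complex_iff)
    ultimately show ?thesis using zeros_in_strip[where a' = a' and z = z, OF a'(2)] by (auto simp: pts_def Z_def)
  qed (simp add: pts_def)
  have Dhol: "D holomorphic_on A" for A unfolding D_def by (intro holomorphic_intros F_holomorphic)
  have sub: "cbox (Complex (-a) (-Y)) (Complex a Y) \<subseteq> S"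
    using a' by (auto simp: S_def in_box_complex_iff in_cbox_complex_iff)
  have wn: "winding_number ?R p = 1" if "p \<in> pts" for p
    using ptsb[OF that] by (rule winding_number_rectpath)
  have Dd: "(D has_field_derivative G z * (z - of_real t) + F z) (at z)" for z
    unfolding D_def by (rule derivative_eq_intros F_deriv refl)+ simp
  have res: "residue (\<lambda>z. 1 / D z) p = 1 / d" if "D p = 0" "(D has_field_derivative d) (at p)" "d \<noteq> 0" for p d
    by (rule residue_simple_pole_deriv[where f = "\<lambda>_. 1" and s = UNIV]) (use that Dhol in auto)
  have rest: "residue (\<lambda>z. 1 / D z) (of_real t) = of_real (1 / f t)"
    using res[of "of_real t" "of_real (f t)"] Dd[of "of_real t"] ft by (simp add: D_def F_of_real)
  have ress: "residue (\<lambda>z. 1 / D z) (of_real s) = of_real (- (1 / (g s * (t - s))))" if "s \<in> Z" for s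
  proof -
    have "s \<noteq> t" "f s = 0" using that ft by (auto simp: Z_def)
    moreover have "(D has_field_derivative of_real (g s * (s - t))) (at (of_real s))"
      using Dd[of "of_real s"] \<open>f s = 0\<close> by (simp add: F_of_real G_of_real)
    ultimately have "residue (\<lambda>z. 1 / D z) (of_real s) = 1 / of_real (g s * (s - t))"
      using simple[OF that] by (intro res) (auto simp: D_def F_of_real)
    also have "g s * (s - t) = - (g s * (t - s))" by (simp add: algebra_simps)
    finally show ?thesis by simp
  qed
  have "contour_integral ?R (\<lambda>z. 1 / D z) = 2 * pi * \<i> * (\<Sum>p\<in>pts. winding_number ?R p * residue (\<lambda>z. 1 / D z) p)"
  proof (rule Residue_theorem)
    show "open S" "connected S" by (auto simp: S_def convex_connected)
    show "finite pts" using fin by (simp add: pts_def)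
    show "(\<lambda>z. 1 / D z) holomorphic_on S - pts"
      using Dz by (intro holomorphic_intros Dhol) auto
    show "path_image ?R \<subseteq> S - pts"
      using sub ptsb a_gt Y by (subst path_image_rectpath_cbox_minus_box) auto
    show "\<forall>z. z \<notin> S \<longrightarrow> winding_number ?R z = 0"
      using sub a_gt Y by (intro allI impI winding_number_rectpath_outside) auto
  qed auto
  also have "(\<Sum>p\<in>pts. winding_number ?R p * residue (\<lambda>z. 1 / D z) p) = (\<Sum>p\<in>pts. residue (\<lambda>z. 1 / D z) p)"
    by (intro sum.cong refl) (simp add: wn)
  also have "\<dots> = (\<Sum>s\<in>insert t Z. residue (\<lambda>z. 1 / D z) (of_real s))"
    unfolding pts_def by (subst sum.reindex) (auto simp: inj_on_def)
  also have "\<dots> = of_real (1 / f t) + (\<Sum>s\<in>Z. residue (\<lambda>z. 1 / D z) (of_real s))"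
    using fin ft by (subst sum.insert) (auto simp: Z_def rest)
  also have "(\<Sum>s\<in>Z. residue (\<lambda>z. 1 / D z) (of_real s)) = of_real (- (\<Sum>s\<in>Z. 1 / (g s * (t - s))))"
    by (simp add: ress sum_negf)
  finally show ?thesis by (simp add: D_def)
qed

text \<open>Apart from the slope, this is a tangent line to the convex function X^2 / (B + X) of X =
  y^2. The slope 2 s - s^2 is weakened to s, and the result has the form 1 + (r y)^2 whose
  reciprocal integrates to an arctangent.\<close>

lemma line_growth_quadratic:
  fixes s :: real
  assumes s: "0 < s" "s \<le> 1"
  shows "1 + c\<^sup>2 * y ^ 4 / (12 * (line_param + y\<^sup>2))
    \<ge> 1 - c\<^sup>2 / 12 * line_param * s\<^sup>2 + c\<^sup>2 / 12 * s * y\<^sup>2"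
proof -
  define B where "B = line_param"
  have B: "B > 0" using line_param_pos by (simp add: B_def)
  have By: "B + y\<^sup>2 > 0" using B by (simp add: add_pos_nonneg)
  have "(s * y\<^sup>2 - B * s\<^sup>2) * (B + y\<^sup>2) \<le> ((2 * s - s\<^sup>2) * y\<^sup>2 - B * s\<^sup>2) * (B + y\<^sup>2)"
  proof -
    have "s * s \<le> s * 1" using s by (intro mult_left_mono) auto
    then have "s * y\<^sup>2 \<le> (2 * s - s\<^sup>2) * y\<^sup>2" by (intro mult_right_mono) (auto simp: power2_eq_square)
    then show ?thesis using By by (intro mult_right_mono) auto
  qed
  also have "\<dots> = y ^ 4 - ((1 - s) * y\<^sup>2 - s * B)\<^sup>2"
    by (simp add: power2_eq_square algebra_simps eval_nat_numeral)
  also have "\<dots> \<le> y ^ 4" by simp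
  finally have "s * y\<^sup>2 - B * s\<^sup>2 \<le> y ^ 4 / (B + y\<^sup>2)" using By by (simp add: pos_le_divide_eq)
  then have "c\<^sup>2 / 12 * (s * y\<^sup>2 - B * s\<^sup>2) \<le> c\<^sup>2 / 12 * (y ^ 4 / (B + y\<^sup>2))"
    by (intro mult_left_mono) auto
  then show ?thesis by (simp add: B_def[symmetric] algebra_simps)
qed

text \<open>\<open>line_growth_upper\<close> bounds sqrt |z^2 - 1| |F z| from below, so it remains
  to trade sqrt |z^2 - 1| for |z - t|. This costs sqrt q, q = (a + 1) / (a - 1), because |z + 1| <=
  q |z - 1| and the distance to t is at least |z - 1|.\<close>

lemma line_bound:
  assumes t: "\<bar>t\<bar> < 1" and x: "x = a \<or> x = - a"
  shows "norm (1 / (F (Complex x y) * (Complex x y - of_real t)))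
    \<le> sqrt ((a + 1) / (a - 1)) / (sqrt (a\<^sup>2 - 1) * f a * (1 + c\<^sup>2 * y ^ 4 / (12 * (line_param + y\<^sup>2))))"
proof -
  define z where "z = Complex a \<bar>y\<bar>"
  define L where "L = sqrt (a\<^sup>2 - 1) * f a * (1 + c\<^sup>2 * y ^ 4 / (12 * (line_param + y\<^sup>2)))"
  have fa: "f a > 0" using f_pos_upto[of a] a_gt by simp
  have L: "L > 0"
    unfolding L_def using P_pos fa line_param_pos
    by (intro mult_pos_pos add_pos_nonneg divide_nonneg_pos mult_nonneg_nonneg) auto
  have FL: "sqrt (norm (z\<^sup>2 - 1)) * norm (F z) \<ge> L"
    using line_growth_upper[of "\<bar>y\<bar>"] by (simp add: z_def L_def)
  have nF: "norm (F (Complex x y)) = norm (F z)"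
    using norm_F_abs[of "Complex x y"] x a_gt by (auto simp: z_def)
  have zm: "(norm (z - 1))\<^sup>2 = (a - 1)\<^sup>2 + y\<^sup>2" "(norm (z + 1))\<^sup>2 = (a + 1)\<^sup>2 + y\<^sup>2"
    by (simp_all add: z_def cmod_power2)
  have "(norm (z - 1))\<^sup>2 \<le> (norm (Complex x y - of_real t))\<^sup>2"
  proof -
    have "(a - 1)\<^sup>2 \<le> (x - t)\<^sup>2"
    proof -
      have "\<bar>a - 1\<bar> \<le> \<bar>x - t\<bar>" using x t a_gt by auto
      then show ?thesis by (rule abs_le_square_iff[THEN iffD1])
    qed
    then show ?thesis unfolding zm by (simp add: cmod_power2)
  qed
  then have zt: "norm (z - 1) \<le> norm (Complex x y - of_real t)" by (rule power2_le_imp_le) simp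
  have z1: "norm (z - 1) > 0" using a_gt by (auto simp: z_def complex_eq_iff)
  define q where "q = (a + 1) / (a - 1)"
  have q: "q > 0" using a_gt by (simp add: q_def)
  have qa: "q * (a - 1) = a + 1" using a_gt by (simp add: q_def)
  have q1: "q \<ge> 1" using a_gt by (simp add: q_def)
  have "(norm (z + 1))\<^sup>2 \<le> (q * norm (z - 1))\<^sup>2"
  proof -
    have "1 * y\<^sup>2 \<le> q\<^sup>2 * y\<^sup>2" using q1 by (intro mult_right_mono) (auto simp: one_le_power)
    moreover have "(q * (a - 1))\<^sup>2 = q\<^sup>2 * (a - 1)\<^sup>2" by (rule power_mult_distrib)
    ultimately show ?thesis unfolding power_mult_distrib zm qa[symmetric] by (simp add: algebra_simps)
  qed
  then have "norm (z + 1) \<le> q * norm (z - 1)" by (rule power2_le_imp_le) (use q in simp)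
  then have "norm (z + 1) * norm (z - 1) \<le> q * norm (z - 1) * norm (z - 1)" by (intro mult_right_mono) auto
  moreover have "z\<^sup>2 - 1 = (z + 1) * (z - 1)" by (simp add: power2_eq_square algebra_simps)
  ultimately have "norm (z\<^sup>2 - 1) \<le> q * (norm (z - 1))\<^sup>2" by (simp add: norm_mult power2_eq_square)
  then have "sqrt (norm (z\<^sup>2 - 1)) \<le> sqrt (q * (norm (z - 1))\<^sup>2)" by (rule real_sqrt_le_mono)
  also have "\<dots> = sqrt q * norm (z - 1)" by (simp add: real_sqrt_mult)
  also have "\<dots> \<le> sqrt q * norm (Complex x y - of_real t)" using zt q by (intro mult_left_mono) auto
  finally have "sqrt (norm (z\<^sup>2 - 1)) * norm (F z) \<le> sqrt q * norm (Complex x y - of_real t) * norm (F z)"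
    by (intro mult_right_mono) auto
  then have "L \<le> sqrt q * (norm (F z) * norm (Complex x y - of_real t))" using FL by (simp add: mult_ac)
  moreover from this have "norm (F z) * norm (Complex x y - of_real t) > 0"
    using L q by (smt (verit) mult_le_0_iff real_sqrt_gt_zero norm_ge_zero)
  ultimately have "1 / (norm (F z) * norm (Complex x y - of_real t)) \<le> sqrt q / L"
    using L by (simp add: field_simps)
  then show ?thesis unfolding q_def L_def norm_divide norm_mult nF by simp
qed

text \<open>The horizontal sides contribute at most 4 a / (\<delta> Y), which vanishes as Y tends to
  infinity while the integral does not depend on Y; only the two vertical sides remain.\<close>

lemma norm_rect_integral_le:
  fixes t K r :: real
  assumes t: "t \<in> {-1<..<1}" and r: "r > 0" and K: "K \<ge> 0"
    and side: "\<And>x y. x = a \<or> x = - a \<Longrightarrow>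
      norm (1 / (F (Complex x y) * (Complex x y - of_real t))) \<le> K / (1 + (r * y)\<^sup>2)"
    and I: "\<And>Y. Y > 0 \<Longrightarrow> contour_integral (rectpath (Complex (-a) (-Y)) (Complex a Y))
      (\<lambda>z. 1 / (F z * (z - of_real t))) = J"
  shows "norm J \<le> 2 * (K * pi / r)"
proof -
  define h where "h = (\<lambda>z. 1 / (F z * (z - of_real t)))"
  obtain \<delta> Y0 where \<delta>: "\<delta> > 0" "Y0 \<ge> 1"
    "\<And>z. \<bar>Re z\<bar> \<le> a \<Longrightarrow> \<bar>Im z\<bar> \<ge> Y0 \<Longrightarrow> norm (F z) \<ge> \<delta>" using F_lower_far by blast
  have fa: "f a > 0" using f_pos_upto[of a] a_gt by simp
  have main: "norm J \<le> 2 * (K * pi / r) + 4 * a / \<delta> * inverse Y" if Y: "Y \<ge> Y0" for Y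
  proof -
    have Y1: "Y > 0" using Y \<delta> by simp
    define a1 a2 a3 a4 where "a1 = Complex (-a) (-Y)" and "a2 = Complex a (-Y)" and "a3 = Complex a Y" and "a4 = Complex (-a) Y"
    have cont: "continuous_on (closed_segment p q) h"
      if "\<And>z. z \<in> closed_segment p q \<Longrightarrow> F z \<noteq> 0 \<and> z \<noteq> of_real t" for p q
      unfolding h_def using that
      by (intro continuous_intros holomorphic_on_imp_continuous_on[OF F_holomorphic]) auto
    have hor: "F z \<noteq> 0 \<and> z \<noteq> of_real t \<and> norm (h z) \<le> 1 / \<delta> * inverse Y" if "\<bar>Re z\<bar> \<le> a" "\<bar>Im z\<bar> = Y" for z
    proof -
      have F: "norm (F z) \<ge> \<delta>" using \<delta>(3)[of z] that Y by simp
      have "\<bar>Im (z - of_real t)\<bar> \<le> norm (z - of_real t)" by (rule abs_Im_le_cmod)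
      then have zt: "norm (z - of_real t) \<ge> Y" using that by simp
      have "\<delta> * Y \<le> norm (F z) * norm (z - of_real t)" using F zt \<delta> Y1 by (intro mult_mono) auto
      moreover have "\<delta> * Y > 0" using \<delta> Y1 by simp
      ultimately have "1 / (norm (F z) * norm (z - of_real t)) \<le> 1 / (\<delta> * Y)" by (intro divide_left_mono) auto
      then have "norm (h z) \<le> 1 / \<delta> * inverse Y" by (simp add: h_def norm_divide norm_mult inverse_eq_divide)
      then show ?thesis using F zt \<delta> Y1 by auto
    qed
    have ver: "F z \<noteq> 0 \<and> z \<noteq> of_real t" if "Re z = a \<or> Re z = - a" for z
    proof
      have "F (of_real a) \<noteq> 0" using fa by (simp add: F_of_real)
      then have "F (of_real (- a)) \<noteq> 0" using norm_F_minus[of "of_real a"] by auto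
      have "z = of_real (Re z)" if "F z = 0" using F_zero_imp_real[OF that] by (simp add: complex_eq_iff)
      then show "F z \<noteq> 0" using that \<open>F (of_real a) \<noteq> 0\<close> \<open>F (of_real (- a)) \<noteq> 0\<close> by metis
      show "z \<noteq> of_real t" using that t a_gt by auto
    qed
    have s1: "z \<in> closed_segment a1 a2 \<Longrightarrow> \<bar>Re z\<bar> \<le> a \<and> \<bar>Im z\<bar> = Y" for z
      using a_gt Y1 by (auto simp: a1_def a2_def closed_segment_same_Im closed_segment_eq_real_ivl)
    have s3: "z \<in> closed_segment a3 a4 \<Longrightarrow> \<bar>Re z\<bar> \<le> a \<and> \<bar>Im z\<bar> = Y" for z
      using a_gt Y1 by (auto simp: a3_def a4_def closed_segment_same_Im closed_segment_eq_real_ivl)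
    have s2: "z \<in> closed_segment a2 a3 \<Longrightarrow> Re z = a" for z
      by (auto simp: a2_def a3_def closed_segment_same_Re)
    have s4: "z \<in> closed_segment a1 a4 \<Longrightarrow> Re z = - a" for z
      by (auto simp: a1_def a4_def closed_segment_same_Re)
    have c1: "continuous_on (closed_segment a1 a2) h" using s1 hor by (intro cont) blast
    have c2: "continuous_on (closed_segment a2 a3) h" using s2 ver by (intro cont) blast
    have c3: "continuous_on (closed_segment a3 a4) h" using s3 hor by (intro cont) blast
    have c4: "continuous_on (closed_segment a1 a4) h" using s4 ver by (intro cont) blast
    have c4': "continuous_on (closed_segment a4 a1) h" using c4 by (simp add: closed_segment_commute)
    note ci = contour_integrable_continuous_linepath[OF c1] contour_integrable_continuous_linepath[OF c2]
      contour_integrable_continuous_linepath[OF c3] contour_integrable_continuous_linepath[OF c4']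
    have "rectpath a1 a3 = linepath a1 a2 +++ linepath a2 a3 +++ linepath a3 a4 +++ linepath a4 a1"
      by (simp add: rectpath_def Let_def a1_def a2_def a3_def a4_def)
    then have "contour_integral (rectpath a1 a3) h = contour_integral (linepath a1 a2) h + (contour_integral (linepath a2 a3) h
       + (contour_integral (linepath a3 a4) h + contour_integral (linepath a4 a1) h))"
      using ci by (simp add: contour_integrable_join contour_integral_join valid_path_join)
    moreover have "contour_integral (rectpath a1 a3) h = J"
      using I[OF Y1] by (simp add: a1_def a3_def h_def)
    moreover have "contour_integral (linepath a4 a1) h = - contour_integral (linepath a1 a4) h"
      using contour_integral_reverse_linepath[OF c4'] by simp
    ultimately have "norm J \<le> norm (contour_integral (linepath a1 a2) h) + (norm (contour_integral (linepath a2 a3) h)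
       + (norm (contour_integral (linepath a3 a4) h) + norm (contour_integral (linepath a1 a4) h)))"
      by (metis norm_minus_cancel norm_triangle_ineq norm_triangle_le add_left_mono)
    also have "\<dots> \<le> 1 / \<delta> * inverse Y * (2 * a) + (K * pi / r + (1 / \<delta> * inverse Y * (2 * a) + K * pi / r))"
    proof (intro add_mono)
      have n1: "norm (a2 - a1) = 2 * a" "norm (a4 - a3) = 2 * a"
        using a_gt by (simp_all add: a1_def a2_def a3_def a4_def cmod_def real_sqrt_mult)
      show "norm (contour_integral (linepath a1 a2) h) \<le> 1 / \<delta> * inverse Y * (2 * a)"
        using contour_integral_bound_linepath[OF ci(1), of "1 / \<delta> * inverse Y"] s1 hor \<delta> Y1 unfolding n1 by simp
      show "norm (contour_integral (linepath a3 a4) h) \<le> 1 / \<delta> * inverse Y * (2 * a)"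
        using contour_integral_bound_linepath[OF ci(3), of "1 / \<delta> * inverse Y"] s3 hor \<delta> Y1 unfolding n1 by simp
      show "norm (contour_integral (linepath a2 a3) h) \<le> K * pi / r"
        unfolding a2_def a3_def
        by (rule norm_vertical_integral_le[OF Y1 r K c2[unfolded a2_def a3_def]]) (simp add: h_def side)
      show "norm (contour_integral (linepath a1 a4) h) \<le> K * pi / r"
        unfolding a1_def a4_def
        by (rule norm_vertical_integral_le[OF Y1 r K c4[unfolded a1_def a4_def]]) (simp add: h_def side)
    qed
    finally show ?thesis by (simp add: algebra_simps)
  qed
  have "((\<lambda>Y. 2 * (K * pi / r) + 4 * a / \<delta> * inverse Y) \<longlongrightarrow> 2 * (K * pi / r) + 4 * a / \<delta> * 0) at_top"
    by (intro tendsto_intros tendsto_inverse_0_at_top filterlim_ident)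
  moreover have "eventually (\<lambda>Y. norm J \<le> 2 * (K * pi / r) + 4 * a / \<delta> * inverse Y) at_top"
    using eventually_ge_at_top[of Y0] by eventually_elim (rule main)
  ultimately have "norm J \<le> 2 * (K * pi / r) + 4 * a / \<delta> * 0"
    by (intro tendsto_lowerbound[OF _ _ trivial_limit_at_top_linorder])
  then show ?thesis by simp
qed

end

section \<open>From the contour integral to an explicit constant\<close>

context spheroidal_band_limited
begin

lemma pole_expansion_error_sq_le:
  fixes t :: real
  defines "Z \<equiv> {s\<in>{-1<..<1}. f s = 0}"
  assumes fin: "finite Z" and simple: "\<And>s. s \<in> Z \<Longrightarrow> g s \<noteq> 0"
    and t: "t \<in> {-1<..<1}" and ft: "f t \<noteq> 0" and f1: "(f 1)\<^sup>2 \<ge> 1/2"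
  shows "(1 / f t - (\<Sum>s\<in>Z. 1 / (g s * (t - s))))\<^sup>2 \<le> 62 * (c * a) * (norm lam)\<^sup>2"
proof -
  define I where "I = 1 / f t - (\<Sum>s\<in>Z. 1 / (g s * (t - s)))"
  define P where "P = a\<^sup>2 - 1"
  define b where "b = sqrt line_param"
  define q where "q = (a + 1) / (a - 1)"
  \<comment> \<open>c b s = 2/5 makes the loss c^2 \<open>line_param\<close> s^2 / 12 equal to 1/75,
    and s <= 1 holds because (c b)^2 >= 1/6 > (2/5)^2. The value of \<open>r\<close> is then read
    off from the coefficient of y^2.\<close>
  define s where "s = 2 / (5 * (c * b))"
  define r where "r = sqrt (75 / 74 * (c / (30 * b)))"
  define N where "N = sqrt P * f a"
  have cp: "c > 0" using c_gt by simp
  have P: "P > 0" using P_pos by (simp add: P_def)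
  have b: "b > 0" using line_param_pos by (simp add: b_def)
  have b2: "line_param = b\<^sup>2" using line_param_pos by (simp add: b_def)
  have fa: "f a > 0" using f_pos_upto[of a] a_gt by simp
  have N: "N > 0" using P fa by (simp add: N_def)
  have q: "q > 0" using a_gt by (simp add: q_def)
  have lam: "norm lam > 0" using lam_nz by simp
  have s0: "s > 0" using cp b by (simp add: s_def)
  have s1: "s \<le> 1"
  proof -
    have "c * (c * P) \<ge> c * 1" using turning_gap k_pos by (simp add: P_def power2_eq_square mult.assoc)
    then have X: "c * P \<ge> 1" using cp by simp
    have "1 * P \<le> c * P" using P c_gt by (intro mult_right_mono) auto
    then have "2 * P + 4 \<le> 6 * (c * P)" using X by linarith
    also have "\<dots> \<le> 6 * (c * P) * (c * P)" using mult_left_mono[OF X, of "6 * (c * P)"] X by simp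
    finally have "2 * P + 4 \<le> 6 * (c * P)\<^sup>2" by (simp add: power2_eq_square)
    then have "1 / 6 \<le> (c * P)\<^sup>2 / (2 * P + 4)" using P by (simp add: field_simps)
    also have "\<dots> = (c * b)\<^sup>2"
      using b2 by (simp add: power_mult_distrib line_param_def P_def[symmetric] flip: times_divide_eq_right)
    finally have "(2 / 5)\<^sup>2 \<le> (c * b)\<^sup>2" by (simp add: power2_eq_square)
    then have "2 / 5 \<le> c * b" by (rule power2_le_imp_le) (use cp b in simp)
    then show ?thesis using cp b by (simp add: s_def field_simps)
  qed
  have r: "r > 0" using cp b by (simp add: r_def)
  have r2: "r\<^sup>2 = 75 / 74 * (c / (30 * b))" using cp b by (simp add: r_def)
  have quad: "1 + c\<^sup>2 * y ^ 4 / (12 * (line_param + y\<^sup>2)) \<ge> 74 / 75 * (1 + (r * y)\<^sup>2)" for y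
  proof -
    have e1: "c\<^sup>2 / 12 * line_param * s\<^sup>2 = 1 / 75"
      using cp b by (simp add: b2 s_def power2_eq_square field_simps)
    have e2: "c\<^sup>2 / 12 * s = 74 / 75 * r\<^sup>2"
      using cp b unfolding r2 by (simp add: s_def power2_eq_square field_simps)
    have e3: "74 / 75 * (1 + (r * y)\<^sup>2) = 1 - 1 / 75 + 74 / 75 * r\<^sup>2 * y\<^sup>2"
      by (simp add: power_mult_distrib)
    show ?thesis
      using line_growth_quadratic[OF s0 s1, of y] unfolding e1 e2 e3 .
  qed
  define K where "K = 75 / 74 * (sqrt q / N)"
  have K: "K > 0" using q N by (simp add: K_def)
  have "norm (2 * pi * \<i> * of_real I) \<le> 2 * (K * pi / r)"
  proof (rule norm_rect_integral_le[OF t r less_imp_le[OF K]])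
    fix x y :: real assume x: "x = a \<or> x = - a"
    have "norm (1 / (F (Complex x y) * (Complex x y - of_real t)))
      \<le> sqrt q / (N * (1 + c\<^sup>2 * y ^ 4 / (12 * (line_param + y\<^sup>2))))"
      using line_bound[OF _ x, of t y] t unfolding q_def N_def P_def by auto
    also have "\<dots> \<le> sqrt q / (N * (74 / 75 * (1 + (r * y)\<^sup>2)))"
    proof -
      have p1: "0 < 74 / 75 * (1 + (r * y)\<^sup>2)" by (simp add: add_pos_nonneg)
      then have p2: "0 < 1 + c\<^sup>2 * y ^ 4 / (12 * (line_param + y\<^sup>2))" using quad[of y] by (rule less_le_trans)
      show ?thesis
        by (intro divide_left_mono mult_left_mono quad mult_pos_pos p1 p2) (use N q in auto)
    qed
    also have "\<dots> = K / (1 + (r * y)\<^sup>2)" by (simp add: K_def field_simps)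
    finally show "norm (1 / (F (Complex x y) * (Complex x y - of_real t))) \<le> K / (1 + (r * y)\<^sup>2)" .
  next
    fix Y :: real assume "Y > 0"
    then show "contour_integral (rectpath (Complex (-a) (-Y)) (Complex a Y)) (\<lambda>z. 1 / (F z * (z - of_real t)))
       = 2 * pi * \<i> * of_real I"
      using residue_sum fin simple t ft unfolding I_def Z_def by blast
  qed
  then have "2 * pi * \<bar>I\<bar> \<le> 2 * pi * (K / r)" by (simp add: norm_mult mult_ac)
  then have "\<bar>I\<bar> \<le> K / r" by (rule mult_left_le_imp_le) simp
  then have "I\<^sup>2 \<le> (K / r)\<^sup>2" using K r by (intro iffD1[OF abs_le_square_iff]) simp
  also have "(K / r)\<^sup>2 = K\<^sup>2 / r\<^sup>2" by (rule power_divide)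
  also have "\<dots> = (75 / 74 * 30) * (q * b / c) * (1 / N\<^sup>2)"
    unfolding r2 K_def using q cp b N by (simp add: power_mult_distrib power_divide field_simps) 
  \<comment> \<open>30 * 75/74 is about 30.4.\<close>
  also have "\<dots> \<le> 31 * (q * b / c) * (1 / N\<^sup>2)" using q b cp by (intro mult_right_mono) auto
  also have "\<dots> \<le> 31 * (q * b / c) * (c * norm lam)\<^sup>2"
  proof (intro mult_left_mono)
    \<comment> \<open>The normalisation (f 1)^2 >= 1/2 and exp (1/2) <= 2 turn
      \<open>amplitude_bound\<close> into N >= 1 / (c |\<lambda>|); this is the source of the factor
      |\<lambda>| in the result.\<close>
    have "(2 * f 1 / (c * norm lam))\<^sup>2 \<le> N\<^sup>2 * exp (1/2)"
      using amplitude_bound P by (simp add: N_def power_mult_distrib P_def[symmetric])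
    moreover have "(2 * f 1 / (c * norm lam))\<^sup>2 = 4 * (f 1)\<^sup>2 / (c * norm lam)\<^sup>2"
      by (simp add: power_divide power_mult_distrib)
    moreover have "2 / (c * norm lam)\<^sup>2 \<le> 4 * (f 1)\<^sup>2 / (c * norm lam)\<^sup>2"
      using f1 by (intro divide_right_mono) auto
    moreover have "N\<^sup>2 * exp (1/2) \<le> N\<^sup>2 * 2"
    proof (intro mult_left_mono)
      have "exp (1/2 :: real) \<le> 1 + 1/2 + (1/2)\<^sup>2" by (rule exp_bound) auto
      then show "exp (1/2 :: real) \<le> 2" by (simp add: power2_eq_square)
    qed auto
    ultimately have "2 / (c * norm lam)\<^sup>2 \<le> N\<^sup>2 * 2" by linarith
    then show "1 / N\<^sup>2 \<le> (c * norm lam)\<^sup>2" using N cp lam by (simp add: field_simps)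
  qed (use q b cp in auto)
  also have "\<dots> = 31 * (q * b) * (c * (norm lam)\<^sup>2)" using cp by (simp add: power2_eq_square field_simps)
  also have "\<dots> \<le> 31 * (2 * a) * (c * (norm lam)\<^sup>2)"
  proof (intro mult_right_mono mult_left_mono)
    \<comment> \<open>The singular factor 1 / (a - 1) in \<open>q\<close> cancels against
      \<open>b\<close>: q P = (a + 1)^2 and b = P / sqrt (2 a^2 + 2), so q b <= a + 1.\<close>
    have "a + 1 \<le> sqrt (2 * a\<^sup>2 + 2)"
      by (rule real_le_rsqrt) (use zero_le_power2[of "a - 1"] in \<open>simp add: power2_eq_square algebra_simps\<close>)
    moreover have "b = P / sqrt (2 * a\<^sup>2 + 2)"
      using P by (simp add: b_def line_param_def P_def real_sqrt_divide algebra_simps)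
    moreover have "q * P = (a + 1) * (a + 1)"
      using a_gt by (simp add: q_def P_def power2_eq_square field_simps)
    ultimately have "q * b \<le> a + 1"
      using a_gt by (simp add: divide_le_eq add_pos_nonneg)
    then show "q * b \<le> 2 * a" using a_gt by simp
  qed (use cp in auto)
  finally show ?thesis by (simp add: I_def mult_ac)
qed

end

section \<open>Arbitrary sign of the eigenfunction at 1\<close>

context spheroidal
begin

lemma pole_expansion_error_of_pos:
  fixes t :: real and lam :: complex
  defines "Z \<equiv> {s\<in>{-1<..<1}. f s = 0}"
  assumes k: "k > 0" and f1p: "f 1 > 0"
    and F_int: "\<And>z. lam * F z = integral {-1..1} (\<lambda>t. F (of_real t) * exp (\<i> * of_real c * z * of_real t))"
    and parity: "(\<forall>z. F (- z) = F z) \<or> (\<forall>z. F (- z) = - F z)"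
    and lam: "lam \<noteq> 0"
    and fin: "finite Z" and simple: "\<And>s. s \<in> Z \<Longrightarrow> g s \<noteq> 0"
    and t: "t \<in> {-1<..<1}" and ft: "f t \<noteq> 0" and f1: "(f 1)\<^sup>2 \<ge> 1/2"
  shows "(1 / f t - (\<Sum>s\<in>Z. 1 / (g s * (t - s))))\<^sup>2
    \<le> 62 * (sqrt (c\<^sup>2 + 2 * k) + pi / sqrt 2) * (norm lam)\<^sup>2"
proof -
  obtain a where a: "1 < a" "a \<le> sqrt (1 + 2 * k / c\<^sup>2) + pi / (sqrt 2 * c)" "u a = 0"
    "\<And>x. 1 \<le> x \<Longrightarrow> x < a \<Longrightarrow> u x > 0"
    using first_critical_point[OF k f1p] by blast
  interpret spheroidal_band_limited c k F G a lam
    by unfold_locales (use assms a in auto)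
  have cp: "c > 0" using c_gt by simp
  have "c * a \<le> c * (sqrt (1 + 2 * k / c\<^sup>2) + pi / (sqrt 2 * c))"
    using a(2) cp by (intro mult_left_mono) auto
  also have "\<dots> = c * sqrt (1 + 2 * k / c\<^sup>2) + pi / sqrt 2" using cp by (simp add: field_simps)
  also have "c * sqrt (1 + 2 * k / c\<^sup>2) = sqrt (c\<^sup>2 * (1 + 2 * k / c\<^sup>2))"
    using cp by (simp add: real_sqrt_mult)
  also have "c\<^sup>2 * (1 + 2 * k / c\<^sup>2) = c\<^sup>2 + 2 * k" using cp by (simp add: field_simps)
  finally have ca: "c * a \<le> sqrt (c\<^sup>2 + 2 * k) + pi / sqrt 2" .
  have "(1 / f t - (\<Sum>s\<in>Z. 1 / (g s * (t - s))))\<^sup>2 \<le> 62 * (c * a) * (norm lam)\<^sup>2"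
    unfolding Z_def using fin simple t ft f1 unfolding Z_def by (intro pole_expansion_error_sq_le) auto
  also have "\<dots> \<le> 62 * (sqrt (c\<^sup>2 + 2 * k) + pi / sqrt 2) * (norm lam)\<^sup>2"
    using ca by (intro mult_right_mono mult_left_mono) auto
  finally show ?thesis .
qed

lemma spheroidal_minus: "spheroidal c k (\<lambda>z. - F z) (\<lambda>z. - G z)"
proof
  show "c > 1" by (rule c_gt)
  show "((\<lambda>z. - F z) has_field_derivative - G z) (at z)" for z
    by (rule DERIV_minus[OF F_deriv])
  show "((\<lambda>z. (z\<^sup>2 - 1) * - G z) has_field_derivative
      (of_real k - of_real (c\<^sup>2) * (z\<^sup>2 - 1)) * - F z) (at z)" for z
    using DERIV_minus[OF pG_deriv[of z]] by simp
  show "- F (cnj z) = cnj (- F z)" for z by (simp add: F_cnj)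
qed

end

text \<open>Replacing F by -F reverses the sign of the expression, so its square reduces to the case
  f 1 > 0.\<close>

lemma (in spheroidal) pole_expansion_error_general:
  fixes t :: real and lam :: complex
  defines "Z \<equiv> {s\<in>{-1<..<1}. f s = 0}"
  assumes k: "k > 0"
    and F_int: "\<And>z. lam * F z = integral {-1..1} (\<lambda>t. F (of_real t) * exp (\<i> * of_real c * z * of_real t))"
    and parity: "(\<forall>z. F (- z) = F z) \<or> (\<forall>z. F (- z) = - F z)"
    and lam: "lam \<noteq> 0"
    and fin: "finite Z" and simple: "\<And>s. s \<in> Z \<Longrightarrow> g s \<noteq> 0"
    and t: "t \<in> {-1<..<1}" and ft: "f t \<noteq> 0" and f1: "(f 1)\<^sup>2 \<ge> 1/2"
  shows "(1 / f t - (\<Sum>s\<in>Z. 1 / (g s * (t - s))))\<^sup>2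
    \<le> 62 * (sqrt (c\<^sup>2 + 2 * k) + pi / sqrt 2) * (norm lam)\<^sup>2"
proof (cases "f 1 > 0")
  case True
  show ?thesis
    unfolding Z_def using assms True by (intro pole_expansion_error_of_pos) auto
next
  case False
  interpret M: spheroidal c k "\<lambda>z. - F z" "\<lambda>z. - G z" by (rule spheroidal_minus)
  have Mf: "M.f x = - f x" and Mg: "M.g x = - g x" for x
    by (simp_all add: M.f_def f_def M.g_def g_def)
  have f1n: "f 1 < 0" using False f1 by (cases "f 1 = 0") auto
  have "(1 / M.f t - (\<Sum>s\<in>{s\<in>{-1<..<1}. M.f s = 0}. 1 / (M.g s * (t - s))))\<^sup>2
    \<le> 62 * (sqrt (c\<^sup>2 + 2 * k) + pi / sqrt 2) * (norm lam)\<^sup>2"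
  proof (rule M.pole_expansion_error_of_pos[OF k])
    show "lam * - F z = integral {-1..1} (\<lambda>t. - F (of_real t) * exp (\<i> * of_real c * z * of_real t))" for z
      using F_int[of z] by simp
  qed (use parity lam fin simple t ft f1 f1n in \<open>auto simp: Mf Mg Z_def\<close>)
  moreover have "1 / M.f t - (\<Sum>s\<in>{s\<in>{-1<..<1}. M.f s = 0}. 1 / (M.g s * (t - s)))
    = - (1 / f t - (\<Sum>s\<in>Z. 1 / (g s * (t - s))))"
    by (simp add: Mf Mg Z_def sum_negf)
  ultimately show ?thesis by (simp only: power2_minus)
qed

section \<open>Entire extension of the eigenfunctions\<close>

text \<open>Carries the differential equation, the reflection symmetry and the parity from (-1,1) to
  the whole plane.\<close>

lemma entire_eq_zero_if_zero_on_interval: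
  assumes "h holomorphic_on UNIV" "\<And>x. x \<in> {-1<..<1} \<Longrightarrow> h (complex_of_real x) = 0"
  shows "h z = 0"
proof -
  have "(0::complex) islimpt of_real ` {-1<..<1}"
    unfolding islimpt_approachable
  proof (intro allI impI)
    fix e :: real assume "e > 0"
    define s where "s = min (1/2) (e / 2)"
    have "s > 0" "s < 1" "s < e" using \<open>e > 0\<close> by (auto simp: s_def)
    then show "\<exists>x'\<in>of_real ` {-1<..<1}. x' \<noteq> (0::complex) \<and> dist x' 0 < e"
      by (intro bexI[of _ "of_real s"]) auto
  qed
  then show ?thesis
    using analytic_continuation[of h UNIV "of_real ` {-1<..<1}" 0 z] assms by blast
qed

lemma deriv_on_interval:
  fixes h :: "real \<Rightarrow> real" and H H' :: "complex \<Rightarrow> complex"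
  assumes H: "\<And>z. (H has_field_derivative H' z) (at z)"
    and eq: "\<And>x. x \<in> {-1<..<1} \<Longrightarrow> H (of_real x) = of_real (h x)"
    and x: "x \<in> {-1<..<1}" and h: "h differentiable (at x)"
  shows "H' (of_real x) = of_real (deriv h x)"
proof -
  have "(h has_real_derivative deriv h x) (at x)"
    using h by (simp add: DERIV_deriv_iff_real_differentiable)
  then have "((\<lambda>x. complex_of_real (h x)) has_vector_derivative of_real (deriv h x)) (at x)"
    using has_vector_derivative_of_real by blast
  moreover have "((\<lambda>x. complex_of_real (h x)) has_vector_derivative H' (of_real x)) (at x)"
  proof (rule has_vector_derivative_transform_within_open[where f = "\<lambda>x. H (of_real x)" and S = "{-1<..<1}"])
    show "((\<lambda>x. H (of_real x)) has_vector_derivative H' (of_real x)) (at x)"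
      by (rule has_vector_derivative_real_field[OF H])
  qed (use x eq in auto)
  ultimately show ?thesis by (rule vector_derivative_unique_at[symmetric])
qed

text \<open>The right-hand side of the eigenvalue equation makes sense for complex arguments and
  extends the eigenfunction to an entire function.\<close>
lemma eigenfunction_extension:
  fixes c chi :: real and \<phi> :: "real \<Rightarrow> real" and lam :: complex and n :: nat
  assumes c: "c > 1" and cont: "continuous_on {-1..1} \<phi>"
    and eig: "\<And>x. x \<in> {-1..1} \<Longrightarrow> finite_fourier c \<phi> x = lam * complex_of_real (\<phi> x)"
    and lam: "lam \<noteq> 0"
    and par: "\<And>x. x \<in> {-1..1} \<Longrightarrow> \<phi> (- x) = (-1) ^ n * \<phi> x"
    and diff: "\<And>x. x \<in> {-1<..<1} \<Longrightarrow> \<phi> differentiable (at x)"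
      "\<And>x. x \<in> {-1<..<1} \<Longrightarrow> deriv \<phi> differentiable (at x)"
    and ode: "\<And>x. x \<in> {-1<..<1} \<Longrightarrow> (1 - x\<^sup>2) * deriv (deriv \<phi>) x - 2 * x * deriv \<phi> x
             + (chi - c\<^sup>2 * x\<^sup>2) * \<phi> x = 0"
  obtains F G where "spheroidal c (chi - c\<^sup>2) F G"
    "\<And>x. x \<in> {-1..1} \<Longrightarrow> spheroidal.f F x = \<phi> x"
    "\<And>x. x \<in> {-1<..<1} \<Longrightarrow> spheroidal.g G x = deriv \<phi> x"
    "\<And>z. lam * F z = integral {-1..1} (\<lambda>t. F (of_real t) * exp (\<i> * of_real c * z * of_real t))"
    "(\<forall>z. F (- z) = F z) \<or> (\<forall>z. F (- z) = - F z)"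
proof -
  define E where "E = (\<lambda>z t. of_real (\<phi> t) * exp (\<i> * of_real c * z * complex_of_real t))"
  define E' where "E' = (\<lambda>z t. of_real (\<phi> t) * (exp (\<i> * of_real c * z * complex_of_real t) * (\<i> * of_real c * complex_of_real t)))"
  define F where "F = (\<lambda>z. integral {-1..1} (E z) / lam)"
  have c\<phi>: "continuous_on {-1..1} (\<lambda>t. complex_of_real (\<phi> t))" using cont by (intro continuous_intros)
  have hol0: "((\<lambda>z. integral (cbox (-1) 1) (E z)) has_field_derivative integral (cbox (-1) 1) (E' z)) (at z within UNIV)" for z
  proof (rule leibniz_rule_field_derivative)
    show "((\<lambda>z. E z t) has_field_derivative E' z t) (at z within UNIV)" for z t
      unfolding E_def E'_def by (auto intro!: derivative_eq_intros)
    show "E z integrable_on cbox (-1) 1" for z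
      unfolding E_def cbox_interval by (intro integrable_continuous_interval continuous_intros c\<phi>)
    have "continuous_on (UNIV \<times> {-1..1}) (\<lambda>x::complex \<times> real. \<phi> (snd x))"
      by (rule continuous_on_compose2[OF cont continuous_on_snd[OF continuous_on_id]]) auto
    then show "continuous_on (UNIV \<times> cbox (-1) 1) (\<lambda>(z, t). E' z t)"
      unfolding E'_def cbox_interval split_def by (intro continuous_intros)
  qed auto
  define G where "G = deriv F"
  define G' where "G' = deriv G"
  have Fhol: "F holomorphic_on A" for A
  proof -
    have "(\<lambda>z. integral {-1..1} (E z)) holomorphic_on A"
      using hol0 unfolding cbox_interval holomorphic_on_def field_differentiable_def
      by (metis has_field_derivative_at_within)
    then show ?thesis unfolding F_def using lam by (intro holomorphic_intros) auto
  qed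
  have Fd: "(F has_field_derivative G z) (at z)" for z
    unfolding G_def using holomorphic_derivI[OF Fhol[of UNIV] open_UNIV UNIV_I] by simp
  have Ghol: "G holomorphic_on A" for A
    unfolding G_def using holomorphic_deriv[OF Fhol[of UNIV] open_UNIV] holomorphic_on_subset by blast
  have Gd: "(G has_field_derivative G' z) (at z)" for z
    unfolding G'_def using holomorphic_derivI[OF Ghol[of UNIV] open_UNIV UNIV_I] by simp
  have G'hol: "G' holomorphic_on A" for A
    unfolding G'_def using holomorphic_deriv[OF Ghol[of UNIV] open_UNIV] holomorphic_on_subset by blast
  have F\<phi>: "F (of_real x) = of_real (\<phi> x)" if "x \<in> {-1..1}" for x
  proof -
    have "integral {-1..1} (E (of_real x)) = finite_fourier c \<phi> x"
      unfolding finite_fourier_def E_def by (simp add: mult_ac)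
    then show ?thesis using eig[OF that] lam by (simp add: F_def)
  qed
  have G\<phi>: "G (of_real x) = of_real (deriv \<phi> x)" if "x \<in> {-1<..<1}" for x
    by (rule deriv_on_interval[OF Fd _ that diff(1)[OF that]]) (use F\<phi> in auto)
  have G'\<phi>: "G' (of_real x) = of_real (deriv (deriv \<phi>) x)" if "x \<in> {-1<..<1}" for x
    by (rule deriv_on_interval[OF Gd _ that diff(2)[OF that]]) (use G\<phi> in auto)
  have ODE: "(z\<^sup>2 - 1) * G' z + 2 * z * G z = (of_real (chi - c\<^sup>2) - of_real (c\<^sup>2) * (z\<^sup>2 - 1)) * F z" for z
  proof -
    define W where "W = (\<lambda>z. (z\<^sup>2 - 1) * G' z + 2 * z * G z - (of_real (chi - c\<^sup>2) - of_real (c\<^sup>2) * (z\<^sup>2 - 1)) * F z)"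
    have "W z = 0"
    proof (rule entire_eq_zero_if_zero_on_interval[where h = W])
      show "W holomorphic_on UNIV"
        unfolding W_def by (intro holomorphic_intros Fhol Ghol G'hol)
      fix x :: real assume x: "x \<in> {-1<..<1}"
      have "W (of_real x) = of_real ((x\<^sup>2 - 1) * deriv (deriv \<phi>) x + 2 * x * deriv \<phi> x - (chi - c\<^sup>2 - c\<^sup>2 * (x\<^sup>2 - 1)) * \<phi> x)"
        using x by (simp add: W_def F\<phi> G\<phi> G'\<phi>)
      also have "(x\<^sup>2 - 1) * deriv (deriv \<phi>) x + 2 * x * deriv \<phi> x - (chi - c\<^sup>2 - c\<^sup>2 * (x\<^sup>2 - 1)) * \<phi> x = 0"
        using ode[OF x] by (simp add: algebra_simps)
      finally show "W (of_real x) = 0" by simp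
    qed
    then show ?thesis by (simp add: W_def)
  qed
  have Fcnj: "F (cnj z) = cnj (F z)" for z
  proof -
    have "(cnj \<circ> F \<circ> cnj) holomorphic_on UNIV"
      using Fd has_field_derivative_cnj_cnj unfolding holomorphic_on_def field_differentiable_def by fastforce
    then have hol: "(\<lambda>z. (cnj \<circ> F \<circ> cnj) z - F z) holomorphic_on UNIV"
      by (rule holomorphic_on_diff[OF _ Fhol])
    have "(cnj \<circ> F \<circ> cnj) z - F z = 0"
      by (rule entire_eq_zero_if_zero_on_interval[OF hol]) (simp add: F\<phi>)
    then have "cnj (F (cnj z)) = F z" by simp
    then show ?thesis by (metis complex_cnj_cnj)
  qed
  have Fpar: "F (- z) - (-1) ^ n * F z = 0" for z
  proof (rule entire_eq_zero_if_zero_on_interval[where h = "\<lambda>z. F (- z) - (-1) ^ n * F z"])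
    have "(F \<circ> uminus) holomorphic_on UNIV"
      by (rule holomorphic_on_compose[OF _ Fhol]) (intro holomorphic_intros)
    then show "(\<lambda>z. F (- z) - (-1) ^ n * F z) holomorphic_on UNIV"
      unfolding o_def by (intro holomorphic_intros Fhol)
    fix x :: real assume x: "x \<in> {-1<..<1}"
    have "F (- of_real x) = of_real (\<phi> (- x))" using F\<phi>[of "- x"] x by simp
    then show "F (- of_real x) - (-1) ^ n * F (of_real x) = 0" using F\<phi>[of x] par[of x] x by simp
  qed
  have sph: "spheroidal c (chi - c\<^sup>2) F G"
  proof
    fix z
    have "((\<lambda>z. (z\<^sup>2 - 1) * G z) has_field_derivative (z\<^sup>2 - 1) * G' z + 2 * z * G z) (at z)"
      by (auto intro!: derivative_eq_intros Gd)
    then show "((\<lambda>z. (z\<^sup>2 - 1) * G z) has_field_derivative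
      (of_real (chi - c\<^sup>2) - of_real (c\<^sup>2) * (z\<^sup>2 - 1)) * F z) (at z)" by (simp only: ODE)
  qed (use c Fd Fcnj in auto)
  then interpret spheroidal c "chi - c\<^sup>2" F G .
  show ?thesis
  proof
    show "spheroidal c (chi - c\<^sup>2) F G" by (rule sph)
    show "f x = \<phi> x" if "x \<in> {-1..1}" for x using F\<phi>[OF that] by (simp add: f_def)
    show "g x = deriv \<phi> x" if "x \<in> {-1<..<1}" for x using G\<phi>[OF that] by (simp add: g_def)
    show "lam * F z = integral {-1..1} (\<lambda>t. F (of_real t) * exp (\<i> * of_real c * z * of_real t))" for z
    proof -
      have "lam * F z = integral {-1..1} (E z)" using lam by (simp add: F_def)
      also have "\<dots> = integral {-1..1} (\<lambda>t. F (of_real t) * exp (\<i> * of_real c * z * of_real t))"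
        by (rule integral_cong) (simp add: E_def F\<phi>)
      finally show ?thesis .
    qed
    show "(\<forall>z. F (- z) = F z) \<or> (\<forall>z. F (- z) = - F z)"
    proof -
      have "F (- z) = (-1) ^ n * F z" for z using Fpar[of z] by simp
      then show ?thesis by (cases "even n") auto
    qed
  qed
qed

theorem theorem58:
  fixes c :: real and psi :: "nat \<Rightarrow> real \<Rightarrow> real" and lam :: "nat \<Rightarrow> complex"
    and chi :: "nat \<Rightarrow> real" and n :: nat and t :: real
  assumes "c > 30"
    and "pswf_system c psi lam chi"
    and "n > 0"
    and "real n > 2 * c / pi + 5"
    and "t \<in> {-1<..<1}"
    and "psi n t \<noteq> 0"
  shows "\<bar>1 / psi n t - (\<Sum>s\<in>{s\<in>{-1<..<1}. psi n s = 0}. 1 / (deriv (psi n) s * (t - s)))\<bar>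
         \<le> norm (lam n) * (24 * ln (2 / norm (lam n)) + 13 * chi n powr (1/4)
              + 40 * c * norm (lam n) + 2 * sqrt 2)"
proof -
  define \<phi> where "\<phi> = psi n"
  define l where "l = lam n"
  define Z where "Z = {s\<in>{-1<..<1}. \<phi> s = 0}"
  have sys: "continuous_on {-1..1} \<phi>" "\<And>x. x \<in> {-1..1} \<Longrightarrow> finite_fourier c \<phi> x = l * complex_of_real (\<phi> x)"
    "l \<noteq> 0" "integral {-1..1} (\<lambda>t. (\<phi> t)\<^sup>2) = 1"
    "\<And>x. x \<in> {-1..1} \<Longrightarrow> \<phi> (- x) = (-1) ^ n * \<phi> x" "finite Z" "card Z = n"
    "\<And>x. x \<in> {-1<..<1} \<Longrightarrow> \<phi> differentiable (at x)" "\<And>x. x \<in> {-1<..<1} \<Longrightarrow> deriv \<phi> differentiable (at x)"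
    "\<And>s. s \<in> Z \<Longrightarrow> deriv \<phi> s \<noteq> 0"
    "\<And>x. x \<in> {-1<..<1} \<Longrightarrow> (1 - x\<^sup>2) * deriv (deriv \<phi>) x - 2 * x * deriv \<phi> x
             + (chi n - c\<^sup>2 * x\<^sup>2) * \<phi> x = 0"
    using assms(2) unfolding pswf_system_def Z_def \<phi>_def l_def by auto
  have c1: "c > 1" using assms(1) by simp
  obtain F G where sph: "spheroidal c (chi n - c\<^sup>2) F G"
    and F\<phi>: "\<And>x. x \<in> {-1..1} \<Longrightarrow> spheroidal.f F x = \<phi> x"
    and G\<phi>: "\<And>x. x \<in> {-1<..<1} \<Longrightarrow> spheroidal.g G x = deriv \<phi> x"
    and F_int: "\<And>z. l * F z = integral {-1..1} (\<lambda>t. F (of_real t) * exp (\<i> * of_real c * z * of_real t))"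
    and parity: "(\<forall>z. F (- z) = F z) \<or> (\<forall>z. F (- z) = - F z)"
    using eigenfunction_extension[OF c1 sys(1,2,3,5,8,9,11)] by blast
  interpret spheroidal c "chi n - c\<^sup>2" F G by (rule sph)
  have Zf: "Z = {s\<in>{-1<..<1}. f s = 0}" using F\<phi> by (auto simp: Z_def)
  have ft: "f t \<noteq> 0" using assms(5,6) F\<phi>[of t] by (simp add: \<phi>_def)
  \<comment> \<open>If k <= 0, parity and the zero count on (0,1) give n <= 2 ((c + 7/4)/pi + 1) +
    1, which is below 2 c/pi + 5 because 7/(4 pi) <= 1.\<close>
  have k: "chi n - c\<^sup>2 > 0"
  proof (rule ccontr)
    assume k0: "\<not> ?thesis"
    define Zp where "Zp = {s\<in>{0<..<1}. \<phi> s = 0}"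
    have "Zp \<subseteq> Z" by (auto simp: Zp_def Z_def)
    then have fin: "finite Zp" using sys(6) finite_subset by blast
    have "Z \<subseteq> Zp \<union> uminus ` Zp \<union> {0}"
    proof
      fix s assume s: "s \<in> Z"
      consider "s > 0" | "s = 0" | "s < 0" by linarith
      then show "s \<in> Zp \<union> uminus ` Zp \<union> {0}"
      proof cases
        case 3
        then have "- s \<in> Zp" using s sys(5)[of s] by (auto simp: Zp_def Z_def)
        then show ?thesis by (metis UnI1 UnI2 imageI minus_minus)
      qed (use s in \<open>auto simp: Zp_def Z_def\<close>)
    qed
    then have "card Z \<le> card (Zp \<union> uminus ` Zp \<union> {0})" using fin by (intro card_mono) auto
    also have "\<dots> \<le> card Zp + card (uminus ` Zp) + card {0::real}"
      by (meson add_right_mono card_Un_le order_trans)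
    also have "card (uminus ` Zp) = card Zp" by (rule card_image) simp
    finally have "real n \<le> 2 * real (card Zp) + 1" using sys(7) by simp
    moreover have "real (card Zp) \<le> (c + 7/4) / pi + 1"
      using k0 ft fin F\<phi> by (intro card_zeros_le[of t]) (auto simp: Zp_def)
    moreover have "(c + 7/4) / pi = c / pi + 7/4 / pi" by (rule add_divide_distrib)
    moreover have "7/4 / pi \<le> 1" using pi_gt3 by (simp add: divide_le_eq)
    ultimately show False using assms(4) by linarith
  qed
  have f_le: "(f x)\<^sup>2 \<le> (f 1)\<^sup>2" if "x \<in> {-1..1}" for x
  proof -
    have "(f x)\<^sup>2 = (f \<bar>x\<bar>)\<^sup>2"
      using that sys(5)[of x] F\<phi>[of x] F\<phi>[of "- x"] by (cases "even n") (auto simp: abs_if)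
    then show ?thesis using f_sq_le[OF k, of "\<bar>x\<bar>"] that by auto
  qed
  \<comment> \<open>The mean of \<phi>^2 over [-1,1] is 1/2, and (f 1)^2 is its maximum.\<close>
  have f1: "(f 1)\<^sup>2 \<ge> 1/2"
  proof -
    have "integral {-1..1} (\<lambda>t. (\<phi> t)\<^sup>2) \<le> integral {-1..1} (\<lambda>t::real. (f 1)\<^sup>2)"
    proof (rule integral_le)
      show "(\<lambda>t. (\<phi> t)\<^sup>2) integrable_on {-1..1}"
        by (intro integrable_continuous_interval continuous_intros sys(1))
      show "(\<phi> x)\<^sup>2 \<le> (f 1)\<^sup>2" if "x \<in> {-1..1}" for x using f_le[OF that] F\<phi>[OF that] by simp
    qed auto
    then show ?thesis using sys(4) by simp
  qed
  have l0: "norm l > 0" using sys(3) by simp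
  \<comment> \<open>The eigenvalue equation at z = 1, where |f| is maximal on [-1,1], bounds
    |\<lambda>| by the length of the interval.\<close>
  have l2: "norm l \<le> 2"
  proof -
    have "norm (F (of_real x)) \<le> \<bar>f 1\<bar>" if "x \<in> {-1..1}" for x
      using f_le[OF that] by (simp add: F_of_real abs_le_square_iff)
    moreover have "continuous_on UNIV F"
      using F_holomorphic holomorphic_on_imp_continuous_on by blast
    ultimately have "norm (l * F 1) \<le> 2 * \<bar>f 1\<bar> * exp (c * \<bar>Im 1\<bar>)"
      unfolding F_int using c1 by (intro norm_fourier_integral_le) auto
    moreover have "F 1 = of_real (f 1)" using F_of_real[of 1] by simp
    ultimately have "norm l * \<bar>f 1\<bar> \<le> 2 * \<bar>f 1\<bar>" by (simp add: norm_mult)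
    moreover have "\<bar>f 1\<bar> > 0" using f1 by (cases "f 1 = 0") auto
    ultimately show ?thesis by simp
  qed
  define I where "I = 1 / \<phi> t - (\<Sum>s\<in>Z. 1 / (deriv \<phi> s * (t - s)))"
  define X where "X = chi n"
  have X: "X > c\<^sup>2" using k by (simp add: X_def)
  have c2: "c\<^sup>2 > 900"
  proof -
    have "30 * 30 < c * c" using assms(1) by (intro mult_strict_mono) auto
    then show ?thesis by (simp add: power2_eq_square)
  qed
  have "(1 / f t - (\<Sum>s\<in>Z. 1 / (g s * (t - s))))\<^sup>2
    \<le> 62 * (sqrt (c\<^sup>2 + 2 * (chi n - c\<^sup>2)) + pi / sqrt 2) * (norm l)\<^sup>2"
    unfolding Zf
  proof (rule pole_expansion_error_general[OF k F_int parity sys(3)])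
    show "g s \<noteq> 0" if "s \<in> {s\<in>{-1<..<1}. f s = 0}" for s
      using that G\<phi>[of s] sys(10)[of s] unfolding Zf by auto
  qed (use sys(6) assms(5) ft f1 Zf in auto)
  moreover have "1 / f t - (\<Sum>s\<in>Z. 1 / (g s * (t - s))) = I"
    using assms(5) F\<phi> G\<phi> unfolding I_def by (auto simp: Z_def intro!: sum.cong arg_cong2[of _ _ _ _ "(-)"])
  ultimately have "I\<^sup>2 \<le> 62 * (sqrt (c\<^sup>2 + 2 * (X - c\<^sup>2)) + pi / sqrt 2) * (norm l)\<^sup>2" by (simp add: X_def)
  \<comment> \<open>Since w >= 30, the summand pi / sqrt 2 <= 4 is absorbed in (sqrt 2 - 1) w, and
    sqrt 2 w = sqrt (4 X - 2 c^2) <= 2 sqrt X.\<close>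
  also have "\<dots> \<le> 62 * (2 * sqrt X) * (norm l)\<^sup>2"
  proof (intro mult_right_mono mult_left_mono)
    define w where "w = sqrt (c\<^sup>2 + 2 * (X - c\<^sup>2))"
    have "sqrt 900 \<le> w" unfolding w_def using X c2 by (intro real_sqrt_le_mono) auto
    moreover have "sqrt 900 = (30::real)" by (rule real_sqrt_unique) auto
    ultimately have w30: "w \<ge> 30" by simp
    have "pi / sqrt 2 \<le> 4 / 1" using pi_less_4 by (intro frac_le) auto
    then have "w + pi / sqrt 2 \<le> sqrt 2 * w"
    proof -
      have "sqrt 2 \<ge> 14/10" by (rule real_le_rsqrt) (simp add: power2_eq_square)
      then have "14/10 * w \<le> sqrt 2 * w" using w30 by (intro mult_right_mono) auto
      then show ?thesis using w30 \<open>pi / sqrt 2 \<le> 4 / 1\<close> by linarith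
    qed
    also have "sqrt 2 * w = sqrt (2 * (c\<^sup>2 + 2 * (X - c\<^sup>2)))" unfolding w_def by (rule real_sqrt_mult[symmetric])
    also have "\<dots> \<le> sqrt (4 * X)" using c2 by (intro real_sqrt_le_mono) simp
    also have "\<dots> = 2 * sqrt X" by (simp add: real_sqrt_mult)
    finally show "sqrt (c\<^sup>2 + 2 * (X - c\<^sup>2)) + pi / sqrt 2 \<le> 2 * sqrt X" by (simp add: w_def)
  qed auto
  \<comment> \<open>62 * 2 = 124 is at most 169 = 13^2.\<close>
  also have "\<dots> \<le> 169 * sqrt X * (norm l)\<^sup>2" using X c2 by (intro mult_right_mono) auto
  also have "\<dots> = (norm l * (13 * X powr (1/4)))\<^sup>2"
  proof -
    have "(X powr (1/4))\<^sup>2 = sqrt X"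
      using X c2 by (simp add: power2_eq_square powr_add[symmetric] powr_half_sqrt)
    then show ?thesis by (simp add: power_mult_distrib)
  qed
  finally have "\<bar>I\<bar> \<le> \<bar>norm l * (13 * X powr (1/4))\<bar>" by (rule abs_le_square_iff[THEN iffD2])
  then have "\<bar>I\<bar> \<le> norm l * (13 * X powr (1/4))" by simp
  also have "\<dots> \<le> norm l * (24 * ln (2 / norm l) + 13 * X powr (1/4) + 40 * c * norm l + 2 * sqrt 2)"
  proof (intro mult_left_mono)
    have "ln (2 / norm l) \<ge> 0" using l0 l2 by (intro ln_ge_zero) simp
    moreover have "40 * c * norm l \<ge> 0" using c1 by simp
    ultimately show "13 * X powr (1/4) \<le> 24 * ln (2 / norm l) + 13 * X powr (1/4) + 40 * c * norm l + 2 * sqrt 2"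
      by (simp add: add_nonneg_nonneg)
  qed simp
  finally show ?thesis unfolding I_def X_def l_def Z_def \<phi>_def .
qed

end
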